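(* Let $\{\mathcal{F}_{(s:t)}\}$ be a Veronese web on $\mathbb{R}^2$. Then the union of all leaves of all foliations of the web is a projective structure, namely the one defined by the associated connection $\nabla^{\mathcal{F}}$; that is, the set of all leaves of all the foliations $\mathcal{F}_{(s:t)}$, $(s:t)\in\mathbb{R}P^1$, is the set of (maximal) unparametrised geodesics of $\nabla^{\mathcal{F}}$. Moreover, if the web is given by $T\mathcal{F}_t=\ker(t_0w_x\,dx+t\,w_y\,dy)$ in coordinates $(x,y)$, where $t_0\neq0$ is a constant and $w=w(x,y)$ is a function with $w_x,w_y$ nowhere zero, then the second order ODE corresponding to this projective structure (the one whose solutions $x\mapsto(x,y(x))$ are the geodesics) is $$y''=\frac{1}{w_xw_y}\Big((w_yw_{xx}-w_xw_{xy})\,y'+(w_yw_{xy}-w_xw_{yy})\,(y')^2\Big).$$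
   Context: Everything is smooth. A projective structure is the set of unparametrised geodesics of a linear connection. A Veronese web on $\mathbb{R}^2$ is a family $\{\mathcal{F}_{(s:t)}\}_{(s:t)\in\mathbb{R}P^1}$ of one-dimensional foliations such that every point has a neighbourhood $U$ with pointwise linearly independent one-forms $\omega_0,\omega_1$ on $U$ satisfying $T\mathcal{F}_{(s:t)}|_U=\ker(s\omega_0+t\omega_1)$ for all $(s:t)\in\mathbb{R}P^1$. One writes $\mathcal{F}_t=\mathcal{F}_{(1:t)}$ for $t\in\mathbb{R}$ and $\mathcal{F}_\infty=\mathcal{F}_{(0:1)}$. The associated connection $\nabla^{\mathcal{F}}$ is defined as follows. Fix $t_0\in\mathbb{R}\setminus\{0\}$. Near any point there are local coordinates $(x,y)$ and a function $w$ with $w_x,w_y$ nowhere zero such that $T\mathcal{F}_0=\ker dx$, $T\mathcal{F}_\infty=\ker dy$, $T\mathcal{F}_{t_0}=\ker dw$, and then $T\mathcal{F}_t=\ker(t_0w_x\,dx+t\,w_y\,dy)$ for all $t$. In such coordinates $$\nabla^{\mathcal{F}}_{\partial_x}\partial_x=\frac{w_yw_{xx}-w_xw_{xy}}{w_xw_y}\,\partial_x,\quad \nabla^{\mathcal{F}}_{\partial_y}\partial_y=\frac{w_xw_{yy}-w_yw_{xy}}{w_xw_y}\,\partial_y,\quad \nabla^{\mathcal{F}}_{\partial_x}\partial_y=\nabla^{\mathcal{F}}_{\partial_y}\partial_x=0,$$ independently of the choices of $t_0$, $(x,y)$ and $w$. *)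

theory Defs
  imports "HOL-Analysis.Analysis" "HOL-Library.Disjoint_Sets"
begin

section \<open>Smooth maps and local coordinates\<close>

text \<open>Both notions are meant for open sets \<open>S\<close>.\<close>

primrec times_differentiable_on ::
  "nat \<Rightarrow> 'a set \<Rightarrow> ('a::real_normed_vector \<Rightarrow> 'b::real_normed_vector) \<Rightarrow> bool" where
  "times_differentiable_on 0 S f \<longleftrightarrow> continuous_on S f"
| "times_differentiable_on (Suc n) S f \<longleftrightarrow>
     (\<forall>x\<in>S. f differentiable (at x)) \<and>
     (\<forall>v. times_differentiable_on n S (\<lambda>x. frechet_derivative f (at x) v))"

definition smooth_on :: "'a set \<Rightarrow> ('a::real_normed_vector \<Rightarrow> 'b::real_normed_vector) \<Rightarrow> bool" where
  "smooth_on S f \<longleftrightarrow> (\<forall>n. times_differentiable_on n S f)"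

type_synonym plane = "real \<times> real"

definition coordinates_on :: "plane set \<Rightarrow> (plane \<Rightarrow> plane) \<Rightarrow> bool" where
  "coordinates_on U \<phi> \<longleftrightarrow>
     open U \<and> inj_on \<phi> U \<and> smooth_on U \<phi> \<and>
     open (\<phi> ` U) \<and> smooth_on (\<phi> ` U) (inv_into U \<phi>)"

text \<open>
  For coordinates \<open>\<phi> = (x, y)\<close> on \<open>U\<close>, the coordinate vector field
  \<open>\<partial>\<^sub>x\<close> is \<open>coord_field U \<phi> (1, 0)\<close> and \<open>\<partial>\<^sub>y\<close> is \<open>coord_field U \<phi> (0, 1)\<close>;
  \<open>partial_x U \<phi> f\<close> is the function \<open>f\<^sub>x = df(\<partial>\<^sub>x)\<close> on \<open>U\<close>.
\<close>

definition coord_field :: "plane set \<Rightarrow> (plane \<Rightarrow> plane) \<Rightarrow> plane \<Rightarrow> plane \<Rightarrow> plane" where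
  "coord_field U \<phi> e q = frechet_derivative (inv_into U \<phi>) (at (\<phi> q)) e"

definition partial_x :: "plane set \<Rightarrow> (plane \<Rightarrow> plane) \<Rightarrow> (plane \<Rightarrow> real) \<Rightarrow> plane \<Rightarrow> real" where
  "partial_x U \<phi> f q = frechet_derivative f (at q) (coord_field U \<phi> (1, 0) q)"

definition partial_y :: "plane set \<Rightarrow> (plane \<Rightarrow> plane) \<Rightarrow> (plane \<Rightarrow> real) \<Rightarrow> plane \<Rightarrow> real" where
  "partial_y U \<phi> f q = frechet_derivative f (at q) (coord_field U \<phi> (0, 1) q)"


section \<open>One-dimensional foliations of the plane\<close>

text \<open>
  A foliation is given by its set of leaves: a partition of the plane which in suitable
  coordinates around every point looks like the partition into horizontal lines.
  Leaves are connected in their own (leaf) topology.  In the subspace topology this becomes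
  path-connectedness: mere connectedness would also admit the union of a leaf with another
  leaf on which it accumulates.
\<close>

definition foliation :: "plane set set \<Rightarrow> bool" where
  "foliation F \<longleftrightarrow>
     partition_on UNIV F \<and>
     (\<forall>L\<in>F. path_connected L) \<and>
     (\<forall>p. \<exists>U \<phi> a b. p \<in> U \<and> coordinates_on U \<phi> \<and> \<phi> ` U = box a b \<and>
        (\<forall>L\<in>F. \<forall>C\<in>components (U \<inter> L). \<exists>c. C = {q\<in>U. snd (\<phi> q) = c}))"

definition tangent_space :: "plane set set \<Rightarrow> plane \<Rightarrow> plane set" where
  "tangent_space F p =
     {v. \<exists>\<gamma> e. e > 0 \<and> smooth_on {-e<..<e} \<gamma> \<and> (\<exists>L\<in>F. \<gamma> ` {-e<..<e} \<subseteq> L) \<and>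
           \<gamma> 0 = p \<and> (\<gamma> has_vector_derivative v) (at (0::real))}"


section \<open>Veronese webs\<close>

text \<open>The real projective line, as the set of lines through the origin in the plane.\<close>

definition RP1 :: "plane set set" where
  "RP1 = {l. subspace l \<and> dim l = 1}"

definition proj_point :: "real \<Rightarrow> real \<Rightarrow> plane set" where
  "proj_point s t = span {(s, t)}"

definition veronese_web :: "(plane set \<Rightarrow> plane set set) \<Rightarrow> bool" where
  "veronese_web F \<longleftrightarrow>
     (\<forall>l\<in>RP1. foliation (F l)) \<and>
     (\<forall>p. \<exists>U. \<exists>\<omega>\<^sub>0 \<omega>\<^sub>1 :: plane \<Rightarrow> plane \<Rightarrow>\<^sub>L real.
        open U \<and> p \<in> U \<and> smooth_on U \<omega>\<^sub>0 \<and> smooth_on U \<omega>\<^sub>1 \<and>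
        (\<forall>q\<in>U. (\<forall>a b. a *\<^sub>R \<omega>\<^sub>0 q + b *\<^sub>R \<omega>\<^sub>1 q = 0 \<longrightarrow> a = 0 \<and> b = 0) \<and>
           (\<forall>s t. (s, t) \<noteq> (0, 0) \<longrightarrow>
              tangent_space (F (proj_point s t)) q =
                {v. blinfun_apply (s *\<^sub>R \<omega>\<^sub>0 q + t *\<^sub>R \<omega>\<^sub>1 q) v = 0})))"


section \<open>Linear connections, geodesics and projective structures\<close>

text \<open>
  On the plane every linear connection has the form
  \<open>\<nabla>\<^sub>X Y = D\<^sub>X Y + \<Gamma>(X, Y)\<close> for a unique smooth field \<open>\<Gamma>\<close> of bilinear maps (its Christoffel
  symbols in the standard coordinates), and we represent it by \<open>\<Gamma>\<close>.
\<close>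

type_synonym christoffel = "plane \<Rightarrow> plane \<Rightarrow>\<^sub>L plane \<Rightarrow>\<^sub>L plane"

definition linear_connection :: "christoffel \<Rightarrow> bool" where
  "linear_connection \<Gamma> \<longleftrightarrow> smooth_on UNIV \<Gamma>"

definition cov_deriv ::
  "christoffel \<Rightarrow> (plane \<Rightarrow> plane) \<Rightarrow> (plane \<Rightarrow> plane) \<Rightarrow> plane \<Rightarrow> plane" where
  "cov_deriv \<Gamma> X Y q =
     frechet_derivative Y (at q) (X q) + blinfun_apply (blinfun_apply (\<Gamma> q) (X q)) (Y q)"

definition open_interval :: "real set \<Rightarrow> bool" where
  "open_interval I \<longleftrightarrow> open I \<and> is_interval I \<and> I \<noteq> {}"

abbreviation velocity :: "(real \<Rightarrow> plane) \<Rightarrow> real \<Rightarrow> plane" where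
  "velocity \<gamma> \<tau> \<equiv> vector_derivative \<gamma> (at \<tau>)"

text \<open>Affinely parametrised, nonconstant geodesics: \<open>\<nabla>\<^bsub>\<gamma>'\<^esub> \<gamma>' = 0\<close>.\<close>

definition geodesic :: "christoffel \<Rightarrow> real set \<Rightarrow> (real \<Rightarrow> plane) \<Rightarrow> bool" where
  "geodesic \<Gamma> I \<gamma> \<longleftrightarrow>
     open_interval I \<and> smooth_on I \<gamma> \<and>
     (\<forall>\<tau>\<in>I. velocity \<gamma> \<tau> \<noteq> 0 \<and>
        vector_derivative (velocity \<gamma>) (at \<tau>) +
          blinfun_apply (blinfun_apply (\<Gamma> (\<gamma> \<tau>)) (velocity \<gamma> \<tau>)) (velocity \<gamma> \<tau>) = 0)"

definition maximal_geodesic :: "christoffel \<Rightarrow> real set \<Rightarrow> (real \<Rightarrow> plane) \<Rightarrow> bool" where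
  "maximal_geodesic \<Gamma> I \<gamma> \<longleftrightarrow>
     geodesic \<Gamma> I \<gamma> \<and>
     (\<forall>J \<eta>. geodesic \<Gamma> J \<eta> \<and> I \<subseteq> J \<and> (\<forall>\<tau>\<in>I. \<eta> \<tau> = \<gamma> \<tau>) \<longrightarrow> J = I)"

definition unparametrised_geodesics :: "christoffel \<Rightarrow> plane set set" where
  "unparametrised_geodesics \<Gamma> = {\<gamma> ` I |\<gamma> I. geodesic \<Gamma> I \<gamma>}"

definition maximal_unparametrised_geodesics :: "christoffel \<Rightarrow> plane set set" where
  "maximal_unparametrised_geodesics \<Gamma> = {\<gamma> ` I |\<gamma> I. maximal_geodesic \<Gamma> I \<gamma>}"

definition projective_structure :: "plane set set \<Rightarrow> bool" where
  "projective_structure P \<longleftrightarrow>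
     (\<exists>\<Gamma>. linear_connection \<Gamma> \<and> P = maximal_unparametrised_geodesics \<Gamma>)"

text \<open>
  \<open>y'' = G (x, y) y'\<close> is the second order ODE of the unparametrised geodesics of \<open>\<Gamma>\<close> in the
  coordinates \<open>\<phi>\<close> on \<open>U\<close>: a smooth function \<open>f\<close> whose graph lies in the coordinate domain is a
  solution iff its graph is an unparametrised geodesic.
\<close>

definition geodesic_ode ::
  "christoffel \<Rightarrow> plane set \<Rightarrow> (plane \<Rightarrow> plane) \<Rightarrow> (plane \<Rightarrow> real \<Rightarrow> real) \<Rightarrow> bool" where
  "geodesic_ode \<Gamma> U \<phi> G \<longleftrightarrow>
     (\<forall>I (f :: real \<Rightarrow> real).
        open_interval I \<and> smooth_on I f \<and> (\<forall>x\<in>I. (x, f x) \<in> \<phi> ` U) \<longrightarrow>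
        ((\<lambda>x. inv_into U \<phi> (x, f x)) ` I \<in> unparametrised_geodesics \<Gamma> \<longleftrightarrow>
         (\<forall>x\<in>I. deriv (deriv f) x = G (x, f x) (deriv f x))))"


section \<open>The connection associated with a Veronese web\<close>

definition adapted_coordinates ::
  "(plane set \<Rightarrow> plane set set) \<Rightarrow> real \<Rightarrow> plane set \<Rightarrow> (plane \<Rightarrow> plane) \<Rightarrow> (plane \<Rightarrow> real) \<Rightarrow> bool" where
  "adapted_coordinates F t\<^sub>0 U \<phi> w \<longleftrightarrow>
     coordinates_on U \<phi> \<and> smooth_on U w \<and>
     (\<forall>q\<in>U. partial_x U \<phi> w q \<noteq> 0 \<and> partial_y U \<phi> w q \<noteq> 0 \<and>
        tangent_space (F (proj_point 1 0)) q = {v. frechet_derivative (\<lambda>p. fst (\<phi> p)) (at q) v = 0} \<and>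
        tangent_space (F (proj_point 0 1)) q = {v. frechet_derivative (\<lambda>p. snd (\<phi> p)) (at q) v = 0} \<and>
        tangent_space (F (proj_point 1 t\<^sub>0)) q = {v. frechet_derivative w (at q) v = 0})"

definition is_associated_connection ::
  "(plane set \<Rightarrow> plane set set) \<Rightarrow> christoffel \<Rightarrow> bool" where
  "is_associated_connection F \<Gamma> \<longleftrightarrow>
     linear_connection \<Gamma> \<and>
     (\<forall>t\<^sub>0 U \<phi> w. t\<^sub>0 \<noteq> 0 \<and> adapted_coordinates F t\<^sub>0 U \<phi> w \<longrightarrow>
        (let X = coord_field U \<phi> (1, 0); Y = coord_field U \<phi> (0, 1);
             w_x = partial_x U \<phi> w; w_y = partial_y U \<phi> w;
             w_xx = partial_x U \<phi> w_x; w_xy = partial_y U \<phi> w_x; w_yy = partial_y U \<phi> w_y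
         in \<forall>q\<in>U.
           cov_deriv \<Gamma> X X q = ((w_y q * w_xx q - w_x q * w_xy q) / (w_x q * w_y q)) *\<^sub>R X q \<and>
           cov_deriv \<Gamma> Y Y q = ((w_x q * w_yy q - w_y q * w_xy q) / (w_x q * w_y q)) *\<^sub>R Y q \<and>
           cov_deriv \<Gamma> X Y q = 0 \<and>
           cov_deriv \<Gamma> Y X q = 0))"

definition associated_connection :: "(plane set \<Rightarrow> plane set set) \<Rightarrow> christoffel" where
  "associated_connection F = (THE \<Gamma>. is_associated_connection F \<Gamma>)"

definition web_given_by ::
  "(plane set \<Rightarrow> plane set set) \<Rightarrow> real \<Rightarrow> plane set \<Rightarrow> (plane \<Rightarrow> plane) \<Rightarrow> (plane \<Rightarrow> real) \<Rightarrow> bool" where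
  "web_given_by F t\<^sub>0 U \<phi> w \<longleftrightarrow>
     coordinates_on U \<phi> \<and> smooth_on U w \<and>
     (\<forall>q\<in>U. partial_x U \<phi> w q \<noteq> 0 \<and> partial_y U \<phi> w q \<noteq> 0 \<and>
        (\<forall>t. tangent_space (F (proj_point 1 t)) q =
           {v. t\<^sub>0 * partial_x U \<phi> w q * frechet_derivative (\<lambda>p. fst (\<phi> p)) (at q) v +
               t * partial_y U \<phi> w q * frechet_derivative (\<lambda>p. snd (\<phi> p)) (at q) v = 0}))"

definition web_ode_rhs ::
  "plane set \<Rightarrow> (plane \<Rightarrow> plane) \<Rightarrow> (plane \<Rightarrow> real) \<Rightarrow> plane \<Rightarrow> real \<Rightarrow> real" where
  "web_ode_rhs U \<phi> w z y' =
     (let q = inv_into U \<phi> z;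
          w_x = partial_x U \<phi> w; w_y = partial_y U \<phi> w;
          w_xx = partial_x U \<phi> w_x; w_xy = partial_y U \<phi> w_x; w_yy = partial_y U \<phi> w_y
      in 1 / (w_x q * w_y q) *
           ((w_y q * w_xx q - w_x q * w_xy q) * y' + (w_y q * w_xy q - w_x q * w_yy q) * y'\<^sup>2))"

end

theory Submission
  imports Defs
begin

text \<open>
  Locally the leaves are tangent to the kernels of \<open>s \<omega>\<^sub>0 + t \<omega>\<^sub>1\<close>, with \<open>(\<omega>\<^sub>0, \<omega>\<^sub>1)\<close> unique up to a common factor.  There
  is a unique torsion-free connection with \<open>\<nabla>\<omega>\<^sub>i = \<theta> \<otimes> \<omega>\<^sub>i\<close> for a common one-form \<open>\<theta>\<close> (the one with
  \<open>d\<omega>\<^sub>i = \<theta> \<and> \<omega>\<^sub>i\<close>); rescaling the frame only changes \<open>\<theta>\<close> by an exact form, so this connection is global,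
  and for \<open>\<omega>\<^sub>0 = t\<^sub>0 w\<^sub>x dx\<close>, \<open>\<omega>\<^sub>1 = w\<^sub>y dy\<close> it is given by the formulas for \<open>\<nabla>\<^bsup>\<F>\<^esup>\<close>.  Along a geodesic
  \<open>\<gamma>\<close> the functions \<open>\<omega>\<^sub>i(\<gamma>')\<close> solve the same equation \<open>h' = \<theta>(\<gamma>') h\<close>, so their ratio is constant and
  \<open>\<gamma>\<close> stays in one leaf of one foliation; conversely, a leaf is reparametrised to a geodesic by two
  quadratures, so neither existence nor uniqueness of geodesics needs a theorem on differential equations.
  As leaves are connected, a maximal geodesic fills its leaf.
\<close>

section \<open>Calculus of smooth maps\<close>

text \<open>Frames exist only locally and only up to a factor, and this shapes two constructions:
  the connection is characterised at each point by a property insensitive to rescaling, and the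
  direction of a curve is recorded as a point of \<open>RP1\<close>, which all frames read in the
  same way. Existence and uniqueness of the connection rest on a count that closes: a symmetric
  \<Gamma> has six components at a point and \<theta> has two, against eight scalar equations
  \<nabla>\<omega>_i = \<theta> \<otimes> \<omega>_i. Uniqueness of geodesics comes from dimension
  one: two geodesics with common initial data keep to the same plaque, where each is the plaque
  geodesic composed with a real function y, and y'' = 0 because both accelerations vanish. Finally,
  \<nabla>^F is a definite description over adapted coordinates, so identifying it needs such
  coordinates around every point; they are assembled from flow boxes of three foliations of the
  web.\<close>

lemma times_differentiable_on_cong:
  assumes "open S" "times_differentiable_on n S f" "\<And>x. x \<in> S \<Longrightarrow> f x = g x"
  shows "times_differentiable_on n S g"
  using assms(2,3)
proof (induction n arbitrary: f g)
  case 0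
  then show ?case by (simp cong: continuous_on_cong)
next
  case (Suc n)
  have f: "(f has_derivative frechet_derivative f (at x)) (at x)" if "x \<in> S" for x
    using Suc.prems(1) that by (simp add: frechet_derivative_works)
  have g: "(g has_derivative frechet_derivative f (at x)) (at x)" if "x \<in> S" for x
    using f[OF that] assms(1) that Suc.prems(2) by (rule has_derivative_transform_within_open)
  have "times_differentiable_on n S (\<lambda>x. frechet_derivative g (at x) v)" for v
  proof (rule Suc.IH)
    show "times_differentiable_on n S (\<lambda>x. frechet_derivative f (at x) v)"
      using Suc.prems by simp
  qed (simp add: frechet_derivative_at[OF g, symmetric])
  moreover have "\<forall>x\<in>S. g differentiable (at x)"
    using g differentiable_def by blast
  ultimately show ?case by simp
qed

lemma times_differentiable_on_Suc:
  assumes "open S" "\<And>x. x \<in> S \<Longrightarrow> (f has_derivative f' x) (at x)"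
    and "\<And>v. times_differentiable_on n S (\<lambda>x. f' x v)"
  shows "times_differentiable_on (Suc n) S f"
proof -
  have "times_differentiable_on n S (\<lambda>x. frechet_derivative f (at x) v)" for v
    using assms(1,3) by (rule times_differentiable_on_cong) (simp add: frechet_derivative_at[OF assms(2), symmetric])
  moreover have "\<forall>x\<in>S. f differentiable (at x)"
    using assms(2) differentiable_def by blast
  ultimately show ?thesis by simp
qed

text \<open>The recursion does not demand the lower orders, so monotonicity in n has to be proved.
  It descends through the derivatives to the base case, where differentiability gives
  continuity.\<close>

lemma times_differentiable_on_Suc_D:
  assumes "times_differentiable_on (Suc n) S f"
  shows "times_differentiable_on n S f"
  using assms
proof (induction n arbitrary: f)
  case 0
  then have "isCont f x" if "x \<in> S" for x
    using that by (simp add: differentiable_imp_continuous_within)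
  then show ?case
    by (simp add: continuous_at_imp_continuous_on)
next
  case (Suc n)
  from Suc.prems[unfolded times_differentiable_on.simps(2)[of "Suc n"]] Suc.IH
  show ?case
    unfolding times_differentiable_on.simps(2)[of n] by blast
qed

lemma times_differentiable_on_has_derivative:
  assumes "times_differentiable_on (Suc n) S f" "x \<in> S"
  shows "(f has_derivative frechet_derivative f (at x)) (at x)"
  using assms by (simp add: frechet_derivative_works)

lemma times_differentiable_on_subset:
  assumes "times_differentiable_on n S f" "T \<subseteq> S"
  shows "times_differentiable_on n T f"
  using assms by (induction n arbitrary: f) (auto intro: continuous_on_subset)

lemma times_differentiable_on_local:
  assumes "\<And>x. x \<in> S \<Longrightarrow> \<exists>T. open T \<and> x \<in> T \<and> times_differentiable_on n T f"
  shows "times_differentiable_on n S f"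
  using assms
proof (induction n arbitrary: f)
  case 0
  then have "isCont f x" if "x \<in> S" for x
    using that continuous_on_eq_continuous_at by (metis times_differentiable_on.simps(1))
  then show ?case
    by (simp add: continuous_at_imp_continuous_on)
next
  case (Suc n)
  have "f differentiable (at x)" if "x \<in> S" for x
    using Suc.prems[OF that] by auto
  moreover have "times_differentiable_on n S (\<lambda>x. frechet_derivative f (at x) v)" for v
  proof (rule Suc.IH)
    show "\<exists>T. open T \<and> x \<in> T \<and> times_differentiable_on n T (\<lambda>x. frechet_derivative f (at x) v)" if "x \<in> S" for x
      using Suc.prems[OF that] by auto
  qed
  ultimately show ?case by simp
qed

section \<open>Closure of finite differentiability under algebraic operations and
  composition\<close>

lemma times_differentiable_on_const [simp]: "times_differentiable_on n S (\<lambda>x. c)"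
  by (induction n arbitrary: c) auto

lemma times_differentiable_on_linear:
  assumes "open S" "bounded_linear h" "times_differentiable_on n S f"
  shows "times_differentiable_on n S (\<lambda>x. h (f x))"
  using assms(3)
proof (induction n arbitrary: f)
  case 0
  then show ?case
    using assms(2) by (simp add: bounded_linear.continuous_on)
next
  case (Suc n)
  show ?case
  proof (rule times_differentiable_on_Suc[OF assms(1)])
    show "((\<lambda>x. h (f x)) has_derivative (\<lambda>v. h (frechet_derivative f (at x) v))) (at x)" if "x \<in> S" for x
      using times_differentiable_on_has_derivative[OF Suc.prems that]
      by (rule bounded_linear.has_derivative[OF assms(2)])
    show "times_differentiable_on n S (\<lambda>x. h (frechet_derivative f (at x) v))" for v
      by (rule Suc.IH) (use Suc.prems in simp)
  qed
qed

lemma times_differentiable_on_add: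
  assumes "open S" "times_differentiable_on n S f" "times_differentiable_on n S g"
  shows "times_differentiable_on n S (\<lambda>x. f x + g x)"
  using assms(2,3)
proof (induction n arbitrary: f g)
  case 0
  then show ?case by (simp add: continuous_on_add)
next
  case (Suc n)
  show ?case
  proof (rule times_differentiable_on_Suc[OF assms(1)])
    show "((\<lambda>x. f x + g x) has_derivative
        (\<lambda>v. frechet_derivative f (at x) v + frechet_derivative g (at x) v)) (at x)" if "x \<in> S" for x
      using times_differentiable_on_has_derivative[OF Suc.prems(1) that]
        times_differentiable_on_has_derivative[OF Suc.prems(2) that]
      by (rule has_derivative_add)
    show "times_differentiable_on n S (\<lambda>x. frechet_derivative f (at x) v + frechet_derivative g (at x) v)" for v
      by (rule Suc.IH) (use Suc.prems in simp_all)
  qed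
qed

text \<open>The product rule leaves one factor undifferentiated in each term, so the induction runs
  over both factors at once and uses that order n + 1 contains order n.\<close>

lemma times_differentiable_on_bilinear:
  assumes "open S" "bounded_bilinear h" "times_differentiable_on n S f" "times_differentiable_on n S g"
  shows "times_differentiable_on n S (\<lambda>x. h (f x) (g x))"
  using assms(3,4)
proof (induction n arbitrary: f g)
  case 0
  then show ?case using assms(2) by (simp add: bounded_bilinear.continuous_on)
next
  case (Suc n)
  show ?case
  proof (rule times_differentiable_on_Suc[OF assms(1)])
    show "((\<lambda>x. h (f x) (g x)) has_derivative (\<lambda>v. h (f x) (frechet_derivative g (at x) v) +
        h (frechet_derivative f (at x) v) (g x))) (at x)" if "x \<in> S" for x
      using times_differentiable_on_has_derivative[OF Suc.prems(1) that]
        times_differentiable_on_has_derivative[OF Suc.prems(2) that]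
      by (rule bounded_bilinear.FDERIV[OF assms(2)])
    have fg: "times_differentiable_on n S f" "times_differentiable_on n S g"
      using Suc.prems by (auto intro: times_differentiable_on_Suc_D)
    show "times_differentiable_on n S (\<lambda>x. h (f x) (frechet_derivative g (at x) v) +
        h (frechet_derivative f (at x) v) (g x))" for v
      by (intro times_differentiable_on_add[OF assms(1)] Suc.IH fg) (use Suc.prems in simp_all)
  qed
qed

lemma times_differentiable_on_sum:
  assumes "open S" "finite A" "\<And>i. i \<in> A \<Longrightarrow> times_differentiable_on n S (f i)"
  shows "times_differentiable_on n S (\<lambda>x. \<Sum>i\<in>A. f i x)"
  using assms(2,3) by (induction A rule: finite_induct) (auto intro!: times_differentiable_on_add assms(1))

text \<open>The chain rule differentiates f in the direction Dg(v), which varies with x, whereas the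
  predicate controls derivatives of f only in fixed directions. Expanding Dg(v) in the basis of a
  Euclidean space repairs this. The induction varies f but not g, since the basis derivatives of f
  are composed with the same g.\<close>

lemma times_differentiable_on_compose:
  fixes f :: "'a::euclidean_space \<Rightarrow> 'b::real_normed_vector"
  assumes "open S" "open T" "g ` S \<subseteq> T" "times_differentiable_on n T f" "times_differentiable_on n S g"
  shows "times_differentiable_on n S (\<lambda>x. f (g x))"
  using assms(4,5)
proof (induction n arbitrary: f)
  case 0
  then show ?case using assms(3) by (simp add: continuous_on_compose2)
next
  case (Suc n)
  have g: "g x \<in> T" if "x \<in> S" for x using assms(3) that by auto
  have lin: "frechet_derivative f (at (g x)) v = (\<Sum>b\<in>Basis. (v \<bullet> b) *\<^sub>R frechet_derivative f (at (g x)) b)"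
    if "x \<in> S" for x v
  proof -
    interpret bounded_linear "frechet_derivative f (at (g x))"
      using times_differentiable_on_has_derivative[OF Suc.prems(1) g[OF that]] by (rule has_derivative_bounded_linear)
    show ?thesis
      by (subst euclidean_representation[of v, symmetric]) (simp only: sum scaleR)
  qed
  show ?case
  proof (rule times_differentiable_on_Suc[where f' = "\<lambda>x v. \<Sum>b\<in>Basis.
        (frechet_derivative g (at x) v \<bullet> b) *\<^sub>R frechet_derivative f (at (g x)) b"])
    fix x assume x: "x \<in> S"
    have "((\<lambda>x. f (g x)) has_derivative (\<lambda>v. frechet_derivative f (at (g x)) (frechet_derivative g (at x) v))) (at x)"
      using times_differentiable_on_has_derivative[OF Suc.prems(1) g[OF x]]
        times_differentiable_on_has_derivative[OF Suc.prems(2) x]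
      by (rule has_derivative_compose[rotated])
    moreover have "(\<lambda>v. frechet_derivative f (at (g x)) (frechet_derivative g (at x) v)) = (\<lambda>v. \<Sum>b\<in>Basis.
        (frechet_derivative g (at x) v \<bullet> b) *\<^sub>R frechet_derivative f (at (g x)) b)"
      by (intro ext lin[OF x])
    ultimately show "((\<lambda>x. f (g x)) has_derivative (\<lambda>v. \<Sum>b\<in>Basis.
        (frechet_derivative g (at x) v \<bullet> b) *\<^sub>R frechet_derivative f (at (g x)) b)) (at x)"
      by simp
  next
    fix v
    have "times_differentiable_on n S g"
      using Suc.prems times_differentiable_on_Suc_D by blast
    then show "times_differentiable_on n S (\<lambda>x. \<Sum>b\<in>Basis.
        (frechet_derivative g (at x) v \<bullet> b) *\<^sub>R frechet_derivative f (at (g x)) b)"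
      using Suc.prems assms(1)
      by (intro times_differentiable_on_sum times_differentiable_on_bilinear[OF _ bounded_bilinear_scaleR]
          times_differentiable_on_linear[OF _ bounded_linear_inner_left] Suc.IH) auto
  qed (use assms(1) in auto)
qed

text \<open>The derivative -(1/f) Df(v) (1/f) contains 1/f itself, so order n of 1/f gives order n
  of its derivative: a bootstrap with f fixed.\<close>

lemma times_differentiable_on_inverse:
  fixes f :: "'a::real_normed_vector \<Rightarrow> real"
  assumes "open S" "times_differentiable_on n S f" "\<And>x. x \<in> S \<Longrightarrow> f x \<noteq> 0"
  shows "times_differentiable_on n S (\<lambda>x. inverse (f x))"
  using assms(2)
proof (induction n)
  case 0
  then show ?case using assms(3) by (auto intro: continuous_on_inverse)
next
  case (Suc n)
  have inv: "times_differentiable_on n S (\<lambda>x. inverse (f x))"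
    using Suc times_differentiable_on_Suc_D by blast
  show ?case
  proof (rule times_differentiable_on_Suc[OF assms(1)])
    show "((\<lambda>x. inverse (f x)) has_derivative
        (\<lambda>v. - (inverse (f x) * frechet_derivative f (at x) v * inverse (f x)))) (at x)" if "x \<in> S" for x
      using assms(3)[OF that] times_differentiable_on_has_derivative[OF Suc.prems that]
      by (rule Deriv.has_derivative_inverse)
    show "times_differentiable_on n S (\<lambda>x. - (inverse (f x) * frechet_derivative f (at x) v * inverse (f x)))" for v
      using times_differentiable_on_bilinear[OF assms(1) bounded_bilinear_mult
          times_differentiable_on_bilinear[OF assms(1) bounded_bilinear_mult inv] inv] Suc.prems
      by (intro times_differentiable_on_linear[OF assms(1) bounded_linear_minus[OF bounded_linear_ident]]) simp
  qed
qed

lemma times_differentiable_on_exp: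
  fixes f :: "'a::real_normed_vector \<Rightarrow> real"
  assumes "open S" "times_differentiable_on n S f"
  shows "times_differentiable_on n S (\<lambda>x. exp (f x))"
  using assms(2)
proof (induction n)
  case 0
  then show ?case by (auto intro: continuous_on_exp)
next
  case (Suc n)
  have exp: "times_differentiable_on n S (\<lambda>x. exp (f x))"
    using Suc times_differentiable_on_Suc_D by blast
  show ?case
  proof (rule times_differentiable_on_Suc[OF assms(1)])
    show "((\<lambda>x. exp (f x)) has_derivative (\<lambda>v. exp (f x) * frechet_derivative f (at x) v)) (at x)" if "x \<in> S" for x
      using has_derivative_exp[OF times_differentiable_on_has_derivative[OF Suc.prems that]]
      by (simp add: mult_ac)
    show "times_differentiable_on n S (\<lambda>x. exp (f x) * frechet_derivative f (at x) v)" for v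
      by (rule times_differentiable_on_bilinear[OF assms(1) bounded_bilinear_mult exp]) (use Suc.prems in simp)
  qed
qed

lemma times_differentiable_on_ident: "open S \<Longrightarrow> times_differentiable_on n S (\<lambda>x. x)"
  by (cases n) (auto simp: frechet_derivative_at[OF has_derivative_ident, symmetric])

section \<open>Smooth maps: consequences of the finite-order rules\<close>

lemma smooth_on_has_derivative:
  "smooth_on S f \<Longrightarrow> x \<in> S \<Longrightarrow> (f has_derivative frechet_derivative f (at x)) (at x)"
  unfolding smooth_on_def using times_differentiable_on_has_derivative by blast

lemma smooth_on_differentiable: "smooth_on S f \<Longrightarrow> x \<in> S \<Longrightarrow> f differentiable (at x)"
  using smooth_on_has_derivative unfolding differentiable_def by blast

lemma smooth_on_bounded_linear:
  "smooth_on S f \<Longrightarrow> x \<in> S \<Longrightarrow> bounded_linear (frechet_derivative f (at x))"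
  using smooth_on_has_derivative has_derivative_bounded_linear by blast

lemma frechet_derivative_linear:
  assumes "smooth_on S f" "x \<in> S"
  shows "frechet_derivative f (at x) (u + v) = frechet_derivative f (at x) u + frechet_derivative f (at x) v"
    and "frechet_derivative f (at x) (c *\<^sub>R v) = c *\<^sub>R frechet_derivative f (at x) v"
    and "frechet_derivative f (at x) 0 = 0"
  using bounded_linear.linear[OF smooth_on_bounded_linear[OF assms]]
  by (simp_all add: linear_add linear_scale linear_0)

lemma smooth_on_frechet_derivative: "smooth_on S f \<Longrightarrow> smooth_on S (\<lambda>x. frechet_derivative f (at x) v)"
  unfolding smooth_on_def by (metis times_differentiable_on.simps(2))

lemma smooth_on_imp_continuous_on: "smooth_on S f \<Longrightarrow> continuous_on S f"
  unfolding smooth_on_def by (metis times_differentiable_on.simps(1))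

lemma smooth_on_cong:
  "open S \<Longrightarrow> smooth_on S f \<Longrightarrow> (\<And>x. x \<in> S \<Longrightarrow> f x = g x) \<Longrightarrow> smooth_on S g"
  unfolding smooth_on_def using times_differentiable_on_cong by blast

lemma smooth_on_subset: "smooth_on S f \<Longrightarrow> T \<subseteq> S \<Longrightarrow> smooth_on T f"
  unfolding smooth_on_def using times_differentiable_on_subset by blast

lemma smooth_on_local:
  assumes "\<And>x. x \<in> S \<Longrightarrow> \<exists>T. open T \<and> x \<in> T \<and> smooth_on T f"
  shows "smooth_on S f"
  unfolding smooth_on_def
proof (intro allI times_differentiable_on_local)
  fix n x assume "x \<in> S"
  then show "\<exists>T. open T \<and> x \<in> T \<and> times_differentiable_on n T f"
    using assms unfolding smooth_on_def by blast
qed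

lemma smooth_on_const: "smooth_on S (\<lambda>x. c)"
  by (simp add: smooth_on_def)

lemma smooth_on_ident: "open S \<Longrightarrow> smooth_on S (\<lambda>x. x)"
  by (simp add: smooth_on_def times_differentiable_on_ident)

lemma smooth_on_linear: "open S \<Longrightarrow> bounded_linear h \<Longrightarrow> smooth_on S f \<Longrightarrow> smooth_on S (\<lambda>x. h (f x))"
  by (simp add: smooth_on_def times_differentiable_on_linear)

lemma smooth_on_bilinear:
  "open S \<Longrightarrow> bounded_bilinear h \<Longrightarrow> smooth_on S f \<Longrightarrow> smooth_on S g \<Longrightarrow> smooth_on S (\<lambda>x. h (f x) (g x))"
  by (simp add: smooth_on_def times_differentiable_on_bilinear)

lemma smooth_on_add: "open S \<Longrightarrow> smooth_on S f \<Longrightarrow> smooth_on S g \<Longrightarrow> smooth_on S (\<lambda>x. f x + g x)"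
  by (simp add: smooth_on_def times_differentiable_on_add)

lemma smooth_on_minus: "open S \<Longrightarrow> smooth_on S f \<Longrightarrow> smooth_on S (\<lambda>x. - f x)"
  by (rule smooth_on_linear) (auto intro: bounded_linear_minus bounded_linear_ident)

lemma smooth_on_diff: "open S \<Longrightarrow> smooth_on S f \<Longrightarrow> smooth_on S g \<Longrightarrow> smooth_on S (\<lambda>x. f x - g x)"
  using smooth_on_add[of S f "\<lambda>x. - g x"] smooth_on_minus[of S g] by simp

lemma smooth_on_compose:
  fixes f :: "'a::euclidean_space \<Rightarrow> 'b::real_normed_vector"
  shows "open S \<Longrightarrow> open T \<Longrightarrow> g ` S \<subseteq> T \<Longrightarrow> smooth_on T f \<Longrightarrow> smooth_on S g \<Longrightarrow> smooth_on S (\<lambda>x. f (g x))"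
  unfolding smooth_on_def by (blast intro: times_differentiable_on_compose[where f = f and g = g and T = T])

lemma smooth_on_inverse:
  fixes f :: "'a::real_normed_vector \<Rightarrow> real"
  shows "open S \<Longrightarrow> smooth_on S f \<Longrightarrow> (\<And>x. x \<in> S \<Longrightarrow> f x \<noteq> 0) \<Longrightarrow> smooth_on S (\<lambda>x. inverse (f x))"
  by (simp add: smooth_on_def times_differentiable_on_inverse)

lemma smooth_on_exp:
  fixes f :: "'a::real_normed_vector \<Rightarrow> real"
  shows "open S \<Longrightarrow> smooth_on S f \<Longrightarrow> smooth_on S (\<lambda>x. exp (f x))"
  by (simp add: smooth_on_def times_differentiable_on_exp)

lemmas smooth_on_mult = smooth_on_bilinear[OF _ bounded_bilinear_mult]
lemmas smooth_on_scaleR = smooth_on_bilinear[OF _ bounded_bilinear_scaleR]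
lemmas smooth_on_inner = smooth_on_bilinear[OF _ bounded_bilinear_inner]
lemmas smooth_on_blinfun_apply = smooth_on_bilinear[OF _ bounded_bilinear_blinfun_apply]
lemmas smooth_on_fst = smooth_on_linear[OF _ bounded_linear_fst]
lemmas smooth_on_snd = smooth_on_linear[OF _ bounded_linear_snd]

lemma smooth_on_divide:
  fixes f :: "'a::real_normed_vector \<Rightarrow> real"
  shows "open S \<Longrightarrow> smooth_on S f \<Longrightarrow> smooth_on S g \<Longrightarrow> (\<And>x. x \<in> S \<Longrightarrow> g x \<noteq> 0) \<Longrightarrow> smooth_on S (\<lambda>x. f x / g x)"
  unfolding divide_inverse by (intro smooth_on_mult smooth_on_inverse)

lemma smooth_on_Pair:
  assumes "open S" "smooth_on S f" "smooth_on S g"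
  shows "smooth_on S (\<lambda>x. (f x, g x))"
proof -
  have "bounded_linear (\<lambda>x. (x, 0))" "bounded_linear (\<lambda>x. (0, x))"
    by (auto intro: bounded_linear_Pair bounded_linear_ident bounded_linear_zero)
  then have "smooth_on S (\<lambda>x. (f x, 0) + (0, g x))"
    using assms by (intro smooth_on_add smooth_on_linear[where h = "\<lambda>x. (x, 0)"] smooth_on_linear[where h = "\<lambda>x. (0, x)"])
  then show ?thesis by simp
qed

lemmas smooth_intros = smooth_on_const smooth_on_ident smooth_on_add smooth_on_minus smooth_on_diff
  smooth_on_mult smooth_on_scaleR smooth_on_inner smooth_on_blinfun_apply smooth_on_fst smooth_on_snd
  smooth_on_divide smooth_on_Pair smooth_on_exp

lemma smooth_on_has_vector_derivative:
  fixes f :: "real \<Rightarrow> 'b::real_normed_vector"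
  assumes "smooth_on S f" "x \<in> S"
  shows "(f has_vector_derivative vector_derivative f (at x)) (at x)"
  using smooth_on_has_derivative[OF assms] differentiable_def vector_derivative_works by blast

lemma smooth_on_vector_derivative:
  fixes f :: "real \<Rightarrow> 'b::real_normed_vector"
  assumes "open S" "smooth_on S f"
  shows "smooth_on S (\<lambda>x. vector_derivative f (at x))"
proof (rule smooth_on_cong[OF assms(1) smooth_on_frechet_derivative[OF assms(2), of 1]])
  fix x assume x: "x \<in> S"
  have "(f has_derivative (\<lambda>h. h *\<^sub>R vector_derivative f (at x))) (at x)"
    using smooth_on_has_vector_derivative[OF assms(2) x] by (simp add: has_vector_derivative_def)
  from frechet_derivative_at[OF this] show "frechet_derivative f (at x) 1 = vector_derivative f (at x)"
    by (metis scaleR_one)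
qed

lemma smooth_on_antiderivative:
  fixes f :: "real \<Rightarrow> 'b::real_normed_vector"
  assumes "open S" "\<And>x. x \<in> S \<Longrightarrow> (f has_vector_derivative g x) (at x)" "smooth_on S g"
  shows "smooth_on S f"
proof -
  have "times_differentiable_on (Suc n) S f" for n
    using assms(1,3) smooth_on_linear[OF assms(1) bounded_linear_scaleR_right assms(3)]
    by (intro times_differentiable_on_Suc[where f' = "\<lambda>x h. h *\<^sub>R g x"] assms(2)[unfolded has_vector_derivative_def])
       (auto simp: smooth_on_def)
  then show ?thesis
    unfolding smooth_on_def using times_differentiable_on_Suc_D by blast
qed

section \<open>Symmetry of second derivatives\<close>

lemma double_difference_mean_value:
  fixes f :: "'a::real_normed_vector \<Rightarrow> real"
  assumes "h > 0" "\<And>s t. 0 \<le> s \<Longrightarrow> s \<le> h \<Longrightarrow> 0 \<le> t \<Longrightarrow> t \<le> h \<Longrightarrow> z + s *\<^sub>R u + t *\<^sub>R v \<in> S"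
    and "times_differentiable_on (Suc (Suc n)) S f"
  obtains s t where "0 < s" "s < h" "0 < t" "t < h"
    "f (z + h *\<^sub>R u + h *\<^sub>R v) - f (z + h *\<^sub>R u) - f (z + h *\<^sub>R v) + f z =
     h * (h * frechet_derivative (\<lambda>z. frechet_derivative f (at z) u) (at (z + s *\<^sub>R u + t *\<^sub>R v)) v)"
proof -
  let ?Df = "\<lambda>z. frechet_derivative f (at z) u"
  have D1: "(f has_derivative frechet_derivative f (at x)) (at x)" if "x \<in> S" for x
    using that assms(3) times_differentiable_on_has_derivative by blast
  have D2: "(?Df has_derivative frechet_derivative ?Df (at x)) (at x)" if "x \<in> S" for x
    using that assms(3) times_differentiable_on_has_derivative[of n S ?Df x] by simp
  have f': "((\<lambda>s. f (z + s *\<^sub>R u + t *\<^sub>R v)) has_real_derivative ?Df (z + s *\<^sub>R u + t *\<^sub>R v)) (at s)"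
    if "0 \<le> s" "s \<le> h" "0 \<le> t" "t \<le> h" for s t
  proof -
    interpret bounded_linear "frechet_derivative f (at (z + s *\<^sub>R u + t *\<^sub>R v))"
      using D1[OF assms(2)[OF that]] by (rule has_derivative_bounded_linear)
    have aff: "((\<lambda>s. z + s *\<^sub>R u + t *\<^sub>R v) has_derivative (\<lambda>r. r *\<^sub>R u)) (at s)"
      by (auto intro!: derivative_eq_intros)
    have "((\<lambda>s. f (z + s *\<^sub>R u + t *\<^sub>R v)) has_derivative
        (\<lambda>r. frechet_derivative f (at (z + s *\<^sub>R u + t *\<^sub>R v)) (r *\<^sub>R u))) (at s)"
      using aff D1[OF assms(2)[OF that]] by (rule has_derivative_compose)
    then show ?thesis
        unfolding has_field_derivative_def by (rule has_derivative_eq_rhs) (simp add: scaleR fun_eq_iff)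
  qed
  have f'': "((\<lambda>t. ?Df (z + s *\<^sub>R u + t *\<^sub>R v)) has_real_derivative
      frechet_derivative ?Df (at (z + s *\<^sub>R u + t *\<^sub>R v)) v) (at t)"
    if "0 \<le> s" "s \<le> h" "0 \<le> t" "t \<le> h" for s t
  proof -
    interpret bounded_linear "frechet_derivative ?Df (at (z + s *\<^sub>R u + t *\<^sub>R v))"
      using D2[OF assms(2)[OF that]] by (rule has_derivative_bounded_linear)
    have aff: "((\<lambda>t. z + s *\<^sub>R u + t *\<^sub>R v) has_derivative (\<lambda>r. r *\<^sub>R v)) (at t)"
      by (auto intro!: derivative_eq_intros)
    have "((\<lambda>t. ?Df (z + s *\<^sub>R u + t *\<^sub>R v)) has_derivative
        (\<lambda>r. frechet_derivative ?Df (at (z + s *\<^sub>R u + t *\<^sub>R v)) (r *\<^sub>R v))) (at t)"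
      using aff D2[OF assms(2)[OF that]] by (rule has_derivative_compose)
    then show ?thesis
      unfolding has_field_derivative_def by (rule has_derivative_eq_rhs) (simp add: scaleR fun_eq_iff)
  qed
  \<comment> \<open>The mean value theorem is applied first in the u-direction, to the difference of
    f across h v, and then, at the s so found, in the v-direction to the derivative of f along
    u.\<close>
  have "\<exists>s>0. s < h \<and>
     (\<lambda>s. f (z + s *\<^sub>R u + h *\<^sub>R v) - f (z + s *\<^sub>R u + 0 *\<^sub>R v)) h - (\<lambda>s. f (z + s *\<^sub>R u + h *\<^sub>R v) - f (z + s *\<^sub>R u + 0 *\<^sub>R v)) 0
      = (h - 0) * (?Df (z + s *\<^sub>R u + h *\<^sub>R v) - ?Df (z + s *\<^sub>R u + 0 *\<^sub>R v))"
    using assms(1) by (intro MVT2 DERIV_diff f') auto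
  then obtain s where s: "0 < s" "s < h"
    "f (z + h *\<^sub>R u + h *\<^sub>R v) - f (z + h *\<^sub>R u) - f (z + h *\<^sub>R v) + f z =
      h * (?Df (z + s *\<^sub>R u + h *\<^sub>R v) - ?Df (z + s *\<^sub>R u + 0 *\<^sub>R v))" by auto
  have "\<exists>t>0. t < h \<and> ?Df (z + s *\<^sub>R u + h *\<^sub>R v) - ?Df (z + s *\<^sub>R u + 0 *\<^sub>R v) =
      (h - 0) * frechet_derivative ?Df (at (z + s *\<^sub>R u + t *\<^sub>R v)) v"
    using assms(1) s(1,2) by (intro MVT2[where f = "\<lambda>t. ?Df (z + s *\<^sub>R u + t *\<^sub>R v)"] f'') auto
  then show thesis using s that by auto
qed

text \<open>The double difference of f over a small parallelogram is symmetric in u and v, so the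
  mean value lemma equates a value of \<open>A\<close> with a value of \<open>B\<close>, each taken
  near z. By continuity these lie within half the gap of \<open>A z\<close> and of
  \<open>B z\<close>, which is impossible if the gap is positive.\<close>

lemma symmetric_second_derivative_real:
  fixes f :: "'a::real_normed_vector \<Rightarrow> real"
  assumes "open S" "smooth_on S f" "z \<in> S"
  shows "frechet_derivative (\<lambda>z. frechet_derivative f (at z) u) (at z) v =
         frechet_derivative (\<lambda>z. frechet_derivative f (at z) v) (at z) u"
proof (rule ccontr)
  define A where "A z = frechet_derivative (\<lambda>z. frechet_derivative f (at z) u) (at z) v" for z
  define B where "B z = frechet_derivative (\<lambda>z. frechet_derivative f (at z) v) (at z) u" for z
  assume "\<not> ?thesis"
  then have ne: "A z \<noteq> B z" by (simp add: A_def B_def)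
  have "isCont A z" "isCont B z"
    unfolding A_def B_def
    using assms by (metis continuous_on_eq_continuous_at smooth_on_frechet_derivative smooth_on_imp_continuous_on)+
  then have "\<forall>\<^sub>F x in nhds z. dist (A x) (A z) < \<bar>A z - B z\<bar> / 2" "\<forall>\<^sub>F x in nhds z. dist (B x) (B z) < \<bar>A z - B z\<bar> / 2"
    using ne unfolding isCont_def tendsto_at_iff_tendsto_nhds by (intro tendstoD; simp)+
  moreover have "\<forall>\<^sub>F x in nhds z. x \<in> S" using assms by (simp add: eventually_nhds_in_open)
  ultimately have "\<forall>\<^sub>F x in nhds z. x \<in> S \<and> dist (A x) (A z) < \<bar>A z - B z\<bar> / 2 \<and> dist (B x) (B z) < \<bar>A z - B z\<bar> / 2"
    by eventually_elim simp
  then obtain e where e: "e > 0"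
    "\<And>x. dist x z < e \<Longrightarrow> x \<in> S \<and> dist (A x) (A z) < \<bar>A z - B z\<bar> / 2 \<and> dist (B x) (B z) < \<bar>A z - B z\<bar> / 2"
    unfolding eventually_nhds_metric by blast
  \<comment> \<open>Small enough for the whole parallelogram spanned by h u and h v to stay in the
    ball; the summand 1 keeps the denominator positive when u = v = 0.\<close>
  define h where "h = e / (norm u + norm v + 1)"
  have pos: "norm u + norm v + 1 > 0" by (simp add: add_nonneg_pos)
  have h: "h > 0" using e pos by (simp add: h_def)
  have in_ball: "z + s *\<^sub>R u + t *\<^sub>R v \<in> ball z e" if "0 \<le> s" "s \<le> h" "0 \<le> t" "t \<le> h" for s t
  proof -
    have "norm (s *\<^sub>R u + t *\<^sub>R v) \<le> h * norm u + h * norm v"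
      using that by (intro norm_triangle_le add_mono) (auto simp: mult_right_mono)
    also have "\<dots> < h * (norm u + norm v + 1)" using h by (simp add: algebra_simps)
    also have "\<dots> = e" using pos by (simp add: h_def)
    finally have "dist (z + (s *\<^sub>R u + t *\<^sub>R v)) z < e" by (simp add: dist_norm)
    then show ?thesis by (simp add: dist_commute add.assoc)
  qed
  have td: "times_differentiable_on (Suc (Suc 0)) (ball z e) f"
    by (rule times_differentiable_on_subset[of _ S]) (use assms(2) e(2) in \<open>auto simp: smooth_on_def dist_commute simp del: times_differentiable_on.simps\<close>)
  obtain s t where st: "0 < s" "s < h" "0 < t" "t < h"
    "f (z + h *\<^sub>R u + h *\<^sub>R v) - f (z + h *\<^sub>R u) - f (z + h *\<^sub>R v) + f z = h * (h * A (z + s *\<^sub>R u + t *\<^sub>R v))"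
    using double_difference_mean_value[OF h in_ball td] unfolding A_def by blast
  have in_ball': "z + s *\<^sub>R v + t *\<^sub>R u \<in> ball z e" if "0 \<le> s" "s \<le> h" "0 \<le> t" "t \<le> h" for s t
    using in_ball[OF that(3,4,1,2)] by (simp add: algebra_simps)
  obtain s' t' where st': "0 < s'" "s' < h" "0 < t'" "t' < h"
    "f (z + h *\<^sub>R v + h *\<^sub>R u) - f (z + h *\<^sub>R v) - f (z + h *\<^sub>R u) + f z = h * (h * B (z + s' *\<^sub>R v + t' *\<^sub>R u))"
    using double_difference_mean_value[OF h in_ball' td] unfolding B_def by blast
  have "A (z + s *\<^sub>R u + t *\<^sub>R v) = B (z + s' *\<^sub>R v + t' *\<^sub>R u)"
    using h st(5) st'(5) by (simp add: algebra_simps)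
  moreover have "dist (z + s *\<^sub>R u + t *\<^sub>R v) z < e" "dist (z + s' *\<^sub>R v + t' *\<^sub>R u) z < e"
    using in_ball[of s t] st in_ball'[of s' t'] st' by (simp_all add: dist_commute)
  then have "dist (A (z + s *\<^sub>R u + t *\<^sub>R v)) (A z) < \<bar>A z - B z\<bar> / 2"
    "dist (B (z + s' *\<^sub>R v + t' *\<^sub>R u)) (B z) < \<bar>A z - B z\<bar> / 2"
    using e(2) by blast+
  ultimately show False
    unfolding dist_real_def by (simp add: abs_if split: if_splits)
qed

lemma symmetric_second_derivative:
  fixes f :: "'a::real_normed_vector \<Rightarrow> 'b::euclidean_space"
  assumes "open S" "smooth_on S f" "z \<in> S"
  shows "frechet_derivative (\<lambda>z. frechet_derivative f (at z) u) (at z) v =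
         frechet_derivative (\<lambda>z. frechet_derivative f (at z) v) (at z) u"
proof (rule euclidean_eqI)
  fix b :: 'b
  assume "b \<in> Basis"
  define g where "g z = f z \<bullet> b" for z
  have g: "smooth_on S g"
    unfolding g_def using assms(1,2) by (intro smooth_on_linear[OF _ bounded_linear_inner_left])
  have "frechet_derivative (\<lambda>z. frechet_derivative g (at z) u) (at z) v =
        frechet_derivative (\<lambda>z. frechet_derivative f (at z) u) (at z) v \<bullet> b" for u v
  proof -
    have D: "frechet_derivative g (at z) u = frechet_derivative f (at z) u \<bullet> b" if "z \<in> S" for z
    proof -
      have "(g has_derivative (\<lambda>u. frechet_derivative f (at z) u \<bullet> b)) (at z)"
        unfolding g_def using smooth_on_has_derivative[OF assms(2) that]
        by (rule bounded_linear.has_derivative[OF bounded_linear_inner_left])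
      from frechet_derivative_at[OF this, symmetric] show ?thesis by simp
    qed
    have "((\<lambda>z. frechet_derivative f (at z) u \<bullet> b) has_derivative
        (\<lambda>v. frechet_derivative (\<lambda>z. frechet_derivative f (at z) u) (at z) v \<bullet> b)) (at z)"
      using smooth_on_has_derivative[OF smooth_on_frechet_derivative[OF assms(2)] assms(3)]
      by (rule bounded_linear.has_derivative[OF bounded_linear_inner_left])
    then have "((\<lambda>z. frechet_derivative g (at z) u) has_derivative
        (\<lambda>v. frechet_derivative (\<lambda>z. frechet_derivative f (at z) u) (at z) v \<bullet> b)) (at z)"
      using assms(1,3) by (rule has_derivative_transform_within_open) (simp add: D)
    from frechet_derivative_at[OF this, symmetric] show ?thesis by simp
  qed
  with symmetric_second_derivative_real[OF assms(1) g assms(3), of u v]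
  show "frechet_derivative (\<lambda>z. frechet_derivative f (at z) u) (at z) v \<bullet> b =
        frechet_derivative (\<lambda>z. frechet_derivative f (at z) v) (at z) u \<bullet> b"
    by simp
qed

section \<open>Inverse function theorem for smooth maps of the plane\<close>

definition pair_blinfun :: "'b::real_normed_vector \<Rightarrow> 'b \<Rightarrow> plane \<Rightarrow>\<^sub>L 'b" where
  "pair_blinfun y z = (blinfun_scaleR_left y o\<^sub>L fst_blinfun) + (blinfun_scaleR_left z o\<^sub>L snd_blinfun)"

lemma pair_blinfun_apply [simp]: "blinfun_apply (pair_blinfun y z) v = fst v *\<^sub>R y + snd v *\<^sub>R z"
  by (simp add: pair_blinfun_def blinfun.add_left)

text \<open>The operator depends linearly on its two columns, so smoothness of an operator-valued
  field reduces to that of its columns. The connection, the coframes and the derivative of a map are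
  treated in this way.\<close>

lemma smooth_on_pair_blinfun:
  assumes "open S" "smooth_on S f" "smooth_on S g"
  shows "smooth_on S (\<lambda>x. pair_blinfun (f x) (g x))"
proof -
  have "bounded_linear (\<lambda>y. blinfun_scaleR_left y o\<^sub>L (B :: plane \<Rightarrow>\<^sub>L real))" for B
    using bounded_linear_compose[OF bounded_bilinear.bounded_linear_left[OF bounded_bilinear_blinfun_compose]
        bounded_linear_blinfun_scaleR_left] .
  then show ?thesis
    unfolding pair_blinfun_def
    by (intro smooth_on_add[OF assms(1)] smooth_on_linear[OF assms(1) _ assms(2)]
        smooth_on_linear[OF assms(1) _ assms(3)])
qed

lemma linear_plane:
  fixes f :: "plane \<Rightarrow> 'b::real_normed_vector"
  assumes "linear f"
  shows "f v = fst v *\<^sub>R f (1, 0) + snd v *\<^sub>R f (0, 1)"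
proof -
  have "f v = f (fst v *\<^sub>R (1, 0) + snd v *\<^sub>R (0, 1))" by simp
  also have "\<dots> = fst v *\<^sub>R f (1, 0) + snd v *\<^sub>R f (0, 1)"
    using assms by (simp only: linear_add linear_scale)
  finally show ?thesis .
qed

lemma pair_blinfun_frechet_derivative:
  fixes f :: "plane \<Rightarrow> 'b::real_normed_vector"
  assumes "smooth_on S f" "x \<in> S"
  shows "blinfun_apply (pair_blinfun (frechet_derivative f (at x) (1, 0)) (frechet_derivative f (at x) (0, 1))) =
         frechet_derivative f (at x)"
  by (rule ext) (metis assms smooth_on_bounded_linear bounded_linear.linear linear_plane pair_blinfun_apply)

text \<open>Cramer's rule writes the derivative of the inverse g rationally in the first derivatives
  of f at g(y). So if g has order n, its derivative has order n too, and g has order n + 1.\<close>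

lemma smooth_on_inverse_map_plane:
  fixes f g :: "plane \<Rightarrow> plane"
  assumes "open S" "open T" "smooth_on S f" "g ` T \<subseteq> S"
    and fg: "\<And>y. y \<in> T \<Longrightarrow> f (g y) = y" and g': "\<And>y. y \<in> T \<Longrightarrow> (g has_derivative g' y) (at y)"
  shows "smooth_on T g"
proof -
  define a where "a y = frechet_derivative f (at (g y)) (1, 0)" for y
  define b where "b y = frechet_derivative f (at (g y)) (0, 1)" for y
  define d where "d y = fst (a y) * snd (b y) - snd (a y) * fst (b y)" for y
  have eq: "fst (g' y v) *\<^sub>R a y + snd (g' y v) *\<^sub>R b y = v" if y: "y \<in> T" for y v
  proof -
    have gy: "g y \<in> S" using assms(4) y by auto
    have "((\<lambda>y. f (g y)) has_derivative (\<lambda>v. frechet_derivative f (at (g y)) (g' y v))) (at y)"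
      using g'[OF y] smooth_on_has_derivative[OF assms(3) gy] by (rule has_derivative_compose)
    then have "((\<lambda>y. y) has_derivative (\<lambda>v. frechet_derivative f (at (g y)) (g' y v))) (at y)"
      using assms(2) y by (rule has_derivative_transform_within_open) (simp add: fg)
    from has_derivative_unique[OF this has_derivative_ident]
    have "frechet_derivative f (at (g y)) (g' y v) = v" by metis
    with linear_plane[OF bounded_linear.linear[OF smooth_on_bounded_linear[OF assms(3) gy]], of "g' y v"]
    show ?thesis by (simp add: a_def b_def)
  qed
  \<comment> \<open>The determinant of Dg times that of Df at g(y) is the determinant of the
    identity, because \<open>eq\<close> computes the columns of the product.\<close>
  have d: "d y \<noteq> 0" if y: "y \<in> T" for y
  proof
    assume "d y = 0"
    have "d y * (fst (g' y (1,0)) * snd (g' y (0,1)) - snd (g' y (1,0)) * fst (g' y (0,1))) =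
      fst (fst (g' y (1,0)) *\<^sub>R a y + snd (g' y (1,0)) *\<^sub>R b y) * snd (fst (g' y (0,1)) *\<^sub>R a y + snd (g' y (0,1)) *\<^sub>R b y)
      - snd (fst (g' y (1,0)) *\<^sub>R a y + snd (g' y (1,0)) *\<^sub>R b y) * fst (fst (g' y (0,1)) *\<^sub>R a y + snd (g' y (0,1)) *\<^sub>R b y)"
      by (simp add: d_def algebra_simps)
    also have "\<dots> = 1" unfolding eq[OF y] by simp
    finally show False using \<open>d y = 0\<close> by simp
  qed
  have g'_eq: "g' y v = ((fst v * snd (b y) - snd v * fst (b y)) * inverse (d y),
      (fst (a y) * snd v - snd (a y) * fst v) * inverse (d y))" if y: "y \<in> T" for y v
  proof -
    have v: "fst v = fst (g' y v) * fst (a y) + snd (g' y v) * fst (b y)"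
      "snd v = fst (g' y v) * snd (a y) + snd (g' y v) * snd (b y)"
      using arg_cong[OF eq[OF y, of v], of fst] arg_cong[OF eq[OF y, of v], of snd] by simp_all
    have "fst v * snd (b y) - snd v * fst (b y) = fst (g' y v) * d y"
      "fst (a y) * snd v - snd (a y) * fst v = snd (g' y v) * d y"
      unfolding d_def using v by algebra+
    then show ?thesis using d[OF y] by (simp add: prod_eq_iff)
  qed
  have "times_differentiable_on n T g" for n
  proof (induction n)
    case 0
    have "isCont g y" if "y \<in> T" for y using g'[OF that] by (rule has_derivative_continuous)
    then show ?case by (simp add: continuous_at_imp_continuous_on)
  next
    case (Suc n)
    have comp: "times_differentiable_on n T (\<lambda>y. frechet_derivative f (at (g y)) v)" for v
      by (rule times_differentiable_on_compose[where T = S and f = "\<lambda>x. frechet_derivative f (at x) v" and g = g])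
        (use assms Suc smooth_on_frechet_derivative[OF assms(3), of v] in \<open>auto simp: smooth_on_def\<close>)
    note tlin = times_differentiable_on_linear[OF assms(2)]
    note tmult = times_differentiable_on_bilinear[OF assms(2) bounded_bilinear_mult]
    have ab: "times_differentiable_on n T (\<lambda>y. fst (a y))" "times_differentiable_on n T (\<lambda>y. snd (a y))"
      "times_differentiable_on n T (\<lambda>y. fst (b y))" "times_differentiable_on n T (\<lambda>y. snd (b y))"
      unfolding a_def b_def by (rule tlin[OF bounded_linear_fst comp] tlin[OF bounded_linear_snd comp])+
    have tdiff: "times_differentiable_on n T (\<lambda>y. p y - q y)"
      if "times_differentiable_on n T p" "times_differentiable_on n T q" for p q :: "plane \<Rightarrow> real"
      using times_differentiable_on_add[OF assms(2) that(1) tlin[OF bounded_linear_minus[OF bounded_linear_ident] that(2)]]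
      by simp
    have inv: "times_differentiable_on n T (\<lambda>y. inverse (d y))"
      using d unfolding d_def
      by (rule times_differentiable_on_inverse[OF assms(2) tdiff[OF tmult[OF ab(1,4)] tmult[OF ab(2,3)]]])
    show ?case
    proof (rule times_differentiable_on_Suc[OF assms(2) g'])
      fix v
      have c: "times_differentiable_on n T (\<lambda>y. (fst v * snd (b y) - snd v * fst (b y)) * inverse (d y))"
        "times_differentiable_on n T (\<lambda>y. (fst (a y) * snd v - snd (a y) * fst v) * inverse (d y))"
        by (rule tmult tdiff inv ab times_differentiable_on_const)+
      have "times_differentiable_on n T (\<lambda>y. ((fst v * snd (b y) - snd v * fst (b y)) * inverse (d y), 0) +
          (0, (fst (a y) * snd v - snd (a y) * fst v) * inverse (d y)))"
        by (rule times_differentiable_on_add[OF assms(2)]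
            tlin[OF bounded_linear_Pair[OF bounded_linear_ident bounded_linear_zero] c(1)]
            tlin[OF bounded_linear_Pair[OF bounded_linear_zero bounded_linear_ident] c(2)])+
      then show "times_differentiable_on n T (\<lambda>y. g' y v)"
        by (rule times_differentiable_on_cong[OF assms(2)]) (simp add: g'_eq)
    qed
  qed
  then show ?thesis by (simp add: smooth_on_def)
qed

text \<open>The inverse function theorem supplies a homeomorphism between open sets with
  differentiable inverse; \<open>smooth_on_inverse_map_plane\<close> makes that inverse
  smooth.\<close>

lemma coordinates_on_of_nonsingular:
  fixes f :: "plane \<Rightarrow> plane"
  assumes "open S" "smooth_on S f" "p \<in> S" and inj: "\<And>v. frechet_derivative f (at p) v = 0 \<Longrightarrow> v = 0"
  obtains U where "p \<in> U" "U \<subseteq> S" "coordinates_on U f"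
proof -
  define f' where "f' x = pair_blinfun (frechet_derivative f (at x) (1, 0)) (frechet_derivative f (at x) (0, 1))" for x
  have f': "(f has_derivative blinfun_apply (f' x)) (at x)" if "x \<in> S" for x
    unfolding f'_def pair_blinfun_frechet_derivative[OF assms(2) that]
    using assms(2) that by (rule smooth_on_has_derivative)
  have cont: "continuous_on S f'"
    unfolding f'_def
    by (intro smooth_on_imp_continuous_on smooth_on_pair_blinfun smooth_on_frechet_derivative assms)
  have f'p: "blinfun_apply (f' p) = frechet_derivative f (at p)"
    unfolding f'_def by (rule pair_blinfun_frechet_derivative[OF assms(2,3)])
  have lin: "linear (blinfun_apply (f' p))" by (simp add: blinfun.bounded_linear_right bounded_linear.linear)
  have "inj (blinfun_apply (f' p))"
    using lin inj by (simp add: linear_injective_0 f'p)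
  then obtain h where h: "linear h" "h \<circ> blinfun_apply (f' p) = id"
    using linear_injective_left_inverse[OF lin] by blast
  have "Blinfun h o\<^sub>L f' p = id_blinfun"
    using h by (intro blinfun_eqI) (simp add: bounded_linear_Blinfun_apply linear_conv_bounded_linear[symmetric] pointfree_idE[OF h(2)])
  from inverse_function_theorem[OF assms(1) f' cont assms(3) this]
  obtain U V g g' where UV: "open U" "U \<subseteq> S" "p \<in> U" "open V" "homeomorphism U V f g"
    and g': "\<And>y. y \<in> V \<Longrightarrow> (g has_derivative g' y) (at y)"
    by metis
  note hom = UV(5)[unfolded homeomorphism_def]
  have fU: "f ` U = V" and inj_on: "inj_on f U"
    using hom by (auto intro: inj_on_inverseI)
  have "smooth_on V g"
    by (rule smooth_on_inverse_map_plane[OF assms(1) UV(4) assms(2) _ _ g']) (use hom UV(2) in auto)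
  then have "smooth_on V (inv_into U f)"
    by (rule smooth_on_cong[OF UV(4)]) (use hom inj_on in \<open>force simp: inv_into_f_eq\<close>)
  with fU inj_on UV assms(2) have "coordinates_on U f"
    unfolding coordinates_on_def using smooth_on_subset by blast
  with UV that show thesis by blast
qed

section \<open>One-variable calculus on open intervals\<close>

lemma open_interval_two_sided:
  assumes "open_interval I" "x \<in> I" "y \<in> I"
  obtains a b where "a < x" "a < y" "x < b" "y < b" "{a..b} \<subseteq> I"
proof -
  have I: "open I" "is_interval I" using assms(1) by (auto simp: open_interval_def)
  have mM: "min x y \<in> I" "max x y \<in> I" using assms(2,3) by (auto simp: min_def max_def)
  obtain e where e: "e > 0" "cball (min x y) e \<subseteq> I" using I(1) mM(1) open_contains_cball by blast
  obtain e' where e': "e' > 0" "cball (max x y) e' \<subseteq> I" using I(1) mM(2) open_contains_cball by blast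
  have ab: "min x y - e \<in> I" "max x y + e' \<in> I" using e e' by (auto simp: subset_iff dist_real_def)
  have "{min x y - e..max x y + e'} \<subseteq> I"
    using I(2) ab unfolding is_interval_1 by fastforce
  with e(1) e'(1) show thesis by (intro that[of "min x y - e" "max x y + e'"]) auto
qed

lemma open_interval_antiderivative:
  fixes f :: "real \<Rightarrow> real"
  assumes "open_interval I" "smooth_on I f"
  obtains F where "smooth_on I F" "\<And>x. x \<in> I \<Longrightarrow> (F has_vector_derivative f x) (at x)"
proof -
  have I: "open I" "is_interval I" using assms(1) by (auto simp: open_interval_def)
  obtain c where c: "c \<in> I" using assms(1) by (auto simp: open_interval_def)
  \<comment> \<open>The signed integral from c to x: at most one of the two terms can be nonzero,
    the other interval being empty or a single point.\<close>
  define F where "F x = integral {c..x} f - integral {x..c} f" for x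
  have F: "(F has_vector_derivative f x) (at x)" if x: "x \<in> I" for x
  proof -
    \<comment> \<open>A compact interval with both x and c in its interior; there F differs from the
      integral from a only by a constant.\<close>
    obtain a b where ab: "a < x" "a < c" "x < b" "c < b" "{a..b} \<subseteq> I"
      using open_interval_two_sided[OF assms(1) x c] by blast
    have cont: "continuous_on {a..b} f"
      using smooth_on_imp_continuous_on[OF assms(2)] ab(5) by (rule continuous_on_subset)
    have int: "f integrable_on {u..v}" if "{u..v} \<subseteq> {a..b}" for u v
      using cont that by (intro integrable_continuous_real) (rule continuous_on_subset)
    have F_eq: "integral {a..y} f - integral {a..c} f = F y" if y: "y \<in> {a<..<b}" for y
    proof (cases "c \<le> y")
      case True
      have "integral {a..c} f + integral {c..y} f = integral {a..y} f"
        using True ab y by (intro Henstock_Kurzweil_Integration.integral_combine int) auto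
      moreover have "integral {y..c} f = 0" using True by (cases "y = c") auto
      ultimately show ?thesis by (simp add: F_def)
    next
      case False
      have "integral {a..y} f + integral {y..c} f = integral {a..c} f"
        using False ab y by (intro Henstock_Kurzweil_Integration.integral_combine int) auto
      moreover have "integral {c..y} f = 0" using False by simp
      ultimately show ?thesis by (simp add: F_def)
    qed
    have "((\<lambda>y. integral {a..y} f) has_vector_derivative f x) (at x within {a..b})"
      using ab by (intro integral_has_vector_derivative cont) auto
    then have "((\<lambda>y. integral {a..y} f) has_vector_derivative f x) (at x)"
      using ab by (simp add: at_within_Icc_at)
    then have "((\<lambda>y. integral {a..y} f - integral {a..c} f) has_vector_derivative f x) (at x)"
      by (auto intro!: derivative_eq_intros)
    then show ?thesis
      by (rule has_vector_derivative_transform_within_open[OF _ open_greaterThanLessThan, of _ _ _ a b])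
        (use ab F_eq in auto)
  qed
  from smooth_on_antiderivative[OF I(1) F assms(2)] F that show thesis by blast
qed

text \<open>A positive derivative makes T strictly increasing, hence injective with an open interval
  as image. The derivative of the inverse g is 1/T' at g, so each order of g yields the
  next.\<close>

lemma open_interval_inverse:
  fixes T :: "real \<Rightarrow> real"
  assumes "open_interval I" "smooth_on I T" "\<And>x. x \<in> I \<Longrightarrow> (T has_vector_derivative T' x) (at x)"
    and "smooth_on I T'" "\<And>x. x \<in> I \<Longrightarrow> T' x > 0"
  obtains g where "open_interval (T ` I)" "smooth_on (T ` I) g" "\<And>x. x \<in> I \<Longrightarrow> g (T x) = x"
    "\<And>x. x \<in> I \<Longrightarrow> (g has_vector_derivative inverse (T' x)) (at (T x))"
proof -
  have I: "open I" "is_interval I" "I \<noteq> {}" using assms(1) by (auto simp: open_interval_def)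
  have less: "T x < T y" if "x \<in> I" "y \<in> I" "x < y" for x y
  proof (rule DERIV_pos_imp_increasing[OF that(3)])
    fix z assume "x \<le> z" "z \<le> y"
    then have "z \<in> I" using I(2) that unfolding is_interval_1 by blast
    then show "\<exists>w. (T has_real_derivative w) (at z) \<and> 0 < w"
      using assms(3,5) by (auto simp: has_real_derivative_iff_has_vector_derivative)
  qed
  have inj: "inj_on T I"
    by (rule inj_onI) (metis less linorder_neqE_linordered_idom order_less_irrefl)
  have cont: "continuous_on I T" by (rule smooth_on_imp_continuous_on[OF assms(2)])
  have op: "open (T ` I)" using cont I(1) inj by (rule invariance_of_domain)
  have intv: "open_interval (T ` I)"
    using op I connected_continuous_image[OF cont] by (auto simp: open_interval_def is_interval_connected_1)
  define g where "g = inv_into I T"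
  have g: "g (T x) = x" if "x \<in> I" for x using inj that by (simp add: g_def)
  have g': "(g has_vector_derivative inverse (T' x)) (at (T x))" if x: "x \<in> I" for x
    unfolding has_vector_derivative_def
  proof (rule has_derivative_inverse_strong[OF I(1) x cont g])
    show "(T has_derivative (\<lambda>h. h *\<^sub>R T' x)) (at x)"
      using assms(3)[OF x] by (simp add: has_vector_derivative_def)
    show "(\<lambda>h. h *\<^sub>R T' x) \<circ> (\<lambda>h. h *\<^sub>R inverse (T' x)) = id"
      using assms(5)[OF x] by (auto simp: fun_eq_iff)
  qed auto
  have g'': "(g has_derivative (\<lambda>h. h *\<^sub>R inverse (T' (g y)))) (at y)" if "y \<in> T ` I" for y
    using that g' g by (auto simp: has_vector_derivative_def)
  have "times_differentiable_on n (T ` I) g" for n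
  proof (induction n)
    case 0
    have "isCont g y" if "y \<in> T ` I" for y using g''[OF that] by (rule has_derivative_continuous)
    then show ?case by (simp add: continuous_at_imp_continuous_on)
  next
    case (Suc n)
    have pos: "T' (g y) \<noteq> 0" if "y \<in> T ` I" for y using that assms(5) g by force
    have "times_differentiable_on n (T ` I) (\<lambda>y. T' (g y))"
      by (rule times_differentiable_on_compose[where T = I and f = T' and g = g])
        (use op I Suc assms(4) g in \<open>auto simp: smooth_on_def\<close>)
    then have "times_differentiable_on n (T ` I) (\<lambda>y. inverse (T' (g y)))"
      by (rule times_differentiable_on_inverse[OF op _ pos])
    then have "times_differentiable_on n (T ` I) (\<lambda>y. h *\<^sub>R inverse (T' (g y)))" for h
      by (rule times_differentiable_on_linear[OF op bounded_linear_scaleR_right])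
    then show ?case by (intro times_differentiable_on_Suc[OF op g''])
  qed
  then have "smooth_on (T ` I) g" by (simp add: smooth_on_def)
  with intv g g' that show thesis by blast
qed


section \<open>Flow boxes and leaves\<close>

lemma coordinates_onD:
  assumes "coordinates_on U \<phi>"
  shows "open U" "open (\<phi> ` U)" "inj_on \<phi> U" "smooth_on U \<phi>" "smooth_on (\<phi> ` U) (inv_into U \<phi>)"
  using assms by (auto simp: coordinates_on_def)

lemma coordinates_on_has_derivative:
  assumes "coordinates_on U \<phi>" "q \<in> U"
  shows "(\<phi> has_derivative frechet_derivative \<phi> (at q)) (at q)"
    and "(inv_into U \<phi> has_derivative frechet_derivative (inv_into U \<phi>) (at (\<phi> q))) (at (\<phi> q))"
  using assms by (auto intro!: smooth_on_has_derivative dest: coordinates_onD)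

lemma coordinates_on_derivative_inverse:
  assumes "coordinates_on U \<phi>" "q \<in> U"
  shows "frechet_derivative (inv_into U \<phi>) (at (\<phi> q)) (frechet_derivative \<phi> (at q) v) = v"
    and "frechet_derivative \<phi> (at q) (frechet_derivative (inv_into U \<phi>) (at (\<phi> q)) v) = v"
proof -
  note c = coordinates_onD[OF assms(1)] and D = coordinates_on_has_derivative[OF assms]
  have "((\<lambda>x. inv_into U \<phi> (\<phi> x)) has_derivative
      (\<lambda>v. frechet_derivative (inv_into U \<phi>) (at (\<phi> q)) (frechet_derivative \<phi> (at q) v))) (at q)"
    using D by (rule has_derivative_compose)
  then have "((\<lambda>x. x) has_derivative
      (\<lambda>v. frechet_derivative (inv_into U \<phi>) (at (\<phi> q)) (frechet_derivative \<phi> (at q) v))) (at q)"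
    using c(1) assms(2) by (rule has_derivative_transform_within_open) (simp add: c(3))
  from has_derivative_unique[OF this has_derivative_ident]
  show "frechet_derivative (inv_into U \<phi>) (at (\<phi> q)) (frechet_derivative \<phi> (at q) v) = v" by metis
  have "(\<phi> has_derivative frechet_derivative \<phi> (at q)) (at (inv_into U \<phi> (\<phi> q)))"
    using D(1) by (simp add: c(3) assms(2))
  with D(2) have "((\<lambda>z. \<phi> (inv_into U \<phi> z)) has_derivative
      (\<lambda>v. frechet_derivative \<phi> (at q) (frechet_derivative (inv_into U \<phi>) (at (\<phi> q)) v))) (at (\<phi> q))"
    by (rule has_derivative_compose)
  then have "((\<lambda>z. z) has_derivative
      (\<lambda>v. frechet_derivative \<phi> (at q) (frechet_derivative (inv_into U \<phi>) (at (\<phi> q)) v))) (at (\<phi> q))"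
    by (rule has_derivative_transform_within_open[OF _ c(2)]) (use assms(2) in \<open>auto simp: f_inv_into_f\<close>)
  from has_derivative_unique[OF this has_derivative_ident]
  show "frechet_derivative \<phi> (at q) (frechet_derivative (inv_into U \<phi>) (at (\<phi> q)) v) = v" by metis
qed

lemma frechet_derivative_fst_snd:
  assumes "smooth_on U \<phi>" "q \<in> U"
  shows "frechet_derivative (\<lambda>p. fst (\<phi> p)) (at q) v = fst (frechet_derivative \<phi> (at q) v)"
    and "frechet_derivative (\<lambda>p. snd (\<phi> p)) (at q) v = snd (frechet_derivative \<phi> (at q) v)"
  using frechet_derivative_at[OF has_derivative_fst[OF smooth_on_has_derivative[OF assms]]]
    frechet_derivative_at[OF has_derivative_snd[OF smooth_on_has_derivative[OF assms]]]
  by metis+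

definition flow_box :: "plane set set \<Rightarrow> plane set \<Rightarrow> (plane \<Rightarrow> plane) \<Rightarrow> plane \<Rightarrow> plane \<Rightarrow> bool" where
  "flow_box F U \<phi> a b \<longleftrightarrow> coordinates_on U \<phi> \<and> \<phi> ` U = box a b \<and>
     (\<forall>L\<in>F. \<forall>C\<in>components (U \<inter> L). \<exists>c. C = {q\<in>U. snd (\<phi> q) = c})"

lemma foliation_flow_box:
  assumes "foliation F"
  obtains U \<phi> a b where "p \<in> U" "flow_box F U \<phi> a b"
proof -
  have "\<exists>U \<phi> a b. p \<in> U \<and> flow_box F U \<phi> a b"
    using assms unfolding foliation_def flow_box_def by (elim conjE) (erule spec)
  with that show thesis by blast
qed

lemma foliation_leaf:
  assumes "foliation F"
  obtains L where "L \<in> F" "p \<in> L"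
  using assms unfolding foliation_def partition_on_def by blast

lemma foliation_leaf_unique:
  assumes "foliation F" "L \<in> F" "L' \<in> F" "p \<in> L" "p \<in> L'"
  shows "L = L'"
  using assms unfolding foliation_def partition_on_def disjoint_def by blast

text \<open>A leaf may cross the box in many plaques, and the definition says only that each
  component of \<open>U \<inter> L\<close> is some level of the second coordinate. It is the level
  of q because q lies in its own component.\<close>

lemma flow_box_component:
  assumes "flow_box F U \<phi> a b" "L \<in> F" "q \<in> U \<inter> L"
  shows "connected_component_set (U \<inter> L) q = {q'\<in>U. snd (\<phi> q') = snd (\<phi> q)}"
proof -
  have "connected_component_set (U \<inter> L) q \<in> components (U \<inter> L)"
    using assms(3) by (rule componentsI)
  then obtain c where c: "connected_component_set (U \<inter> L) q = {q'\<in>U. snd (\<phi> q') = c}"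
    using assms(1,2) unfolding flow_box_def by meson
  have "q \<in> connected_component_set (U \<inter> L) q" using assms(3) by simp
  with c show ?thesis by auto
qed

lemma flow_box_plaque_subset:
  assumes "flow_box F U \<phi> a b" "L \<in> F" "q \<in> U" "q \<in> L"
  shows "{q'\<in>U. snd (\<phi> q') = snd (\<phi> q)} \<subseteq> L"
  using flow_box_component[OF assms(1,2)] assms(3,4) connected_component_subset[of "U \<inter> L" q] by auto

lemma flow_box_connected:
  assumes "flow_box F U \<phi> a b" "L \<in> F" "connected A" "A \<subseteq> U \<inter> L" "p \<in> A" "q \<in> A"
  shows "snd (\<phi> p) = snd (\<phi> q)"
proof -
  have "A \<subseteq> connected_component_set (U \<inter> L) q"
    using assms(6,3,4) by (rule connected_component_maximal)
  with flow_box_component[OF assms(1,2), of q] assms show ?thesis by auto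
qed

text \<open>A curve inside a leaf, cut down to a connected piece in the box, cannot jump between
  plaques, so its second coordinate is constant. Conversely, a straight segment along the level in
  the chart realises every vector of the kernel.\<close>

lemma tangent_space_flow_box:
  assumes F: "foliation F" and box: "flow_box F U \<phi> a b" and q: "q \<in> U"
  shows "tangent_space F q = {v. snd (frechet_derivative \<phi> (at q) v) = 0}"
proof (intro set_eqI iffI)
  have co: "coordinates_on U \<phi>" using box by (simp add: flow_box_def)
  note c = coordinates_onD[OF co]
  {
    fix v assume "v \<in> tangent_space F q"
    then obtain \<gamma> e L where \<gamma>: "e > 0" "smooth_on {-e<..<e} \<gamma>" "L \<in> F" "\<gamma> ` {-e<..<e} \<subseteq> L"
      "\<gamma> 0 = q" "(\<gamma> has_vector_derivative v) (at (0::real))"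
      unfolding tangent_space_def by blast
    have cont: "continuous_on {-e<..<e} \<gamma>" using \<gamma>(2) by (rule smooth_on_imp_continuous_on)
    then have "open ({-e<..<e} \<inter> \<gamma> -` U)"
      using c(1) by (simp add: continuous_open_preimage)
    moreover have "0 \<in> {-e<..<e} \<inter> \<gamma> -` U" using \<gamma>(1,5) q by simp
    ultimately obtain d where d: "d > 0" "ball 0 d \<subseteq> {-e<..<e} \<inter> \<gamma> -` U"
      unfolding open_contains_ball by blast
    have con: "connected (\<gamma> ` ball 0 d)"
      using cont d(2) by (intro connected_continuous_image) (auto intro: continuous_on_subset)
    have const: "snd (\<phi> q) = snd (\<phi> (\<gamma> t))" if "t \<in> ball 0 d" for t
    proof (rule flow_box_connected[OF box \<gamma>(3) con])
      show "\<gamma> ` ball 0 d \<subseteq> U \<inter> L" using d(2) \<gamma>(4) by blast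
      show "q \<in> \<gamma> ` ball 0 d" using \<gamma>(5) d(1) by force
      show "\<gamma> t \<in> \<gamma> ` ball 0 d" using that by blast
    qed
    have "((\<lambda>t. snd (\<phi> (\<gamma> t))) has_derivative (\<lambda>h. snd (frechet_derivative \<phi> (at q) (h *\<^sub>R v)))) (at 0)"
      using \<gamma>(5,6) coordinates_on_has_derivative(1)[OF co q]
      by (intro has_derivative_snd has_derivative_compose[where f = \<gamma> and g = \<phi>])
         (auto simp: has_vector_derivative_def)
    then have "((\<lambda>t. snd (\<phi> q)) has_derivative (\<lambda>h. snd (frechet_derivative \<phi> (at q) (h *\<^sub>R v)))) (at (0::real))"
      by (rule has_derivative_transform_within_open[OF _ open_ball[of 0 d]]) (use d const in auto)
    from has_derivative_unique[OF this has_derivative_const]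
    have "snd (frechet_derivative \<phi> (at q) (1 *\<^sub>R v)) = 0" by metis
    then show "v \<in> {v. snd (frechet_derivative \<phi> (at q) v) = 0}" by simp
  next
    fix v assume "v \<in> {v. snd (frechet_derivative \<phi> (at q) v) = 0}"
    define w where "w = frechet_derivative \<phi> (at q) v"
    have w: "snd w = 0" using \<open>v \<in> _\<close> by (simp add: w_def)
    obtain L where L: "L \<in> F" "q \<in> L" using F by (rule foliation_leaf)
    obtain e where e: "e > 0" "ball (\<phi> q) e \<subseteq> \<phi> ` U"
      using c(2) q unfolding open_contains_ball by blast
    \<comment> \<open>Keeps the segment \<open>\<phi> q + t *\<^sub>R w\<close> inside the ball
      around \<open>\<phi> q\<close> that the image of the chart contains.\<close>
    define d where "d = e / (norm w + 1)"
    have nw: "norm w + 1 > 0" by (simp add: add_nonneg_pos)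
    have d: "d > 0" using e(1) nw by (simp add: d_def)
    have in_U: "\<phi> q + t *\<^sub>R w \<in> \<phi> ` U" if "t \<in> {-d<..<d}" for t
    proof -
      have "norm (t *\<^sub>R w) \<le> d * norm w" using that by (auto intro!: mult_right_mono)
      also have "\<dots> < d * (norm w + 1)" using d by simp
      also have "\<dots> = e" using nw by (simp add: d_def)
      finally have "\<phi> q + t *\<^sub>R w \<in> ball (\<phi> q) e" by (simp add: dist_norm)
      then show ?thesis using e(2) by blast
    qed
    define \<gamma> where "\<gamma> t = inv_into U \<phi> (\<phi> q + t *\<^sub>R w)" for t
    have "smooth_on {-d<..<d} (\<lambda>t. \<phi> q + t *\<^sub>R w)"
      by (intro smooth_intros) auto
    then have smooth: "smooth_on {-d<..<d} \<gamma>"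
      unfolding \<gamma>_def using in_U c
      by (intro smooth_on_compose[where f = "inv_into U \<phi>" and T = "\<phi> ` U" and g = "\<lambda>t. \<phi> q + t *\<^sub>R w"]) auto
    have "\<gamma> t \<in> {q'\<in>U. snd (\<phi> q') = snd (\<phi> q)}" if "t \<in> {-d<..<d}" for t
      using in_U[OF that] w by (auto simp: \<gamma>_def f_inv_into_f inv_into_into)
    then have sub: "\<gamma> ` {-d<..<d} \<subseteq> L"
      using flow_box_plaque_subset[OF box L(1) q L(2)] by blast
    have \<gamma>0: "\<gamma> 0 = q" using c(3) q by (simp add: \<gamma>_def)
    have aff: "((\<lambda>t. \<phi> q + t *\<^sub>R w) has_derivative (\<lambda>h. h *\<^sub>R w)) (at 0)"
      by (auto intro!: derivative_eq_intros)
    have "(inv_into U \<phi> has_derivative frechet_derivative (inv_into U \<phi>) (at (\<phi> q))) (at (\<phi> q + 0 *\<^sub>R w))"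
      using coordinates_on_has_derivative(2)[OF co q] by simp
    with aff have "(\<gamma> has_derivative (\<lambda>h. frechet_derivative (inv_into U \<phi>) (at (\<phi> q)) (h *\<^sub>R w))) (at 0)"
      unfolding \<gamma>_def by (rule has_derivative_compose)
    moreover have "frechet_derivative (inv_into U \<phi>) (at (\<phi> q)) (h *\<^sub>R w) = h *\<^sub>R v" for h
      using linear_scale[OF bounded_linear.linear[OF smooth_on_bounded_linear[OF c(5), of "\<phi> q"]]] q
      by (simp add: w_def coordinates_on_derivative_inverse(1)[OF co q])
    ultimately have "(\<gamma> has_vector_derivative v) (at 0)"
      by (simp add: has_vector_derivative_def)
    with d smooth L(1) sub \<gamma>0 show "v \<in> tangent_space F q"
      unfolding tangent_space_def by blast
  }
qed

lemma tangent_curve_in_plaque: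
  assumes F: "foliation F" and box: "flow_box F U \<phi> a b"
    and J: "open J" "connected J" "\<gamma> ` J \<subseteq> U" and \<gamma>: "smooth_on J \<gamma>"
    and tan: "\<And>\<tau>. \<tau> \<in> J \<Longrightarrow> velocity \<gamma> \<tau> \<in> tangent_space F (\<gamma> \<tau>)"
    and st: "\<sigma> \<in> J" "\<tau> \<in> J"
  shows "snd (\<phi> (\<gamma> \<sigma>)) = snd (\<phi> (\<gamma> \<tau>))"
proof (rule has_derivative_zero_unique_connected[OF J(1,2) _ st])
  fix x assume x: "x \<in> J"
  then have U: "\<gamma> x \<in> U" using J(3) by blast
  have co: "coordinates_on U \<phi>" using box by (simp add: flow_box_def)
  have "(\<gamma> has_derivative (\<lambda>h. h *\<^sub>R velocity \<gamma> x)) (at x)"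
    using smooth_on_has_vector_derivative[OF \<gamma> x] by (simp add: has_vector_derivative_def)
  then have "((\<lambda>x. \<phi> (\<gamma> x)) has_derivative (\<lambda>h. frechet_derivative \<phi> (at (\<gamma> x)) (h *\<^sub>R velocity \<gamma> x))) (at x)"
    using coordinates_on_has_derivative(1)[OF co U] by (rule has_derivative_compose)
  then have "((\<lambda>x. snd (\<phi> (\<gamma> x))) has_derivative
      (\<lambda>h. snd (frechet_derivative \<phi> (at (\<gamma> x)) (h *\<^sub>R velocity \<gamma> x)))) (at x)"
    by (rule has_derivative_snd)
  moreover have "snd (frechet_derivative \<phi> (at (\<gamma> x)) (h *\<^sub>R velocity \<gamma> x)) = 0" for h
    using tan[OF x] tangent_space_flow_box[OF F box U]
      linear_scale[OF bounded_linear.linear[OF smooth_on_bounded_linear[OF coordinates_onD(4)[OF co] U]]]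
    by simp
  ultimately show "((\<lambda>x. snd (\<phi> (\<gamma> x))) has_derivative (\<lambda>x. 0)) (at x)" by simp
qed

lemma open_interval_neighbourhood:
  assumes "open I" "\<tau> \<in> I" "continuous_on I \<gamma>" "open U" "\<gamma> \<tau> \<in> U"
  obtains J :: "real set" where "open_interval J" "\<tau> \<in> J" "J \<subseteq> I" "\<gamma> ` J \<subseteq> U"
proof -
  have "open (I \<inter> \<gamma> -` U)" using assms by (simp add: continuous_open_preimage)
  then obtain d where d: "d > 0" "ball \<tau> d \<subseteq> I \<inter> \<gamma> -` U"
    using assms(2,5) unfolding open_contains_ball by blast
  have "open_interval (ball \<tau> d)"
    using d(1) by (simp add: open_interval_def is_interval_connected_1)
  with d that show thesis by (metis Int_subset_iff centre_in_ball image_subset_iff_subset_vimage)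
qed

text \<open>The leaf through the moving point is locally constant: in a flow box a tangent curve
  keeps to one plaque, and a plaque lies in one leaf. Connectedness of I makes it constant.\<close>

lemma tangent_curve_in_leaf:
  assumes F: "foliation F" and I: "open_interval I" and \<gamma>: "smooth_on I \<gamma>"
    and tan: "\<And>\<tau>. \<tau> \<in> I \<Longrightarrow> velocity \<gamma> \<tau> \<in> tangent_space F (\<gamma> \<tau>)"
  obtains L where "L \<in> F" "\<gamma> ` I \<subseteq> L"
proof -
  have Io: "open I" "connected I" "I \<noteq> {}" using I by (auto simp: open_interval_def is_interval_connected_1)
  define leaf where "leaf p = (THE L. L \<in> F \<and> p \<in> L)" for p
  have leaf: "leaf p \<in> F" "p \<in> leaf p" for p
  proof -
    have "\<exists>!L. L \<in> F \<and> p \<in> L" using foliation_leaf[OF F] foliation_leaf_unique[OF F] by metis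
    from theI'[OF this] show "leaf p \<in> F" "p \<in> leaf p" by (auto simp: leaf_def)
  qed
  have leaf_eq: "leaf (\<gamma> \<sigma>) = leaf (\<gamma> \<tau>)" if "\<sigma> \<in> I" "\<tau> \<in> I" for \<sigma> \<tau>
  proof (rule connected_local_const[where f = "\<lambda>\<tau>. leaf (\<gamma> \<tau>)", OF Io(2) that], intro ballI)
    fix \<tau> assume \<tau>: "\<tau> \<in> I"
    obtain U \<phi> a b where U: "\<gamma> \<tau> \<in> U" and box: "flow_box F U \<phi> a b" using F by (rule foliation_flow_box)
    have "open U" using box by (simp add: flow_box_def coordinates_on_def)
    then obtain J where J: "open_interval J" "\<tau> \<in> J" "J \<subseteq> I" "\<gamma> ` J \<subseteq> U"
      using open_interval_neighbourhood[OF Io(1) \<tau> smooth_on_imp_continuous_on[OF \<gamma>]] U by metis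
    have "leaf (\<gamma> \<tau>) = leaf (\<gamma> \<sigma>)" if "\<sigma> \<in> J" for \<sigma>
    proof -
      have "snd (\<phi> (\<gamma> \<sigma>)) = snd (\<phi> (\<gamma> \<tau>))"
        by (rule tangent_curve_in_plaque[OF F box _ _ J(4) smooth_on_subset[OF \<gamma> J(3)] tan that J(2)])
          (use J(1,3) in \<open>auto simp: open_interval_def is_interval_connected_1\<close>)
      then have "\<gamma> \<sigma> \<in> leaf (\<gamma> \<tau>)"
        using flow_box_plaque_subset[OF box leaf(1) U leaf(2)] J(4) that by auto
      then show ?thesis using foliation_leaf_unique[OF F] leaf by blast
    qed
    moreover have "\<forall>\<^sub>F \<sigma> in at \<tau> within I. \<sigma> \<in> J"
      using J(1,2) by (auto simp: open_interval_def eventually_at_topological)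
    ultimately show "\<forall>\<^sub>F \<sigma> in at \<tau> within I. leaf (\<gamma> \<tau>) = leaf (\<gamma> \<sigma>)"
      by (auto elim: eventually_mono)
  qed
  obtain \<tau> where "\<tau> \<in> I" using Io(3) by blast
  show thesis
  proof
    show "leaf (\<gamma> \<tau>) \<in> F" by (rule leaf)
    show "\<gamma> ` I \<subseteq> leaf (\<gamma> \<tau>)" using leaf_eq[OF _ \<open>\<tau> \<in> I\<close>] leaf(2) by blast
  qed
qed


section \<open>Web frames\<close>

definition form_det :: "(plane \<Rightarrow>\<^sub>L real) \<Rightarrow> (plane \<Rightarrow>\<^sub>L real) \<Rightarrow> real" where
  "form_det \<alpha> \<beta> = blinfun_apply \<alpha> (1, 0) * blinfun_apply \<beta> (0, 1) - blinfun_apply \<alpha> (0, 1) * blinfun_apply \<beta> (1, 0)"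

lemma form_apply:
  fixes \<alpha> :: "plane \<Rightarrow>\<^sub>L 'b::real_normed_vector"
  shows "blinfun_apply \<alpha> v = fst v *\<^sub>R blinfun_apply \<alpha> (1, 0) + snd v *\<^sub>R blinfun_apply \<alpha> (0, 1)"
  by (rule linear_plane) (simp add: bounded_linear.linear blinfun.bounded_linear_right)

lemma form_eqI:
  fixes \<alpha> :: "plane \<Rightarrow>\<^sub>L 'b::real_normed_vector"
  assumes "blinfun_apply \<alpha> (1, 0) = blinfun_apply \<beta> (1, 0)" "blinfun_apply \<alpha> (0, 1) = blinfun_apply \<beta> (0, 1)"
  shows "\<alpha> = \<beta>"
  by (rule blinfun_eqI) (metis assms form_apply)

lemma form_det_nonzero:
  assumes "\<forall>a b. a *\<^sub>R \<alpha> + b *\<^sub>R \<beta> = 0 \<longrightarrow> a = 0 \<and> b = 0"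
  shows "form_det \<alpha> \<beta> \<noteq> 0"
proof
  assume "form_det \<alpha> \<beta> = 0"
  then have "blinfun_apply \<beta> (0, 1) *\<^sub>R \<alpha> + (- blinfun_apply \<alpha> (0, 1)) *\<^sub>R \<beta> = 0"
    "blinfun_apply \<beta> (1, 0) *\<^sub>R \<alpha> + (- blinfun_apply \<alpha> (1, 0)) *\<^sub>R \<beta> = 0"
    by (auto intro!: form_eqI simp: form_det_def blinfun.bilinear_simps algebra_simps)
  then have "blinfun_apply \<alpha> (0, 1) = 0" "blinfun_apply \<alpha> (1, 0) = 0"
    using assms[rule_format, of "blinfun_apply \<beta> (0, 1)" "- blinfun_apply \<alpha> (0, 1)"]
      assms[rule_format, of "blinfun_apply \<beta> (1, 0)" "- blinfun_apply \<alpha> (1, 0)"] by simp_all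
  then have "\<alpha> = 0" by (intro form_eqI) auto
  then show False using assms[rule_format, of 1 0] by simp
qed

lemma form_det_cramer:
  assumes "form_det \<alpha> \<beta> \<noteq> 0"
  shows "v = ((blinfun_apply \<alpha> v * blinfun_apply \<beta> (0, 1) - blinfun_apply \<beta> v * blinfun_apply \<alpha> (0, 1)) / form_det \<alpha> \<beta>,
    (blinfun_apply \<beta> v * blinfun_apply \<alpha> (1, 0) - blinfun_apply \<alpha> v * blinfun_apply \<beta> (1, 0)) / form_det \<alpha> \<beta>)"
proof -
  have v: "blinfun_apply \<alpha> v = fst v * blinfun_apply \<alpha> (1, 0) + snd v * blinfun_apply \<alpha> (0, 1)"
    "blinfun_apply \<beta> v = fst v * blinfun_apply \<beta> (1, 0) + snd v * blinfun_apply \<beta> (0, 1)"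
    by (subst form_apply; simp)+
  have "fst v * form_det \<alpha> \<beta> = blinfun_apply \<alpha> v * blinfun_apply \<beta> (0, 1) - blinfun_apply \<beta> v * blinfun_apply \<alpha> (0, 1)"
    "snd v * form_det \<alpha> \<beta> = blinfun_apply \<beta> v * blinfun_apply \<alpha> (1, 0) - blinfun_apply \<alpha> v * blinfun_apply \<beta> (1, 0)"
    unfolding v form_det_def by (simp_all add: algebra_simps)
  then show ?thesis using assms by (simp add: prod_eq_iff field_simps)
qed

lemma form_det_eqI:
  assumes "form_det \<alpha> \<beta> \<noteq> 0" "blinfun_apply \<alpha> v = blinfun_apply \<alpha> w" "blinfun_apply \<beta> v = blinfun_apply \<beta> w"
  shows "v = w"
  using form_det_cramer[OF assms(1), of v] form_det_cramer[OF assms(1), of w] assms(2,3) by simp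

lemma form_det_solve:
  assumes "form_det \<alpha> \<beta> \<noteq> 0"
  obtains v where "blinfun_apply \<alpha> v = r" "blinfun_apply \<beta> v = s"
proof
  let ?v = "((r * blinfun_apply \<beta> (0, 1) - s * blinfun_apply \<alpha> (0, 1)) / form_det \<alpha> \<beta>,
    (s * blinfun_apply \<alpha> (1, 0) - r * blinfun_apply \<beta> (1, 0)) / form_det \<alpha> \<beta>)"
  have num: "(r * blinfun_apply \<beta> (0, 1) - s * blinfun_apply \<alpha> (0, 1)) * blinfun_apply \<alpha> (1, 0) +
      (s * blinfun_apply \<alpha> (1, 0) - r * blinfun_apply \<beta> (1, 0)) * blinfun_apply \<alpha> (0, 1) = r * form_det \<alpha> \<beta>"
    "(r * blinfun_apply \<beta> (0, 1) - s * blinfun_apply \<alpha> (0, 1)) * blinfun_apply \<beta> (1, 0) +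
      (s * blinfun_apply \<alpha> (1, 0) - r * blinfun_apply \<beta> (1, 0)) * blinfun_apply \<beta> (0, 1) = s * form_det \<alpha> \<beta>"
    by (simp_all add: form_det_def algebra_simps)
  show "blinfun_apply \<alpha> ?v = r" "blinfun_apply \<beta> ?v = s"
    unfolding form_apply[of _ ?v] using assms num by (simp_all add: add_divide_distrib[symmetric])
qed

lemma form_kernel_parallel:
  fixes \<alpha> :: "plane \<Rightarrow>\<^sub>L real"
  assumes "\<alpha> \<noteq> 0" "blinfun_apply \<alpha> v = 0" "blinfun_apply \<alpha> w = 0" "v \<noteq> 0"
  shows "\<exists>k. w = k *\<^sub>R v"
proof -
  define a b where "a = blinfun_apply \<alpha> (1, 0)" and "b = blinfun_apply \<alpha> (0, 1)"
  have ab: "a \<noteq> 0 \<or> b \<noteq> 0" using assms(1) form_eqI[of \<alpha> 0] by (auto simp: a_def b_def)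
  have v: "fst v * a + snd v * b = 0" and w: "fst w * a + snd w * b = 0"
    using assms(2,3) form_apply[of \<alpha> v] form_apply[of \<alpha> w] by (simp_all add: a_def b_def)
  have "a * (fst v * snd w - snd v * fst w) = 0" "b * (fst v * snd w - snd v * fst w) = 0"
    using v w by algebra+
  then have d: "fst v * snd w = snd v * fst w" using ab by auto
  have "fst v \<noteq> 0 \<or> snd v \<noteq> 0" using assms(4) by (auto simp: prod_eq_iff)
  then have "w = (fst w / fst v) *\<^sub>R v \<or> w = (snd w / snd v) *\<^sub>R v"
    using d by (auto simp: prod_eq_iff field_simps)
  then show ?thesis by blast
qed

text \<open>The form with coefficients (a, b) kills (-b, a); if \<alpha>' kills it too, the
  coefficient vectors are parallel. The factor is the coefficient of orthogonal projection, which
  avoids distinguishing a = 0 from b = 0.\<close>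

lemma form_proportional:
  fixes \<alpha> \<alpha>' :: "plane \<Rightarrow>\<^sub>L real"
  assumes "\<alpha> \<noteq> 0" and ker: "\<And>v. blinfun_apply \<alpha> v = 0 \<Longrightarrow> blinfun_apply \<alpha>' v = 0"
  shows "\<exists>f. \<alpha>' = f *\<^sub>R \<alpha>"
proof -
  define a b where "a = blinfun_apply \<alpha> (1, 0)" and "b = blinfun_apply \<alpha> (0, 1)"
  define a' b' where "a' = blinfun_apply \<alpha>' (1, 0)" and "b' = blinfun_apply \<alpha>' (0, 1)"
  have ab: "a\<^sup>2 + b\<^sup>2 \<noteq> 0" using assms(1) form_eqI[of \<alpha> 0] by (auto simp: a_def b_def)
  have "blinfun_apply \<alpha> (- b, a) = 0" by (subst form_apply) (simp add: a_def b_def)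
  from ker[OF this] have "blinfun_apply \<alpha>' (- b, a) = 0" .
  then have "a * b' = b * a'" by (subst (asm) form_apply) (simp add: a'_def b'_def)
  then have "a' * (a\<^sup>2 + b\<^sup>2) = (a' * a + b' * b) * a" "b' * (a\<^sup>2 + b\<^sup>2) = (a' * a + b' * b) * b"
    by algebra+
  then have "\<alpha>' = ((a' * a + b' * b) / (a\<^sup>2 + b\<^sup>2)) *\<^sub>R \<alpha>"
    using ab by (intro form_eqI) (simp_all add: blinfun.scaleR_left a_def[symmetric] b_def[symmetric]
        a'_def[symmetric] b'_def[symmetric] field_simps)
  then show ?thesis by blast
qed

text \<open>Three pairwise transverse kernels determine the pair of forms up to one common factor.
  Each kernel yields a factor of its own, and evaluating the third relation on the basis dual to
  \<alpha>, \<beta> identifies all three. This is why a web fixes its frames so rigidly.\<close>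

lemma forms_proportional:
  fixes \<alpha> \<beta> :: "plane \<Rightarrow>\<^sub>L real"
  assumes "form_det \<alpha> \<beta> \<noteq> 0" "c \<noteq> 0"
    and "\<And>v. blinfun_apply \<alpha> v = 0 \<Longrightarrow> blinfun_apply \<alpha>' v = 0"
    and "\<And>v. blinfun_apply \<beta> v = 0 \<Longrightarrow> blinfun_apply \<beta>' v = 0"
    and "\<And>v. blinfun_apply (\<alpha> + c *\<^sub>R \<beta>) v = 0 \<Longrightarrow> blinfun_apply (\<alpha>' + c *\<^sub>R \<beta>') v = 0"
  shows "\<exists>f. \<alpha>' = f *\<^sub>R \<alpha> \<and> \<beta>' = f *\<^sub>R \<beta>"
proof -
  have nz: "\<alpha> \<noteq> 0" "\<beta> \<noteq> 0" using assms(1) by (auto simp: form_det_def)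
  have nz': "\<alpha> + c *\<^sub>R \<beta> \<noteq> 0"
  proof
    assume *: "\<alpha> + c *\<^sub>R \<beta> = 0"
    obtain v where "blinfun_apply \<alpha> v = 1" "blinfun_apply \<beta> v = 0" using assms(1) by (rule form_det_solve)
    with arg_cong[OF *, of "\<lambda>\<gamma>. blinfun_apply \<gamma> v"] show False by (simp add: blinfun.bilinear_simps)
  qed
  obtain f where f: "\<alpha>' = f *\<^sub>R \<alpha>" using form_proportional[OF nz(1) assms(3)] by blast
  obtain g where g: "\<beta>' = g *\<^sub>R \<beta>" using form_proportional[OF nz(2) assms(4)] by blast
  obtain h where h: "\<alpha>' + c *\<^sub>R \<beta>' = h *\<^sub>R (\<alpha> + c *\<^sub>R \<beta>)" using form_proportional[OF nz' assms(5)] by blast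
  obtain v where v: "blinfun_apply \<alpha> v = 1" "blinfun_apply \<beta> v = 0" using assms(1) by (rule form_det_solve)
  obtain w where w: "blinfun_apply \<alpha> w = 0" "blinfun_apply \<beta> w = 1" using assms(1) by (rule form_det_solve)
  have "f = h" using arg_cong[OF h, of "\<lambda>\<gamma>. blinfun_apply \<gamma> v"] v by (simp add: f g blinfun.bilinear_simps)
  moreover have "g = h" using arg_cong[OF h, of "\<lambda>\<gamma>. blinfun_apply \<gamma> w"] w assms(2) by (simp add: f g blinfun.bilinear_simps)
  ultimately show ?thesis using f g by blast
qed

section \<open>Homogeneous coordinates on the projective line and local frames of a web\<close>

lemma RP1_eq: "RP1 = {proj_point s t |s t. (s, t) \<noteq> (0, 0)}"
proof (intro set_eqI iffI)
  fix l assume "l \<in> RP1"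
  then have l: "subspace l" "dim l = 1" by (auto simp: RP1_def)
  obtain B where B: "B \<subseteq> l" "independent B" "l \<subseteq> span B" "card B = dim l"
    using basis_exists by blast
  obtain p where p: "B = {p}" using B(4) l(2) card_1_singletonE by metis
  have "p \<noteq> 0" using B(2) p dependent_zero by blast
  moreover have "l = span {p}" using B p l(1) by (simp add: span_minimal subset_antisym)
  ultimately show "l \<in> {proj_point s t |s t. (s, t) \<noteq> (0, 0)}"
    unfolding proj_point_def by (cases p) (auto simp: zero_prod_def)
next
  fix l assume "l \<in> {proj_point s t |s t. (s, t) \<noteq> (0, 0)}"
  then obtain s t where "l = span {(s, t)}" "(s, t) \<noteq> (0, 0)" by (auto simp: proj_point_def)
  then show "l \<in> RP1" by (simp add: RP1_def subspace_span dim_singleton zero_prod_def)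
qed

lemma proj_point_eqI:
  assumes "(s, t) \<noteq> (0, 0)" "k \<noteq> 0"
  shows "proj_point (k * s) (k * t) = proj_point s t"
proof -
  have "(k * s, k * t) \<in> span {(s, t)}" using span_scale[OF span_base, of "(s, t)" "{(s, t)}" k] by simp
  moreover have "(s, t) = inverse k *\<^sub>R (k * s, k * t)" using assms(2) by simp
  then have "(s, t) \<in> span {(k * s, k * t)}" by (metis span_scale span_base singletonI)
  ultimately show ?thesis unfolding proj_point_def
    by (intro subset_antisym span_minimal subspace_span) simp_all
qed

text \<open>Independence of the two forms is expressed by \<open>form_det\<close>, since this is the
  number that Cramer's rule divides by.\<close>

definition web_frame ::
  "(plane set \<Rightarrow> plane set set) \<Rightarrow> plane set \<Rightarrow> (plane \<Rightarrow> plane \<Rightarrow>\<^sub>L real) \<Rightarrow> (plane \<Rightarrow> plane \<Rightarrow>\<^sub>L real) \<Rightarrow> bool" where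
  "web_frame F U \<omega>\<^sub>0 \<omega>\<^sub>1 \<longleftrightarrow> open U \<and> smooth_on U \<omega>\<^sub>0 \<and> smooth_on U \<omega>\<^sub>1 \<and>
     (\<forall>q\<in>U. form_det (\<omega>\<^sub>0 q) (\<omega>\<^sub>1 q) \<noteq> 0 \<and>
       (\<forall>s t. (s, t) \<noteq> (0, 0) \<longrightarrow>
          tangent_space (F (proj_point s t)) q = {v. s * blinfun_apply (\<omega>\<^sub>0 q) v + t * blinfun_apply (\<omega>\<^sub>1 q) v = 0}))"

lemma veronese_web_frame:
  assumes "veronese_web F"
  obtains U \<omega>\<^sub>0 \<omega>\<^sub>1 where "p \<in> U" "web_frame F U \<omega>\<^sub>0 \<omega>\<^sub>1"
proof -
  have "\<exists>U. \<exists>\<omega>\<^sub>0 \<omega>\<^sub>1 :: plane \<Rightarrow> plane \<Rightarrow>\<^sub>L real.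
        open U \<and> p \<in> U \<and> smooth_on U \<omega>\<^sub>0 \<and> smooth_on U \<omega>\<^sub>1 \<and>
        (\<forall>q\<in>U. (\<forall>a b. a *\<^sub>R \<omega>\<^sub>0 q + b *\<^sub>R \<omega>\<^sub>1 q = 0 \<longrightarrow> a = 0 \<and> b = 0) \<and>
           (\<forall>s t. (s, t) \<noteq> (0, 0) \<longrightarrow>
              tangent_space (F (proj_point s t)) q =
                {v. blinfun_apply (s *\<^sub>R \<omega>\<^sub>0 q + t *\<^sub>R \<omega>\<^sub>1 q) v = 0}))"
    using assms unfolding veronese_web_def by (elim conjE) (erule spec)
  then show thesis
  proof (elim exE conjE)
    fix U and \<omega>\<^sub>0 \<omega>\<^sub>1 :: "plane \<Rightarrow> plane \<Rightarrow>\<^sub>L real"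
    assume fr: "open U" "p \<in> U" "smooth_on U \<omega>\<^sub>0" "smooth_on U \<omega>\<^sub>1"
      and H: "\<forall>q\<in>U. (\<forall>a b. a *\<^sub>R \<omega>\<^sub>0 q + b *\<^sub>R \<omega>\<^sub>1 q = 0 \<longrightarrow> a = 0 \<and> b = 0) \<and>
           (\<forall>s t. (s, t) \<noteq> (0, 0) \<longrightarrow>
              tangent_space (F (proj_point s t)) q =
                {v. blinfun_apply (s *\<^sub>R \<omega>\<^sub>0 q + t *\<^sub>R \<omega>\<^sub>1 q) v = 0})"
    have indep: "\<forall>a b. a *\<^sub>R \<omega>\<^sub>0 q + b *\<^sub>R \<omega>\<^sub>1 q = 0 \<longrightarrow> a = 0 \<and> b = 0" if "q \<in> U" for q
      using H that by blast
    have ker: "tangent_space (F (proj_point s t)) q = {v. blinfun_apply (s *\<^sub>R \<omega>\<^sub>0 q + t *\<^sub>R \<omega>\<^sub>1 q) v = 0}"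
      if "q \<in> U" "(s, t) \<noteq> (0, 0)" for q s t
      using H that by blast
    have "web_frame F U \<omega>\<^sub>0 \<omega>\<^sub>1"
      unfolding web_frame_def using fr form_det_nonzero[OF indep] ker
      by (simp add: blinfun.add_left blinfun.scaleR_left)
    with fr(2) show thesis by (rule that)
  qed
qed

lemma veronese_web_foliation:
  "veronese_web F \<Longrightarrow> l \<in> RP1 \<Longrightarrow> foliation (F l)"
  by (simp add: veronese_web_def)

text \<open>With h and k the values of the two forms on v, the condition s h + t k = 0 has, up to
  scale, the single solution (k, -h), as h and k do not both vanish. So a frame reads off the one
  foliation to which v is tangent.\<close>

lemma web_frame_direction:
  assumes fr: "web_frame F U \<omega>\<^sub>0 \<omega>\<^sub>1" and q: "q \<in> U" and v: "v \<noteq> 0" and l: "l \<in> RP1"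
  shows "v \<in> tangent_space (F l) q \<longleftrightarrow> l = proj_point (blinfun_apply (\<omega>\<^sub>1 q) v) (- blinfun_apply (\<omega>\<^sub>0 q) v)"
proof -
  define h where "h = blinfun_apply (\<omega>\<^sub>0 q) v"
  define k where "k = blinfun_apply (\<omega>\<^sub>1 q) v"
  have det: "form_det (\<omega>\<^sub>0 q) (\<omega>\<^sub>1 q) \<noteq> 0" using fr q by (simp add: web_frame_def)
  have ker: "v \<in> tangent_space (F (proj_point s t)) q \<longleftrightarrow> s * h + t * k = 0" if "(s, t) \<noteq> (0, 0)" for s t
    using fr q that unfolding web_frame_def h_def k_def by blast
  have hk: "(k, - h) \<noteq> (0, 0)"
    using form_det_eqI[OF det, of v 0] v by (auto simp: h_def k_def)
  obtain s t where st: "l = proj_point s t" "(s, t) \<noteq> (0, 0)" using l unfolding RP1_eq by blast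
  show ?thesis unfolding h_def[symmetric] k_def[symmetric]
  proof
    assume "v \<in> tangent_space (F l) q"
    then have eq: "s * h + t * k = 0" using ker st by simp
    show "l = proj_point k (- h)"
    proof (cases "k = 0")
      case True
      with hk have "h \<noteq> 0" by simp
      with eq True have "s = 0" by simp
      with st have "t \<noteq> 0" by simp
      have "l = proj_point ((- t / h) * k) ((- t / h) * - h)"
        using st \<open>s = 0\<close> True \<open>h \<noteq> 0\<close> by simp
      also have "\<dots> = proj_point k (- h)"
        using hk \<open>t \<noteq> 0\<close> \<open>h \<noteq> 0\<close> by (intro proj_point_eqI) auto
      finally show ?thesis .
    next
      case False
      then have t: "t = (s / k) * - h" using eq by (simp add: field_simps)
      with st have "s \<noteq> 0" by auto
      have "l = proj_point ((s / k) * k) ((s / k) * - h)" using st False t by simp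
      also have "\<dots> = proj_point k (- h)"
        using hk \<open>s \<noteq> 0\<close> False by (intro proj_point_eqI) auto
      finally show ?thesis .
    qed
  next
    assume "l = proj_point k (- h)"
    then show "v \<in> tangent_space (F l) q" using ker[OF hk] by simp
  qed
qed

lemma web_frame_direction_in_RP1:
  assumes "web_frame F U \<omega>\<^sub>0 \<omega>\<^sub>1" "q \<in> U" "v \<noteq> 0"
  shows "proj_point (blinfun_apply (\<omega>\<^sub>1 q) v) (- blinfun_apply (\<omega>\<^sub>0 q) v) \<in> RP1"
proof -
  have "form_det (\<omega>\<^sub>0 q) (\<omega>\<^sub>1 q) \<noteq> 0" using assms by (simp add: web_frame_def)
  from form_det_eqI[OF this, of v 0] assms(3) show ?thesis unfolding RP1_eq by fastforce
qed

text \<open>The kernels at (1:0), (0:1) and (1:1), common to both frames, are enough to apply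
  \<open>forms_proportional\<close>.\<close>

lemma web_frame_scale:
  assumes "web_frame F U \<omega>\<^sub>0 \<omega>\<^sub>1" "web_frame F U' \<eta>\<^sub>0 \<eta>\<^sub>1" "q \<in> U" "q \<in> U'"
  shows "\<exists>f. \<eta>\<^sub>0 q = f *\<^sub>R \<omega>\<^sub>0 q \<and> \<eta>\<^sub>1 q = f *\<^sub>R \<omega>\<^sub>1 q"
proof (rule forms_proportional[where c = 1])
  have ker: "s * blinfun_apply (\<omega>\<^sub>0 q) v + t * blinfun_apply (\<omega>\<^sub>1 q) v = 0 \<longleftrightarrow>
      s * blinfun_apply (\<eta>\<^sub>0 q) v + t * blinfun_apply (\<eta>\<^sub>1 q) v = 0" if "(s, t) \<noteq> (0, 0)" for s t v
    using assms that unfolding web_frame_def by blast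
  show "blinfun_apply (\<eta>\<^sub>0 q) v = 0" if "blinfun_apply (\<omega>\<^sub>0 q) v = 0" for v
    using ker[of 1 0 v] that by simp
  show "blinfun_apply (\<eta>\<^sub>1 q) v = 0" if "blinfun_apply (\<omega>\<^sub>1 q) v = 0" for v
    using ker[of 0 1 v] that by simp
  show "blinfun_apply (\<eta>\<^sub>0 q + 1 *\<^sub>R \<eta>\<^sub>1 q) v = 0" if "blinfun_apply (\<omega>\<^sub>0 q + 1 *\<^sub>R \<omega>\<^sub>1 q) v = 0" for v
    using ker[of 1 1 v] that by (simp add: blinfun.bilinear_simps)
  show "form_det (\<omega>\<^sub>0 q) (\<omega>\<^sub>1 q) \<noteq> 0" using assms by (simp add: web_frame_def)
qed simp


section \<open>The connection of a web\<close>

text \<open>The first clause is vanishing torsion. The second is \<nabla>\<omega>_i = \<theta>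
  \<otimes> \<omega>_i, written out as (D_u \<omega>_i)(v) - \<omega>_i(G(u, v)) = \<theta>(u)
  \<omega>_i(v). The form \<theta> is quantified inside because it depends on the scale of the
  frame, while G does not.\<close>

definition connection_at ::
  "(plane \<Rightarrow> plane \<Rightarrow>\<^sub>L real) \<Rightarrow> (plane \<Rightarrow> plane \<Rightarrow>\<^sub>L real) \<Rightarrow> plane \<Rightarrow> (plane \<Rightarrow>\<^sub>L plane \<Rightarrow>\<^sub>L plane) \<Rightarrow> bool" where
  "connection_at \<omega>\<^sub>0 \<omega>\<^sub>1 q G \<longleftrightarrow>
     (\<forall>u v. blinfun_apply (blinfun_apply G u) v = blinfun_apply (blinfun_apply G v) u) \<and>
     (\<exists>\<theta> :: plane \<Rightarrow> real. \<forall>u v.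
        blinfun_apply (\<omega>\<^sub>0 q) (blinfun_apply (blinfun_apply G u) v) =
          blinfun_apply (frechet_derivative \<omega>\<^sub>0 (at q) u) v - \<theta> u * blinfun_apply (\<omega>\<^sub>0 q) v \<and>
        blinfun_apply (\<omega>\<^sub>1 q) (blinfun_apply (blinfun_apply G u) v) =
          blinfun_apply (frechet_derivative \<omega>\<^sub>1 (at q) u) v - \<theta> u * blinfun_apply (\<omega>\<^sub>1 q) v)"

text \<open>The two forms share one \<theta> and together detect vectors, so two solutions differ at
  (u, v) by a scalar depending on u alone, times v. Symmetry in u and v leaves no room for that
  scalar in dimension two.\<close>

lemma connection_at_unique:
  assumes det: "form_det (\<omega>\<^sub>0 q) (\<omega>\<^sub>1 q) \<noteq> 0"
    and G: "connection_at \<omega>\<^sub>0 \<omega>\<^sub>1 q G" and H: "connection_at \<omega>\<^sub>0 \<omega>\<^sub>1 q H"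
  shows "G = H"
proof -
  obtain \<theta> where sG: "\<And>u v. blinfun_apply (blinfun_apply G u) v = blinfun_apply (blinfun_apply G v) u" and \<theta>:
    "\<And>u v. blinfun_apply (\<omega>\<^sub>0 q) (blinfun_apply (blinfun_apply G u) v) =
          blinfun_apply (frechet_derivative \<omega>\<^sub>0 (at q) u) v - \<theta> u * blinfun_apply (\<omega>\<^sub>0 q) v"
    "\<And>u v. blinfun_apply (\<omega>\<^sub>1 q) (blinfun_apply (blinfun_apply G u) v) =
          blinfun_apply (frechet_derivative \<omega>\<^sub>1 (at q) u) v - \<theta> u * blinfun_apply (\<omega>\<^sub>1 q) v"
    using G unfolding connection_at_def by blast
  obtain \<kappa> where sH: "\<And>u v. blinfun_apply (blinfun_apply H u) v = blinfun_apply (blinfun_apply H v) u" and \<kappa>: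
    "\<And>u v. blinfun_apply (\<omega>\<^sub>0 q) (blinfun_apply (blinfun_apply H u) v) =
          blinfun_apply (frechet_derivative \<omega>\<^sub>0 (at q) u) v - \<kappa> u * blinfun_apply (\<omega>\<^sub>0 q) v"
    "\<And>u v. blinfun_apply (\<omega>\<^sub>1 q) (blinfun_apply (blinfun_apply H u) v) =
          blinfun_apply (frechet_derivative \<omega>\<^sub>1 (at q) u) v - \<kappa> u * blinfun_apply (\<omega>\<^sub>1 q) v"
    using H unfolding connection_at_def by blast
  have diff: "blinfun_apply (blinfun_apply H u) v = blinfun_apply (blinfun_apply G u) v + (\<theta> u - \<kappa> u) *\<^sub>R v" for u v
    by (rule form_det_eqI[OF det]) (simp_all add: blinfun.bilinear_simps \<theta> \<kappa> algebra_simps)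
  have "blinfun_apply (blinfun_apply H u) v = blinfun_apply (blinfun_apply G u) v" for u v
  proof (cases "u = 0")
    case False
    \<comment> \<open>symmetry forces \<open>(\<theta> u - \<kappa> u) w = (\<theta> w - \<kappa> w) u\<close>, impossible for independent \<open>u, w\<close> unless both sides vanish\<close>
    have sym: "(\<theta> u - \<kappa> u) *\<^sub>R w = (\<theta> w - \<kappa> w) *\<^sub>R u" for w
      using diff[of u w] diff[of w u] sG[of u w] sH[of u w] by simp
    have "\<theta> u - \<kappa> u = 0"
    proof (rule ccontr)
      assume nz: "\<theta> u - \<kappa> u \<noteq> 0"
      \<comment> \<open>The test vector is u turned by a right angle; the two components combine to
        the scalar times the squared length of u.\<close>
      have "(\<theta> u - \<kappa> u) * - snd u = (\<theta> (- snd u, fst u) - \<kappa> (- snd u, fst u)) * fst u"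
        "(\<theta> u - \<kappa> u) * fst u = (\<theta> (- snd u, fst u) - \<kappa> (- snd u, fst u)) * snd u"
        using sym[of "(- snd u, fst u)"] by (simp_all add: prod_eq_iff)
      then have "(\<theta> u - \<kappa> u) * ((fst u)\<^sup>2 + (snd u)\<^sup>2) = 0" by algebra
      with nz False show False by (simp add: prod_eq_iff sum_power2_eq_zero_iff)
    qed
    then show ?thesis using diff by simp
  qed simp
  then show ?thesis by (metis blinfun_eqI)
qed

text \<open>By the product rule D(f \<omega>_i) = f D\<omega>_i + df \<omega>_i, so \<theta> becomes
  \<theta> + df/f, the same for both forms, and G is untouched.\<close>

lemma connection_at_scale:
  assumes G: "connection_at \<omega>\<^sub>0 \<omega>\<^sub>1 q G" and U: "open U" "q \<in> U"
    and eq: "\<And>p. p \<in> U \<Longrightarrow> \<eta>\<^sub>0 p = f p *\<^sub>R \<omega>\<^sub>0 p" "\<And>p. p \<in> U \<Longrightarrow> \<eta>\<^sub>1 p = f p *\<^sub>R \<omega>\<^sub>1 p"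
    and f: "f q \<noteq> 0" "f differentiable (at q)"
    and \<omega>: "\<omega>\<^sub>0 differentiable (at q)" "\<omega>\<^sub>1 differentiable (at q)"
  shows "connection_at \<eta>\<^sub>0 \<eta>\<^sub>1 q G"
proof -
  obtain \<theta> where sym: "\<And>u v. blinfun_apply (blinfun_apply G u) v = blinfun_apply (blinfun_apply G v) u" and \<theta>:
    "\<And>u v. blinfun_apply (\<omega>\<^sub>0 q) (blinfun_apply (blinfun_apply G u) v) =
          blinfun_apply (frechet_derivative \<omega>\<^sub>0 (at q) u) v - \<theta> u * blinfun_apply (\<omega>\<^sub>0 q) v"
    "\<And>u v. blinfun_apply (\<omega>\<^sub>1 q) (blinfun_apply (blinfun_apply G u) v) =
          blinfun_apply (frechet_derivative \<omega>\<^sub>1 (at q) u) v - \<theta> u * blinfun_apply (\<omega>\<^sub>1 q) v"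
    using G unfolding connection_at_def by blast
  have D: "frechet_derivative \<eta> (at q) u = f q *\<^sub>R frechet_derivative \<omega> (at q) u + frechet_derivative f (at q) u *\<^sub>R \<omega> q"
    if "\<And>p. p \<in> U \<Longrightarrow> \<eta> p = f p *\<^sub>R \<omega> p" "\<omega> differentiable (at q)" for \<eta> \<omega> :: "plane \<Rightarrow> plane \<Rightarrow>\<^sub>L real" and u
  proof -
    have "((\<lambda>p. f p *\<^sub>R \<omega> p) has_derivative
        (\<lambda>u. f q *\<^sub>R frechet_derivative \<omega> (at q) u + frechet_derivative f (at q) u *\<^sub>R \<omega> q)) (at q)"
      using f(2) that(2) unfolding frechet_derivative_works by (rule has_derivative_scaleR)
    then have "(\<eta> has_derivative
        (\<lambda>u. f q *\<^sub>R frechet_derivative \<omega> (at q) u + frechet_derivative f (at q) u *\<^sub>R \<omega> q)) (at q)"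
      using U by (rule has_derivative_transform_within_open) (simp add: that(1))
    from frechet_derivative_at[OF this, symmetric] show ?thesis by simp
  qed
  have D0: "frechet_derivative \<eta>\<^sub>0 (at q) u = f q *\<^sub>R frechet_derivative \<omega>\<^sub>0 (at q) u + frechet_derivative f (at q) u *\<^sub>R \<omega>\<^sub>0 q" for u
    using eq(1) \<omega>(1) by (rule D)
  have D1: "frechet_derivative \<eta>\<^sub>1 (at q) u = f q *\<^sub>R frechet_derivative \<omega>\<^sub>1 (at q) u + frechet_derivative f (at q) u *\<^sub>R \<omega>\<^sub>1 q" for u
    using eq(2) \<omega>(2) by (rule D)
  show ?thesis unfolding connection_at_def
  proof (intro conjI allI sym exI[of _ "\<lambda>u. \<theta> u + frechet_derivative f (at q) u / f q"])
    fix u v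
    show "blinfun_apply (\<eta>\<^sub>0 q) (blinfun_apply (blinfun_apply G u) v) =
          blinfun_apply (frechet_derivative \<eta>\<^sub>0 (at q) u) v -
          (\<theta> u + frechet_derivative f (at q) u / f q) * blinfun_apply (\<eta>\<^sub>0 q) v"
      using f(1) unfolding eq[OF U(2)] D0
      by (simp add: blinfun.bilinear_simps \<theta> field_simps)
    show "blinfun_apply (\<eta>\<^sub>1 q) (blinfun_apply (blinfun_apply G u) v) =
          blinfun_apply (frechet_derivative \<eta>\<^sub>1 (at q) u) v -
          (\<theta> u + frechet_derivative f (at q) u / f q) * blinfun_apply (\<eta>\<^sub>1 q) v"
      using f(1) unfolding eq[OF U(2)] D1
      by (simp add: blinfun.bilinear_simps \<theta> field_simps)
  qed
qed

text \<open>The factor from \<open>web_frame_scale\<close> comes pointwise and without regularity.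
  Evaluating on one constant vector v with nonzero value of \<omega>_0 near q exhibits it as a
  smooth quotient, so that the product rule applies; W is the part of the overlap where the
  denominator does not vanish.\<close>

lemma connection_at_frame_independent:
  assumes fr: "web_frame F U \<omega>\<^sub>0 \<omega>\<^sub>1" "web_frame F U' \<eta>\<^sub>0 \<eta>\<^sub>1" and q: "q \<in> U" "q \<in> U'"
    and G: "connection_at \<omega>\<^sub>0 \<omega>\<^sub>1 q G"
  shows "connection_at \<eta>\<^sub>0 \<eta>\<^sub>1 q G"
proof -
  note fr' = fr[unfolded web_frame_def]
  have "form_det (\<omega>\<^sub>0 q) (\<omega>\<^sub>1 q) \<noteq> 0" using fr' q by blast
  then obtain v where v: "blinfun_apply (\<omega>\<^sub>0 q) v = 1" by (rule form_det_solve)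
  define f where "f p = blinfun_apply (\<eta>\<^sub>0 p) v / blinfun_apply (\<omega>\<^sub>0 p) v" for p
  define W where "W = U \<inter> U' \<inter> (U \<inter> (\<lambda>p. blinfun_apply (\<omega>\<^sub>0 p) v) -` (- {0}))"
  have "smooth_on U (\<lambda>p. blinfun_apply (\<omega>\<^sub>0 p) v)"
    using fr' by (intro smooth_on_blinfun_apply smooth_on_const) auto
  then have "continuous_on U (\<lambda>p. blinfun_apply (\<omega>\<^sub>0 p) v)" by (rule smooth_on_imp_continuous_on)
  then have "open (U \<inter> (\<lambda>p. blinfun_apply (\<omega>\<^sub>0 p) v) -` (- {0}))"
    using fr' by (intro continuous_open_preimage) auto
  then have W: "open W" "q \<in> W"
    using fr' q v unfolding W_def by (auto intro: open_Int)
  have eq: "\<eta>\<^sub>0 p = f p *\<^sub>R \<omega>\<^sub>0 p \<and> \<eta>\<^sub>1 p = f p *\<^sub>R \<omega>\<^sub>1 p" if "p \<in> W" for p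
  proof -
    have "p \<in> U" "p \<in> U'" "blinfun_apply (\<omega>\<^sub>0 p) v \<noteq> 0" using that by (auto simp: W_def)
    with web_frame_scale[OF fr, of p] show ?thesis
      unfolding f_def by (auto simp: blinfun.bilinear_simps)
  qed
  have "f q \<noteq> 0"
  proof
    assume "f q = 0"
    with eq[OF W(2)] have "form_det (\<eta>\<^sub>0 q) (\<eta>\<^sub>1 q) = 0" by (simp add: form_det_def)
    with fr' q show False by blast
  qed
  moreover have "smooth_on W \<omega>\<^sub>0" "smooth_on W \<eta>\<^sub>0"
    using fr' smooth_on_subset[of U \<omega>\<^sub>0 W] smooth_on_subset[of U' \<eta>\<^sub>0 W] by (auto simp: W_def)
  then have "smooth_on W f"
    unfolding f_def using W(1) by (intro smooth_intros) (auto simp: W_def)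
  then have "f differentiable (at q)" using W(2) by (rule smooth_on_differentiable)
  moreover have "\<omega>\<^sub>0 differentiable (at q)" "\<omega>\<^sub>1 differentiable (at q)"
    using fr' q smooth_on_differentiable by metis+
  ultimately show ?thesis
    using connection_at_scale[OF G W, of \<eta>\<^sub>0 f \<eta>\<^sub>1] eq by blast
qed

lemma connection_at_exists:
  assumes fr: "web_frame F U \<omega>\<^sub>0 \<omega>\<^sub>1"
  obtains \<Gamma> where "smooth_on U \<Gamma>" "\<And>q. q \<in> U \<Longrightarrow> connection_at \<omega>\<^sub>0 \<omega>\<^sub>1 q (\<Gamma> q)"
proof -
  note fr' = fr[unfolded web_frame_def]
  have U: "open U" and sm: "smooth_on U \<omega>\<^sub>0" "smooth_on U \<omega>\<^sub>1" using fr' by auto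
  define a b c d where "a q = blinfun_apply (\<omega>\<^sub>0 q) (1, 0)" and "b q = blinfun_apply (\<omega>\<^sub>0 q) (0, 1)"
    and "c q = blinfun_apply (\<omega>\<^sub>1 q) (1, 0)" and "d q = blinfun_apply (\<omega>\<^sub>1 q) (0, 1)" for q
  define D where "D q = a q * d q - b q * c q" for q
  define P Q where "P q u = blinfun_apply (frechet_derivative \<omega>\<^sub>0 (at q) u)"
    and "Q q u = blinfun_apply (frechet_derivative \<omega>\<^sub>1 (at q) u)" for q u
  \<comment> \<open>The values of d\<omega>_0 and d\<omega>_1 on the standard basis.\<close>
  define k0 k1 where "k0 q = P q (1, 0) (0, 1) - P q (0, 1) (1, 0)"
    and "k1 q = Q q (1, 0) (0, 1) - Q q (0, 1) (1, 0)" for q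
  \<comment> \<open>The components of \<theta>, by Cramer's rule from d\<omega>_i = \<theta> \<and>
    \<omega>_i, that is from \<open>k0 = \<theta>1 b - \<theta>2 a\<close> and
    \<open>k1 = \<theta>1 d - \<theta>2 c\<close>. These equations are what symmetry of \<Gamma>
    amounts to, see \<open>torsion\<close>.\<close>
  define \<theta>1 \<theta>2 where "\<theta>1 q = (a q * k1 q - c q * k0 q) / D q" and "\<theta>2 q = (b q * k1 q - d q * k0 q) / D q" for q
  \<comment> \<open>The vectors dual to \<omega>_0, \<omega>_1. In terms of them \<open>g\<close> is
    the value that the two defining equations prescribe for \<Gamma>(u, v) when \<theta>(u) =
    t.\<close>
  define e0 e1 :: "plane \<Rightarrow> plane" where "e0 q = (d q / D q, - (c q / D q))" and "e1 q = (- (b q / D q), a q / D q)" for q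
  define g where "g q u v t = P q u v *\<^sub>R e0 q + Q q u v *\<^sub>R e1 q - (t :: real) *\<^sub>R v" for q and u v :: plane and t
  define \<Gamma> where "\<Gamma> q = pair_blinfun (pair_blinfun (g q (1, 0) (1, 0) (\<theta>1 q)) (g q (1, 0) (0, 1) (\<theta>1 q)))
      (pair_blinfun (g q (0, 1) (1, 0) (\<theta>2 q)) (g q (0, 1) (0, 1) (\<theta>2 q)))" for q
  have D: "D q \<noteq> 0" if "q \<in> U" for q using fr' that by (simp add: form_det_def D_def a_def b_def c_def d_def)
  have sm_abcd: "smooth_on U a" "smooth_on U b" "smooth_on U c" "smooth_on U d"
    unfolding a_def b_def c_def d_def by (intro smooth_on_blinfun_apply smooth_on_const U sm)+
  then have smD: "smooth_on U D" unfolding D_def by (intro smooth_intros U)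
  have smPQ: "smooth_on U (\<lambda>q. P q u v)" "smooth_on U (\<lambda>q. Q q u v)" for u v
    unfolding P_def Q_def by (intro smooth_on_blinfun_apply smooth_on_const smooth_on_frechet_derivative U sm)+
  have smk: "smooth_on U k0" "smooth_on U k1" unfolding k0_def k1_def by (intro smooth_on_diff smPQ U)+
  have sm\<theta>: "smooth_on U \<theta>1" "smooth_on U \<theta>2" unfolding \<theta>1_def \<theta>2_def
    by (intro smooth_on_divide smooth_on_diff smooth_on_mult sm_abcd smk smD U D; assumption)+
  have sme: "smooth_on U e0" "smooth_on U e1" unfolding e0_def e1_def
    by (intro smooth_on_Pair smooth_on_minus smooth_on_divide sm_abcd smD U D; assumption)+
  have smg: "smooth_on U (\<lambda>q. g q u v (t q))" if "smooth_on U t" for u v t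
    unfolding g_def by (intro smooth_on_diff smooth_on_add smooth_on_scaleR smPQ sme that smooth_on_const U)
  have "smooth_on U \<Gamma>" unfolding \<Gamma>_def by (intro smooth_on_pair_blinfun smg sm\<theta> U)
  moreover have "connection_at \<omega>\<^sub>0 \<omega>\<^sub>1 q (\<Gamma> q)" if q: "q \<in> U" for q
  proof -
    have torsion: "g q (1, 0) (0, 1) (\<theta>1 q) = g q (0, 1) (1, 0) (\<theta>2 q)"
      using D[OF q] by (simp add: g_def prod_eq_iff \<theta>1_def \<theta>2_def e0_def e1_def k0_def k1_def field_simps)
    have \<omega>: "blinfun_apply (\<omega>\<^sub>0 q) v = fst v * a q + snd v * b q" "blinfun_apply (\<omega>\<^sub>1 q) v = fst v * c q + snd v * d q" for v
      by (subst form_apply, simp add: a_def b_def c_def d_def)+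
    have dual: "blinfun_apply (\<omega>\<^sub>0 q) (e0 q) = 1" "blinfun_apply (\<omega>\<^sub>0 q) (e1 q) = 0"
      "blinfun_apply (\<omega>\<^sub>1 q) (e0 q) = 0" "blinfun_apply (\<omega>\<^sub>1 q) (e1 q) = 1"
      using D[OF q] unfolding \<omega> by (simp_all add: e0_def e1_def field_simps, simp_all add: D_def)
    have \<omega>g: "blinfun_apply (\<omega>\<^sub>0 q) (g q u v t) = P q u v - t * blinfun_apply (\<omega>\<^sub>0 q) v"
      "blinfun_apply (\<omega>\<^sub>1 q) (g q u v t) = Q q u v - t * blinfun_apply (\<omega>\<^sub>1 q) v" for u v t
      unfolding g_def by (simp_all add: blinfun.bilinear_simps dual)
    have lin: "linear (frechet_derivative \<omega>\<^sub>0 (at q))" "linear (frechet_derivative \<omega>\<^sub>1 (at q))"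
      using smooth_on_bounded_linear[OF sm(1) q] smooth_on_bounded_linear[OF sm(2) q] by (simp_all add: bounded_linear.linear)
    have PQ: "P q u v = fst u * fst v * P q (1, 0) (1, 0) + fst u * snd v * P q (1, 0) (0, 1) +
        snd u * fst v * P q (0, 1) (1, 0) + snd u * snd v * P q (0, 1) (0, 1)"
      "Q q u v = fst u * fst v * Q q (1, 0) (1, 0) + fst u * snd v * Q q (1, 0) (0, 1) +
        snd u * fst v * Q q (0, 1) (1, 0) + snd u * snd v * Q q (0, 1) (0, 1)" for u v
      unfolding P_def Q_def
      by (subst linear_plane[OF lin(1), of u] linear_plane[OF lin(2), of u], subst form_apply[of _ v],
          simp add: blinfun.bilinear_simps algebra_simps)+
    show ?thesis unfolding connection_at_def
    proof (intro conjI allI exI[of _ "\<lambda>u. fst u * \<theta>1 q + snd u * \<theta>2 q"])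
      fix u v
      show "blinfun_apply (blinfun_apply (\<Gamma> q) u) v = blinfun_apply (blinfun_apply (\<Gamma> q) v) u"
        by (simp add: \<Gamma>_def blinfun.bilinear_simps torsion algebra_simps)
      show "blinfun_apply (\<omega>\<^sub>0 q) (blinfun_apply (blinfun_apply (\<Gamma> q) u) v) =
          blinfun_apply (frechet_derivative \<omega>\<^sub>0 (at q) u) v - (fst u * \<theta>1 q + snd u * \<theta>2 q) * blinfun_apply (\<omega>\<^sub>0 q) v"
        unfolding P_def[symmetric] PQ(1)[of u v] \<Gamma>_def pair_blinfun_apply
          blinfun.add_left blinfun.scaleR_left blinfun.add_right blinfun.scaleR_right \<omega>g
        unfolding \<omega> by (simp add: algebra_simps)
      show "blinfun_apply (\<omega>\<^sub>1 q) (blinfun_apply (blinfun_apply (\<Gamma> q) u) v) =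
          blinfun_apply (frechet_derivative \<omega>\<^sub>1 (at q) u) v - (fst u * \<theta>1 q + snd u * \<theta>2 q) * blinfun_apply (\<omega>\<^sub>1 q) v"
        unfolding Q_def[symmetric] PQ(2)[of u v] \<Gamma>_def pair_blinfun_apply
          blinfun.add_left blinfun.scaleR_left blinfun.add_right blinfun.scaleR_right \<omega>g
        unfolding \<omega> by (simp add: algebra_simps)
    qed
  qed
  ultimately show thesis by (rule that)
qed

text \<open>No frame is canonical, so the value at q is described through any frame around q.
  Uniqueness and frame independence make the description definite, and no gluing of local
  connections is required.\<close>

definition web_connection :: "(plane set \<Rightarrow> plane set set) \<Rightarrow> christoffel" where
  "web_connection F q = (THE G. \<exists>U \<omega>\<^sub>0 \<omega>\<^sub>1. web_frame F U \<omega>\<^sub>0 \<omega>\<^sub>1 \<and> q \<in> U \<and> connection_at \<omega>\<^sub>0 \<omega>\<^sub>1 q G)"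

lemma web_connection_eqI:
  assumes "web_frame F U \<omega>\<^sub>0 \<omega>\<^sub>1" "q \<in> U" "connection_at \<omega>\<^sub>0 \<omega>\<^sub>1 q G"
  shows "web_connection F q = G"
  unfolding web_connection_def
proof (rule the_equality)
  show "\<exists>U \<omega>\<^sub>0 \<omega>\<^sub>1. web_frame F U \<omega>\<^sub>0 \<omega>\<^sub>1 \<and> q \<in> U \<and> connection_at \<omega>\<^sub>0 \<omega>\<^sub>1 q G"
    using assms by blast
next
  fix H assume "\<exists>U \<omega>\<^sub>0 \<omega>\<^sub>1. web_frame F U \<omega>\<^sub>0 \<omega>\<^sub>1 \<and> q \<in> U \<and> connection_at \<omega>\<^sub>0 \<omega>\<^sub>1 q H"
  then have "connection_at \<omega>\<^sub>0 \<omega>\<^sub>1 q H" using connection_at_frame_independent assms(1,2) by blast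
  moreover have "form_det (\<omega>\<^sub>0 q) (\<omega>\<^sub>1 q) \<noteq> 0" using assms(1,2) by (simp add: web_frame_def)
  ultimately show "H = G" using connection_at_unique assms(3) by blast
qed

lemma connection_at_web_connection:
  assumes "web_frame F U \<omega>\<^sub>0 \<omega>\<^sub>1" "q \<in> U"
  shows "connection_at \<omega>\<^sub>0 \<omega>\<^sub>1 q (web_connection F q)"
  using connection_at_exists[OF assms(1)] web_connection_eqI[OF assms] assms(2) by metis

lemma linear_connection_web_connection:
  assumes "veronese_web F"
  shows "linear_connection (web_connection F)"
  unfolding linear_connection_def
proof (rule smooth_on_local)
  fix p
  obtain U \<omega>\<^sub>0 \<omega>\<^sub>1 where U: "p \<in> U" "web_frame F U \<omega>\<^sub>0 \<omega>\<^sub>1" using assms by (rule veronese_web_frame)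
  obtain \<Gamma> where \<Gamma>: "smooth_on U \<Gamma>" "\<And>q. q \<in> U \<Longrightarrow> connection_at \<omega>\<^sub>0 \<omega>\<^sub>1 q (\<Gamma> q)"
    using U(2) by (rule connection_at_exists) blast
  have "open U" using U(2) by (simp add: web_frame_def)
  then have "smooth_on U (web_connection F)"
    using \<Gamma>(1) by (rule smooth_on_cong) (use web_connection_eqI[OF U(2)] \<Gamma>(2) in metis)
  with U \<open>open U\<close> show "\<exists>T. open T \<and> p \<in> T \<and> smooth_on T (web_connection F)" by blast
qed


section \<open>Geodesics of the web connection\<close>

definition acceleration :: "christoffel \<Rightarrow> (real \<Rightarrow> plane) \<Rightarrow> real \<Rightarrow> plane" where
  "acceleration \<Gamma> \<gamma> \<tau> = vector_derivative (velocity \<gamma>) (at \<tau>) +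
     blinfun_apply (blinfun_apply (\<Gamma> (\<gamma> \<tau>)) (velocity \<gamma> \<tau>)) (velocity \<gamma> \<tau>)"

lemma geodesic_iff:
  "geodesic \<Gamma> I \<gamma> \<longleftrightarrow> open_interval I \<and> smooth_on I \<gamma> \<and>
     (\<forall>\<tau>\<in>I. velocity \<gamma> \<tau> \<noteq> 0 \<and> acceleration \<Gamma> \<gamma> \<tau> = 0)"
  by (simp add: geodesic_def acceleration_def)

lemma open_intervalD:
  assumes "open_interval I"
  shows "open I" "connected I" "I \<noteq> {}"
  using assms by (auto simp: open_interval_def is_interval_connected_1)

lemma open_intervalI: "open I \<Longrightarrow> connected I \<Longrightarrow> I \<noteq> {} \<Longrightarrow> open_interval I"
  by (simp add: open_interval_def is_interval_connected_1)

lemma vector_derivative_cong_open: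
  fixes f g :: "real \<Rightarrow> 'b::real_normed_vector"
  assumes "open S" "x \<in> S" "\<And>y. y \<in> S \<Longrightarrow> f y = g y"
  shows "vector_derivative f (at x) = vector_derivative g (at x)"
proof -
  have "(f has_vector_derivative v) (at x) \<longleftrightarrow> (g has_vector_derivative v) (at x)" for v
  proof
    show "(g has_vector_derivative v) (at x)" if "(f has_vector_derivative v) (at x)"
      using that assms by (rule has_vector_derivative_transform_within_open)
    show "(f has_vector_derivative v) (at x)" if "(g has_vector_derivative v) (at x)"
      using that assms(1,2) by (rule has_vector_derivative_transform_within_open) (simp add: assms(3))
  qed
  then show ?thesis by (simp add: vector_derivative_def)
qed

lemma acceleration_cong:
  assumes "open I" "\<tau> \<in> I" "\<And>\<sigma>. \<sigma> \<in> I \<Longrightarrow> \<gamma> \<sigma> = \<eta> \<sigma>"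
  shows "acceleration \<Gamma> \<gamma> \<tau> = acceleration \<Gamma> \<eta> \<tau>"
proof -
  have v: "velocity \<gamma> \<sigma> = velocity \<eta> \<sigma>" if "\<sigma> \<in> I" for \<sigma>
    using assms(1) that assms(3) by (rule vector_derivative_cong_open)
  have "vector_derivative (velocity \<gamma>) (at \<tau>) = vector_derivative (velocity \<eta>) (at \<tau>)"
    using assms(1,2) v by (rule vector_derivative_cong_open)
  with v[OF assms(2)] assms(3)[OF assms(2)] show ?thesis by (simp add: acceleration_def)
qed

lemma geodesic_local:
  assumes "open_interval I"
    and loc: "\<And>\<tau>. \<tau> \<in> I \<Longrightarrow> \<exists>J \<eta>. geodesic \<Gamma> J \<eta> \<and> \<tau> \<in> J \<and> (\<forall>\<sigma>\<in>J. \<gamma> \<sigma> = \<eta> \<sigma>)"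
  shows "geodesic \<Gamma> I \<gamma>"
  unfolding geodesic_iff
proof (intro conjI ballI assms(1) smooth_on_local)
  fix \<tau> assume "\<tau> \<in> I"
  then obtain J \<eta> where J: "geodesic \<Gamma> J \<eta>" "\<tau> \<in> J" and eq: "\<And>\<sigma>. \<sigma> \<in> J \<Longrightarrow> \<gamma> \<sigma> = \<eta> \<sigma>"
    using loc by blast
  have op: "open J" and sm: "smooth_on J \<eta>" using J(1) by (auto simp: geodesic_iff open_interval_def)
  have "smooth_on J \<gamma>" using op sm by (rule smooth_on_cong) (simp add: eq)
  then show "\<exists>T. open T \<and> \<tau> \<in> T \<and> smooth_on T \<gamma>" using op J(2) by blast
  have "velocity \<gamma> \<tau> = velocity \<eta> \<tau>" using op J(2) eq by (rule vector_derivative_cong_open)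
  then show "velocity \<gamma> \<tau> \<noteq> 0" using J by (simp add: geodesic_iff)
  have "acceleration \<Gamma> \<gamma> \<tau> = acceleration \<Gamma> \<eta> \<tau>" using op J(2) eq by (rule acceleration_cong)
  then show "acceleration \<Gamma> \<gamma> \<tau> = 0" using J by (simp add: geodesic_iff)
qed

section \<open>Reparametrised curves and affine parameters\<close>

lemma velocity_compose:
  fixes \<sigma> :: "real \<Rightarrow> plane" and x :: "real \<Rightarrow> real"
  assumes "open I" "smooth_on S \<sigma>" "smooth_on I x" "x ` I \<subseteq> S"
    and eq: "\<And>\<tau>. \<tau> \<in> I \<Longrightarrow> \<gamma> \<tau> = \<sigma> (x \<tau>)" and \<tau>: "\<tau> \<in> I"
  shows "velocity \<gamma> \<tau> = vector_derivative x (at \<tau>) *\<^sub>R velocity \<sigma> (x \<tau>)"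
proof -
  have "((\<lambda>\<tau>. \<sigma> (x \<tau>)) has_vector_derivative vector_derivative x (at \<tau>) *\<^sub>R velocity \<sigma> (x \<tau>)) (at \<tau>)"
    using vector_diff_chain_at[OF smooth_on_has_vector_derivative[OF assms(3) \<tau>]
        smooth_on_has_vector_derivative[OF assms(2), of "x \<tau>"]] assms(4) \<tau>
    by (auto simp: o_def)
  then have "(\<gamma> has_vector_derivative vector_derivative x (at \<tau>) *\<^sub>R velocity \<sigma> (x \<tau>)) (at \<tau>)"
    using assms(1) \<tau> by (rule has_vector_derivative_transform_within_open) (simp add: eq)
  then show ?thesis by (rule vector_derivative_at)
qed

text \<open>The Christoffel term is quadratic in the velocity, so it scales by x'^2 just as the
  second derivative of \<sigma> does, and the x'' term is tangential. The formula serves both to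
  find an affine parameter and to show that a change of parameter between geodesics is
  affine.\<close>

lemma acceleration_compose:
  fixes \<sigma> :: "real \<Rightarrow> plane" and x :: "real \<Rightarrow> real"
  assumes "open I" "open S" "smooth_on S \<sigma>" "smooth_on I x" "x ` I \<subseteq> S"
    and eq: "\<And>\<tau>. \<tau> \<in> I \<Longrightarrow> \<gamma> \<tau> = \<sigma> (x \<tau>)" and \<tau>: "\<tau> \<in> I"
  shows "acceleration \<Gamma> \<gamma> \<tau> = vector_derivative (\<lambda>\<tau>. vector_derivative x (at \<tau>)) (at \<tau>) *\<^sub>R velocity \<sigma> (x \<tau>) +
    (vector_derivative x (at \<tau>))\<^sup>2 *\<^sub>R acceleration \<Gamma> \<sigma> (x \<tau>)"
proof -
  let ?x' = "\<lambda>\<tau>. vector_derivative x (at \<tau>)"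
  have x\<tau>: "x \<tau> \<in> S" using assms(5) \<tau> by blast
  have v: "velocity \<gamma> \<tau> = ?x' \<tau> *\<^sub>R velocity \<sigma> (x \<tau>)" if "\<tau> \<in> I" for \<tau>
    using assms(1,3,4,5) eq that by (rule velocity_compose)
  have "((\<lambda>\<tau>. velocity \<sigma> (x \<tau>)) has_vector_derivative ?x' \<tau> *\<^sub>R vector_derivative (velocity \<sigma>) (at (x \<tau>))) (at \<tau>)"
    using vector_diff_chain_at[OF smooth_on_has_vector_derivative[OF assms(4) \<tau>]
        smooth_on_has_vector_derivative[OF smooth_on_vector_derivative[OF assms(2,3)] x\<tau>]]
    by (simp add: o_def)
  moreover have "(?x' has_vector_derivative vector_derivative ?x' (at \<tau>)) (at \<tau>)"
    using smooth_on_has_vector_derivative[OF smooth_on_vector_derivative[OF assms(1,4)] \<tau>] .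
  ultimately have "((\<lambda>\<tau>. ?x' \<tau> *\<^sub>R velocity \<sigma> (x \<tau>)) has_vector_derivative
      ?x' \<tau> *\<^sub>R (?x' \<tau> *\<^sub>R vector_derivative (velocity \<sigma>) (at (x \<tau>))) + vector_derivative ?x' (at \<tau>) *\<^sub>R velocity \<sigma> (x \<tau>)) (at \<tau>)"
    by (intro has_vector_derivative_scaleR) (auto simp: has_real_derivative_iff_has_vector_derivative)
  then have "(velocity \<gamma> has_vector_derivative
      ?x' \<tau> *\<^sub>R (?x' \<tau> *\<^sub>R vector_derivative (velocity \<sigma>) (at (x \<tau>))) + vector_derivative ?x' (at \<tau>) *\<^sub>R velocity \<sigma> (x \<tau>)) (at \<tau>)"
    using assms(1) \<tau> by (rule has_vector_derivative_transform_within_open) (simp add: v)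
  then have "vector_derivative (velocity \<gamma>) (at \<tau>) =
      ?x' \<tau> *\<^sub>R (?x' \<tau> *\<^sub>R vector_derivative (velocity \<sigma>) (at (x \<tau>))) + vector_derivative ?x' (at \<tau>) *\<^sub>R velocity \<sigma> (x \<tau>)"
    by (rule vector_derivative_at)
  then show ?thesis
    by (simp add: acceleration_def v[OF \<tau>] eq[OF \<tau>] blinfun.scaleR_left blinfun.scaleR_right
        scaleR_add_right power2_eq_square)
qed

lemma smooth_on_acceleration:
  assumes "linear_connection \<Gamma>" "open I" "smooth_on I \<sigma>"
  shows "smooth_on I (acceleration \<Gamma> \<sigma>)"
proof -
  have v: "smooth_on I (velocity \<sigma>)" using assms(2,3) by (rule smooth_on_vector_derivative)
  have "smooth_on I (\<lambda>\<tau>. \<Gamma> (\<sigma> \<tau>))"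
    using assms by (intro smooth_on_compose[where f = \<Gamma> and T = UNIV and g = \<sigma>]) (auto simp: linear_connection_def)
  then have "smooth_on I (\<lambda>\<tau>. vector_derivative (velocity \<sigma>) (at \<tau>) +
     blinfun_apply (blinfun_apply (\<Gamma> (\<sigma> \<tau>)) (velocity \<sigma> \<tau>)) (velocity \<sigma> \<tau>))"
    by (intro smooth_on_add smooth_on_blinfun_apply smooth_on_vector_derivative v assms(2))
  then show ?thesis by (simp add: acceleration_def[abs_def])
qed

text \<open>
  If \<open>\<nabla>\<^bsub>\<sigma>'\<^esub> \<sigma>' = \<mu> \<sigma>'\<close>, then \<open>T = \<integral> exp (\<integral> \<mu>)\<close> is an affine parameter of \<open>\<sigma>\<close>.
\<close>

lemma pregeodesic_reparametrisation:
  assumes \<Gamma>: "linear_connection \<Gamma>" and I: "open_interval I" and \<sigma>: "smooth_on I \<sigma>"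
    and nz: "\<And>x. x \<in> I \<Longrightarrow> velocity \<sigma> x \<noteq> 0"
    and par: "\<And>x. x \<in> I \<Longrightarrow> \<exists>k. acceleration \<Gamma> \<sigma> x = k *\<^sub>R velocity \<sigma> x"
  obtains \<rho> T where "geodesic \<Gamma> (T ` I) \<rho>" "smooth_on I T" "\<And>x. x \<in> I \<Longrightarrow> \<rho> (T x) = \<sigma> x"
proof -
  have Io: "open I" using I by (rule open_intervalD)
  \<comment> \<open>The coefficient is known only pointwise; the inner product turns it into a
    quotient of smooth functions.\<close>
  define \<mu> where "\<mu> x = (acceleration \<Gamma> \<sigma> x \<bullet> velocity \<sigma> x) / (velocity \<sigma> x \<bullet> velocity \<sigma> x)" for x
  have acc: "acceleration \<Gamma> \<sigma> x = \<mu> x *\<^sub>R velocity \<sigma> x" if "x \<in> I" for x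
    using par[OF that] nz[OF that] by (auto simp: \<mu>_def)
  have "smooth_on I \<mu>"
    unfolding \<mu>_def
    using nz by (intro smooth_on_divide smooth_on_inner smooth_on_acceleration smooth_on_vector_derivative \<Gamma> Io \<sigma>) simp
  then obtain F where F: "smooth_on I F" "\<And>x. x \<in> I \<Longrightarrow> (F has_vector_derivative \<mu> x) (at x)"
    using open_interval_antiderivative[OF I] by blast
  have E: "smooth_on I (\<lambda>x. exp (F x))" using Io F(1) by (rule smooth_on_exp)
  obtain T where T: "smooth_on I T" "\<And>x. x \<in> I \<Longrightarrow> (T has_vector_derivative exp (F x)) (at x)"
    using open_interval_antiderivative[OF I E] by blast
  obtain g where J: "open_interval (T ` I)" and g: "smooth_on (T ` I) g" "\<And>x. x \<in> I \<Longrightarrow> g (T x) = x"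
    "\<And>x. x \<in> I \<Longrightarrow> (g has_vector_derivative inverse (exp (F x))) (at (T x))"
    using open_interval_inverse[OF I T E] by (metis exp_gt_zero)
  have Jo: "open (T ` I)" using J by (rule open_intervalD)
  have gI: "g ` (T ` I) \<subseteq> I" using g(2) by auto
  have g': "vector_derivative g (at y) = exp (- F (g y))" if "y \<in> T ` I" for y
    using that g(2) vector_derivative_at[OF g(3)] by (auto simp: exp_minus)
  \<comment> \<open>Since T' = exp F with F' = \<mu>, the inverse satisfies g' = exp(-F) at g and so
    g'' = -\<mu> g'^2. This is the term that cancels the tangential acceleration in
    \<open>acceleration_compose\<close>.\<close>
  have g'': "vector_derivative (\<lambda>y. vector_derivative g (at y)) (at y) = - \<mu> (g y) * (exp (- F (g y)))\<^sup>2"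
    if y: "y \<in> T ` I" for y
  proof -
    have gy: "g y \<in> I" using gI y by blast
    have "(g has_vector_derivative exp (- F (g y))) (at y)"
      using smooth_on_has_vector_derivative[OF g(1) y] g'[OF y] by simp
    from vector_diff_chain_at[OF this F(2)[OF gy]]
    have "((\<lambda>y. F (g y)) has_real_derivative exp (- F (g y)) * \<mu> (g y)) (at y)"
      by (simp add: o_def has_real_derivative_iff_has_vector_derivative)
    then have "((\<lambda>y. exp (- F (g y))) has_real_derivative - \<mu> (g y) * (exp (- F (g y)))\<^sup>2) (at y)"
      by (auto intro!: derivative_eq_intros simp: power2_eq_square)
    then have "((\<lambda>y. exp (- F (g y))) has_vector_derivative - \<mu> (g y) * (exp (- F (g y)))\<^sup>2) (at y)"
      by (simp add: has_real_derivative_iff_has_vector_derivative)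
    then have "((\<lambda>y. vector_derivative g (at y)) has_vector_derivative - \<mu> (g y) * (exp (- F (g y)))\<^sup>2) (at y)"
      using Jo y by (rule has_vector_derivative_transform_within_open) (simp add: g')
    then show ?thesis by (rule vector_derivative_at)
  qed
  define \<rho> where "\<rho> y = \<sigma> (g y)" for y
  have "geodesic \<Gamma> (T ` I) \<rho>"
    unfolding geodesic_iff
  proof (intro conjI ballI J)
    show "smooth_on (T ` I) \<rho>"
      unfolding \<rho>_def using smooth_on_compose[OF Jo Io gI \<sigma> g(1)] .
    fix y assume y: "y \<in> T ` I"
    have gy: "g y \<in> I" using gI y by blast
    have "velocity \<rho> y = exp (- F (g y)) *\<^sub>R velocity \<sigma> (g y)"
      using velocity_compose[OF Jo \<sigma> g(1) gI _ y, of \<rho>] g'[OF y] by (simp add: \<rho>_def)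
    then show "velocity \<rho> y \<noteq> 0" using nz[OF gy] by simp
    show "acceleration \<Gamma> \<rho> y = 0"
      using acceleration_compose[OF Jo Io \<sigma> g(1) gI _ y, of \<rho> \<Gamma>] acc[OF gy]
      by (simp add: \<rho>_def g'[OF y] g''[OF y] mult.commute)
  qed
  with T(1) g(2) show thesis by (intro that[of T \<rho>]) (auto simp: \<rho>_def)
qed

text \<open>Lets the starting time and the speed of a geodesic, including its sense, be adjusted
  without changing the image.\<close>

lemma geodesic_affine:
  assumes \<gamma>: "geodesic \<Gamma> I \<gamma>" and k: "k \<noteq> 0"
  shows "geodesic \<Gamma> {s. c + k * s \<in> I} (\<lambda>s. \<gamma> (c + k * s))"
    and "c + k * s \<in> I \<Longrightarrow> velocity (\<lambda>s. \<gamma> (c + k * s)) s = k *\<^sub>R velocity \<gamma> (c + k * s)"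
    and "(\<lambda>s. \<gamma> (c + k * s)) ` {s. c + k * s \<in> I} = \<gamma> ` I"
proof -
  let ?J = "{s. c + k * s \<in> I}"
  have I: "open_interval I" and sm: "smooth_on I \<gamma>" using \<gamma> by (auto simp: geodesic_iff)
  note I' = open_intervalD[OF I]
  have solve: "c + k * ((x - c) / k) = x" for x using k by simp
  have J_eq: "?J = (\<lambda>x. (x - c) / k) ` I"
  proof (intro set_eqI iffI)
    fix s assume "s \<in> ?J"
    then show "s \<in> (\<lambda>x. (x - c) / k) ` I" using k by (intro image_eqI[of _ _ "c + k * s"]) auto
  qed (use solve in auto)
  have "open ((\<lambda>s. c + k * s) -` I)" using I'(1) by (intro open_vimage continuous_intros) auto
  then have Jo: "open ?J" by (simp add: vimage_def)
  moreover have "connected ?J" unfolding J_eq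
    by (intro connected_continuous_image I'(2) continuous_intros) (use k in auto)
  moreover have "?J \<noteq> {}" using I'(3) J_eq by auto
  ultimately have J: "open_interval ?J" by (rule open_intervalI)
  have smx: "smooth_on ?J (\<lambda>s. c + k * s)" by (intro smooth_intros Jo)
  have sub: "(\<lambda>s. c + k * s) ` ?J \<subseteq> I" by auto
  have "((\<lambda>s. c + k * s) has_vector_derivative k) (at s)" for s
    unfolding has_real_derivative_iff_has_vector_derivative[symmetric] by (auto intro!: derivative_eq_intros)
  then have x': "vector_derivative (\<lambda>s. c + k * s) (at s) = k" for s by (rule vector_derivative_at)
  have v: "velocity (\<lambda>s. \<gamma> (c + k * s)) s = k *\<^sub>R velocity \<gamma> (c + k * s)" if "s \<in> ?J" for s
    using velocity_compose[OF Jo sm smx sub refl that] by (simp add: x')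
  then show "velocity (\<lambda>s. \<gamma> (c + k * s)) s = k *\<^sub>R velocity \<gamma> (c + k * s)" if "c + k * s \<in> I" for s
    using that by simp
  show "geodesic \<Gamma> ?J (\<lambda>s. \<gamma> (c + k * s))"
    unfolding geodesic_iff
  proof (intro conjI ballI J)
    show "smooth_on ?J (\<lambda>s. \<gamma> (c + k * s))" using smooth_on_compose[OF Jo I'(1) sub sm smx] .
    fix s assume s: "s \<in> ?J"
    then have "velocity \<gamma> (c + k * s) \<noteq> 0" "acceleration \<Gamma> \<gamma> (c + k * s) = 0" using \<gamma> by (auto simp: geodesic_iff)
    then show "velocity (\<lambda>s. \<gamma> (c + k * s)) s \<noteq> 0" "acceleration \<Gamma> (\<lambda>s. \<gamma> (c + k * s)) s = 0"
      using v[OF s] k acceleration_compose[OF Jo I'(1) sm smx sub refl s, of \<Gamma>] by (simp_all add: x')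
  qed
  show "(\<lambda>s. \<gamma> (c + k * s)) ` ?J = \<gamma> ` I"
  proof (intro subset_antisym image_subsetI)
    fix x assume "x \<in> I"
    then show "\<gamma> x \<in> (\<lambda>s. \<gamma> (c + k * s)) ` ?J"
      using solve[of x] by (intro image_eqI[of _ _ "(x - c) / k"]) auto
  qed auto
qed

text \<open>The derivative of \<omega>_i(\<gamma>') is \<omega>_i of the acceleration plus the
  covariant derivative of \<omega>_i along \<gamma>', evaluated on \<gamma>'. The latter is
  \<theta>(\<gamma>') \<omega>_i(\<gamma>'), with one factor for both forms.\<close>

lemma frame_derivative_along_curve:
  assumes fr: "web_frame F U \<omega>\<^sub>0 \<omega>\<^sub>1" and I: "open I" "\<tau> \<in> I" and \<gamma>: "smooth_on I \<gamma>" "\<gamma> \<tau> \<in> U"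
  obtains \<theta> :: real where
    "((\<lambda>\<tau>. blinfun_apply (\<omega>\<^sub>0 (\<gamma> \<tau>)) (velocity \<gamma> \<tau>)) has_real_derivative
       blinfun_apply (\<omega>\<^sub>0 (\<gamma> \<tau>)) (acceleration (web_connection F) \<gamma> \<tau>) +
       \<theta> * blinfun_apply (\<omega>\<^sub>0 (\<gamma> \<tau>)) (velocity \<gamma> \<tau>)) (at \<tau>)"
    "((\<lambda>\<tau>. blinfun_apply (\<omega>\<^sub>1 (\<gamma> \<tau>)) (velocity \<gamma> \<tau>)) has_real_derivative
       blinfun_apply (\<omega>\<^sub>1 (\<gamma> \<tau>)) (acceleration (web_connection F) \<gamma> \<tau>) +
       \<theta> * blinfun_apply (\<omega>\<^sub>1 (\<gamma> \<tau>)) (velocity \<gamma> \<tau>)) (at \<tau>)"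
proof -
  obtain \<theta> :: "plane \<Rightarrow> real" where \<theta>:
    "\<And>u v. blinfun_apply (\<omega>\<^sub>0 (\<gamma> \<tau>)) (blinfun_apply (blinfun_apply (web_connection F (\<gamma> \<tau>)) u) v) =
          blinfun_apply (frechet_derivative \<omega>\<^sub>0 (at (\<gamma> \<tau>)) u) v - \<theta> u * blinfun_apply (\<omega>\<^sub>0 (\<gamma> \<tau>)) v"
    "\<And>u v. blinfun_apply (\<omega>\<^sub>1 (\<gamma> \<tau>)) (blinfun_apply (blinfun_apply (web_connection F (\<gamma> \<tau>)) u) v) =
          blinfun_apply (frechet_derivative \<omega>\<^sub>1 (at (\<gamma> \<tau>)) u) v - \<theta> u * blinfun_apply (\<omega>\<^sub>1 (\<gamma> \<tau>)) v"
    using connection_at_web_connection[OF fr \<gamma>(2)] unfolding connection_at_def by blast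
  have D: "((\<lambda>\<tau>. blinfun_apply (\<omega> (\<gamma> \<tau>)) (velocity \<gamma> \<tau>)) has_real_derivative
       blinfun_apply (\<omega> (\<gamma> \<tau>)) (vector_derivative (velocity \<gamma>) (at \<tau>)) +
       blinfun_apply (frechet_derivative \<omega> (at (\<gamma> \<tau>)) (velocity \<gamma> \<tau>)) (velocity \<gamma> \<tau>)) (at \<tau>)"
    if "smooth_on U \<omega>" for \<omega> :: "plane \<Rightarrow> plane \<Rightarrow>\<^sub>L real"
  proof -
    have "(\<gamma> has_derivative (\<lambda>h. h *\<^sub>R velocity \<gamma> \<tau>)) (at \<tau>)"
      using smooth_on_has_vector_derivative[OF \<gamma>(1) I(2)] by (simp add: has_vector_derivative_def)
    then have "((\<lambda>\<tau>. \<omega> (\<gamma> \<tau>)) has_derivative (\<lambda>h. frechet_derivative \<omega> (at (\<gamma> \<tau>)) (h *\<^sub>R velocity \<gamma> \<tau>))) (at \<tau>)"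
      using smooth_on_has_derivative[OF that \<gamma>(2)] by (rule has_derivative_compose)
    moreover have "(velocity \<gamma> has_derivative (\<lambda>h. h *\<^sub>R vector_derivative (velocity \<gamma>) (at \<tau>))) (at \<tau>)"
      using smooth_on_has_vector_derivative[OF smooth_on_vector_derivative[OF I(1) \<gamma>(1)] I(2)]
      by (simp add: has_vector_derivative_def)
    ultimately have "((\<lambda>\<tau>. blinfun_apply (\<omega> (\<gamma> \<tau>)) (velocity \<gamma> \<tau>)) has_derivative
        (\<lambda>h. blinfun_apply (\<omega> (\<gamma> \<tau>)) (h *\<^sub>R vector_derivative (velocity \<gamma>) (at \<tau>)) +
          blinfun_apply (frechet_derivative \<omega> (at (\<gamma> \<tau>)) (h *\<^sub>R velocity \<gamma> \<tau>)) (velocity \<gamma> \<tau>))) (at \<tau>)"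
      by (rule bounded_bilinear.FDERIV[OF bounded_bilinear_blinfun_apply])
    then show ?thesis
      unfolding has_field_derivative_def
      by (rule has_derivative_eq_rhs)
        (simp add: fun_eq_iff blinfun.bilinear_simps algebra_simps
          linear_scale[OF bounded_linear.linear[OF smooth_on_bounded_linear[OF that \<gamma>(2)]]])
  qed
  have sm: "smooth_on U \<omega>\<^sub>0" "smooth_on U \<omega>\<^sub>1" using fr by (auto simp: web_frame_def)
  show thesis
  proof (rule that[of "\<theta> (velocity \<gamma> \<tau>)"])
    show "((\<lambda>\<tau>. blinfun_apply (\<omega>\<^sub>0 (\<gamma> \<tau>)) (velocity \<gamma> \<tau>)) has_real_derivative
       blinfun_apply (\<omega>\<^sub>0 (\<gamma> \<tau>)) (acceleration (web_connection F) \<gamma> \<tau>) +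
       \<theta> (velocity \<gamma> \<tau>) * blinfun_apply (\<omega>\<^sub>0 (\<gamma> \<tau>)) (velocity \<gamma> \<tau>)) (at \<tau>)"
      using D[OF sm(1)] by (simp add: acceleration_def blinfun.add_right \<theta>)
    show "((\<lambda>\<tau>. blinfun_apply (\<omega>\<^sub>1 (\<gamma> \<tau>)) (velocity \<gamma> \<tau>)) has_real_derivative
       blinfun_apply (\<omega>\<^sub>1 (\<gamma> \<tau>)) (acceleration (web_connection F) \<gamma> \<tau>) +
       \<theta> (velocity \<gamma> \<tau>) * blinfun_apply (\<omega>\<^sub>1 (\<gamma> \<tau>)) (velocity \<gamma> \<tau>)) (at \<tau>)"
      using D[OF sm(2)] by (simp add: acceleration_def blinfun.add_right \<theta>)
  qed
qed

section \<open>Curves with a constant web direction\<close>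

lemma web_direction_unique:
  assumes "veronese_web F" "v \<noteq> 0"
  shows "\<exists>!l. l \<in> RP1 \<and> v \<in> tangent_space (F l) q"
proof -
  obtain U \<omega>\<^sub>0 \<omega>\<^sub>1 where U: "q \<in> U" "web_frame F U \<omega>\<^sub>0 \<omega>\<^sub>1" using assms(1) by (rule veronese_web_frame)
  show ?thesis
    using web_frame_direction[OF U(2,1) assms(2)] web_frame_direction_in_RP1[OF U(2,1) assms(2)] by blast
qed

lemma geodesic_direction_local:
  assumes fr: "web_frame F U \<omega>\<^sub>0 \<omega>\<^sub>1" and \<gamma>: "geodesic (web_connection F) I \<gamma>" "\<gamma> ` I \<subseteq> U"
    and st: "\<sigma> \<in> I" "\<tau> \<in> I"
  shows "proj_point (blinfun_apply (\<omega>\<^sub>1 (\<gamma> \<tau>)) (velocity \<gamma> \<tau>)) (- blinfun_apply (\<omega>\<^sub>0 (\<gamma> \<tau>)) (velocity \<gamma> \<tau>)) =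
         proj_point (blinfun_apply (\<omega>\<^sub>1 (\<gamma> \<sigma>)) (velocity \<gamma> \<sigma>)) (- blinfun_apply (\<omega>\<^sub>0 (\<gamma> \<sigma>)) (velocity \<gamma> \<sigma>))"
proof -
  define h where "h \<tau> = blinfun_apply (\<omega>\<^sub>0 (\<gamma> \<tau>)) (velocity \<gamma> \<tau>)" for \<tau>
  define k where "k \<tau> = blinfun_apply (\<omega>\<^sub>1 (\<gamma> \<tau>)) (velocity \<gamma> \<tau>)" for \<tau>
  have I: "open I" "connected I" using \<gamma>(1) by (auto simp: geodesic_iff dest: open_intervalD)
  have hk_nz: "h \<tau> \<noteq> 0 \<or> k \<tau> \<noteq> 0" if "\<tau> \<in> I" for \<tau>
  proof -
    have "velocity \<gamma> \<tau> \<noteq> 0" using \<gamma>(1) that by (simp add: geodesic_iff)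
    moreover have "form_det (\<omega>\<^sub>0 (\<gamma> \<tau>)) (\<omega>\<^sub>1 (\<gamma> \<tau>)) \<noteq> 0" using fr \<gamma>(2) that unfolding web_frame_def by blast
    ultimately show ?thesis using form_det_eqI[of "\<omega>\<^sub>0 (\<gamma> \<tau>)" "\<omega>\<^sub>1 (\<gamma> \<tau>)" "velocity \<gamma> \<tau>" 0]
      by (auto simp: h_def k_def)
  qed
  have n: "(h \<tau>)\<^sup>2 + (k \<tau>)\<^sup>2 \<noteq> 0" if "\<tau> \<in> I" for \<tau>
    using hk_nz[OF that] by (simp add: sum_power2_eq_zero_iff)
  define a b where "a = h \<sigma>" and "b = k \<sigma>"
  \<comment> \<open>Either of h and k may vanish, so the ratio is replaced by the squared sine of
    the angle between \<open>(h, k)\<close> and its value \<open>(a, b)\<close> at \<sigma>, times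
    the constant \<open>a\<^sup>2 + b\<^sup>2\<close>. Its derivative is 0 because h and k solve the
    same linear equation, and it is 0 at \<sigma>.\<close>
  define z where "z \<tau> = (a * k \<tau> - b * h \<tau>)\<^sup>2 / ((h \<tau>)\<^sup>2 + (k \<tau>)\<^sup>2)" for \<tau>
  have "z \<tau> = z \<sigma>"
  proof (rule has_derivative_zero_unique_connected[OF I _ st(2,1)])
    fix \<tau> assume \<tau>: "\<tau> \<in> I"
    have acc: "acceleration (web_connection F) \<gamma> \<tau> = 0" and sm: "smooth_on I \<gamma>"
      using \<gamma>(1) \<tau> by (auto simp: geodesic_iff)
    have "\<gamma> \<tau> \<in> U" using \<gamma>(2) \<tau> by blast
    with fr I(1) \<tau> sm obtain \<theta> where
      "(h has_real_derivative \<theta> * h \<tau>) (at \<tau>)" "(k has_real_derivative \<theta> * k \<tau>) (at \<tau>)"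
      by (rule frame_derivative_along_curve) (simp add: acc h_def[abs_def] k_def[abs_def])
    then have "(z has_real_derivative 0) (at \<tau>)"
      unfolding z_def using n[OF \<tau>]
      by (auto intro!: derivative_eq_intros simp: power2_eq_square algebra_simps)
    then show "(z has_derivative (\<lambda>x. 0)) (at \<tau>)"
      by (simp add: has_field_derivative_def lambda_zero)
  qed
  also have "z \<sigma> = 0" by (simp add: z_def a_def b_def)
  finally have ab: "a * k \<tau> = b * h \<tau>" using n[OF st(2)] by (auto simp: z_def)
  define c where "c = (h \<tau> * a + k \<tau> * b) / (a\<^sup>2 + b\<^sup>2)"
  have n\<sigma>: "a\<^sup>2 + b\<^sup>2 \<noteq> 0" using n[OF st(1)] by (simp add: a_def b_def)
  have "h \<tau> * (a\<^sup>2 + b\<^sup>2) = (h \<tau> * a + k \<tau> * b) * a" "k \<tau> * (a\<^sup>2 + b\<^sup>2) = (h \<tau> * a + k \<tau> * b) * b"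
    using ab by algebra+
  then have c: "h \<tau> = c * a" "k \<tau> = c * b" using n\<sigma> by (simp_all add: c_def field_simps)
  then have "c \<noteq> 0" using hk_nz[OF st(2)] by auto
  then have "proj_point (c * b) (c * - a) = proj_point b (- a)"
    using n\<sigma> by (intro proj_point_eqI) auto
  then show ?thesis
    unfolding h_def[symmetric] k_def[symmetric] by (simp add: c a_def[symmetric] b_def[symmetric])
qed

text \<open>The curve may leave the domain of any one frame, but the point of \<open>RP1\<close>
  belonging to its velocity does not depend on a frame. Being constant on pieces that lie in a frame
  domain, it is locally constant, hence constant on I.\<close>

lemma geodesic_direction:
  assumes web: "veronese_web F" and \<gamma>: "geodesic (web_connection F) I \<gamma>"
  obtains l where "l \<in> RP1" "\<And>\<tau>. \<tau> \<in> I \<Longrightarrow> velocity \<gamma> \<tau> \<in> tangent_space (F l) (\<gamma> \<tau>)"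
proof -
  have I: "open_interval I" "smooth_on I \<gamma>" and nz: "\<And>\<tau>. \<tau> \<in> I \<Longrightarrow> velocity \<gamma> \<tau> \<noteq> 0"
    using \<gamma> by (auto simp: geodesic_iff)
  note Io = open_intervalD[OF I(1)]
  define dir where "dir \<tau> = (THE l. l \<in> RP1 \<and> velocity \<gamma> \<tau> \<in> tangent_space (F l) (\<gamma> \<tau>))" for \<tau>
  have dir: "dir \<tau> \<in> RP1" "velocity \<gamma> \<tau> \<in> tangent_space (F (dir \<tau>)) (\<gamma> \<tau>)" if "\<tau> \<in> I" for \<tau>
    using theI'[OF web_direction_unique[OF web nz[OF that], of "\<gamma> \<tau>"]] by (auto simp: dir_def)
  have const: "dir \<sigma> = dir \<tau>" if "\<sigma> \<in> I" "\<tau> \<in> I" for \<sigma> \<tau>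
  proof (rule connected_local_const[where f = dir, OF Io(2) that], intro ballI)
    fix \<tau> assume \<tau>: "\<tau> \<in> I"
    obtain U \<omega>\<^sub>0 \<omega>\<^sub>1 where U: "\<gamma> \<tau> \<in> U" "web_frame F U \<omega>\<^sub>0 \<omega>\<^sub>1" using web by (rule veronese_web_frame)
    have "open U" using U(2) by (simp add: web_frame_def)
    then obtain J where J: "open_interval J" "\<tau> \<in> J" "J \<subseteq> I" "\<gamma> ` J \<subseteq> U"
      using open_interval_neighbourhood[OF Io(1) \<tau> smooth_on_imp_continuous_on[OF I(2)] _ U(1)] by metis
    have \<gamma>J: "geodesic (web_connection F) J \<gamma>"
      using \<gamma> J(1,3) smooth_on_subset[OF I(2) J(3)] by (auto simp: geodesic_iff)
    have dir_eq: "dir \<sigma> = proj_point (blinfun_apply (\<omega>\<^sub>1 (\<gamma> \<sigma>)) (velocity \<gamma> \<sigma>)) (- blinfun_apply (\<omega>\<^sub>0 (\<gamma> \<sigma>)) (velocity \<gamma> \<sigma>))"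
      if "\<sigma> \<in> J" for \<sigma>
    proof -
      have "\<sigma> \<in> I" "\<gamma> \<sigma> \<in> U" using that J(3,4) by auto
      then show ?thesis
        using web_frame_direction[OF U(2) _ nz dir(1)] dir(2) by blast
    qed
    have "dir \<tau> = dir \<sigma>" if "\<sigma> \<in> J" for \<sigma>
      using geodesic_direction_local[OF U(2) \<gamma>J J(4) that J(2)] dir_eq that J(2) by simp
    moreover have "\<forall>\<^sub>F \<sigma> in at \<tau> within I. \<sigma> \<in> J"
      using J(1,2) by (auto simp: open_interval_def eventually_at_topological)
    ultimately show "\<forall>\<^sub>F \<sigma> in at \<tau> within I. dir \<tau> = dir \<sigma>"
      by (auto elim: eventually_mono)
  qed
  obtain \<tau>\<^sub>0 where \<tau>\<^sub>0: "\<tau>\<^sub>0 \<in> I" using Io(3) by blast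
  show thesis
  proof (rule that[of "dir \<tau>\<^sub>0"])
    show "dir \<tau>\<^sub>0 \<in> RP1" using \<tau>\<^sub>0 by (rule dir)
    show "velocity \<gamma> \<tau> \<in> tangent_space (F (dir \<tau>\<^sub>0)) (\<gamma> \<tau>)" if "\<tau> \<in> I" for \<tau>
      using dir(2)[OF that] const[OF that \<tau>\<^sub>0] by simp
  qed
qed

text \<open>Along the curve s h + t k = 0, where h and k are the values of the forms on the
  velocity. Differentiating this, the \<theta>-terms cancel and the acceleration falls into the
  kernel of s \<omega>_0 + t \<omega>_1, the line spanned by the velocity.\<close>

lemma leafwise_curve_pregeodesic:
  assumes web: "veronese_web F" and l: "l \<in> RP1" and I: "open I" "\<tau> \<in> I" and \<sigma>: "smooth_on I \<sigma>"
    and nz: "velocity \<sigma> \<tau> \<noteq> 0"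
    and tan: "\<And>\<tau>. \<tau> \<in> I \<Longrightarrow> velocity \<sigma> \<tau> \<in> tangent_space (F l) (\<sigma> \<tau>)"
  shows "\<exists>k. acceleration (web_connection F) \<sigma> \<tau> = k *\<^sub>R velocity \<sigma> \<tau>"
proof -
  obtain U \<omega>\<^sub>0 \<omega>\<^sub>1 where U: "\<sigma> \<tau> \<in> U" and fr: "web_frame F U \<omega>\<^sub>0 \<omega>\<^sub>1" using web by (rule veronese_web_frame)
  have "open U" using fr by (simp add: web_frame_def)
  then obtain J where J: "open_interval J" "\<tau> \<in> J" "J \<subseteq> I" "\<sigma> ` J \<subseteq> U"
    using open_interval_neighbourhood[OF I smooth_on_imp_continuous_on[OF \<sigma>] _ U] by metis
  obtain s t where st: "l = proj_point s t" "(s, t) \<noteq> (0, 0)" using l unfolding RP1_eq by blast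
  define h where "h \<tau> = blinfun_apply (\<omega>\<^sub>0 (\<sigma> \<tau>)) (velocity \<sigma> \<tau>)" for \<tau>
  define k where "k \<tau> = blinfun_apply (\<omega>\<^sub>1 (\<sigma> \<tau>)) (velocity \<sigma> \<tau>)" for \<tau>
  have zero: "s * h x + t * k x = 0" if "x \<in> J" for x
  proof -
    have "x \<in> I" "\<sigma> x \<in> U" using that J by auto
    then show ?thesis using tan[of x] fr st unfolding web_frame_def h_def k_def by blast
  qed
  let ?a = "acceleration (web_connection F) \<sigma> \<tau>"
  obtain \<theta> where \<theta>: "(h has_real_derivative blinfun_apply (\<omega>\<^sub>0 (\<sigma> \<tau>)) ?a + \<theta> * h \<tau>) (at \<tau>)"
    "(k has_real_derivative blinfun_apply (\<omega>\<^sub>1 (\<sigma> \<tau>)) ?a + \<theta> * k \<tau>) (at \<tau>)"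
    using fr I \<sigma> U by (rule frame_derivative_along_curve) (simp add: h_def[abs_def] k_def[abs_def])
  have "((\<lambda>x. s * h x + t * k x) has_real_derivative
      s * (blinfun_apply (\<omega>\<^sub>0 (\<sigma> \<tau>)) ?a + \<theta> * h \<tau>) + t * (blinfun_apply (\<omega>\<^sub>1 (\<sigma> \<tau>)) ?a + \<theta> * k \<tau>)) (at \<tau>)"
    using DERIV_add[OF DERIV_cmult[OF \<theta>(1), of s] DERIV_cmult[OF \<theta>(2), of t]] .
  moreover have "((\<lambda>x. s * h x + t * k x) has_real_derivative 0) (at \<tau>)"
  proof (rule has_field_derivative_transform_within_open[OF DERIV_const[of 0]])
    show "open J" using J(1) by (rule open_intervalD)
  qed (use J(2) zero in auto)
  ultimately have "s * (blinfun_apply (\<omega>\<^sub>0 (\<sigma> \<tau>)) ?a + \<theta> * h \<tau>) + t * (blinfun_apply (\<omega>\<^sub>1 (\<sigma> \<tau>)) ?a + \<theta> * k \<tau>) = 0"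
    by (rule DERIV_unique)
  then have acc: "s * blinfun_apply (\<omega>\<^sub>0 (\<sigma> \<tau>)) ?a + t * blinfun_apply (\<omega>\<^sub>1 (\<sigma> \<tau>)) ?a = 0"
    using zero[OF J(2)] by algebra
  have "form_det (\<omega>\<^sub>0 (\<sigma> \<tau>)) (\<omega>\<^sub>1 (\<sigma> \<tau>)) \<noteq> 0" using fr U by (simp add: web_frame_def)
  \<comment> \<open>On this vector the combined form takes the value
    \<open>s\<^sup>2 + t\<^sup>2\<close>, so it is nonzero and its kernel is a line.\<close>
  then obtain v where "blinfun_apply (\<omega>\<^sub>0 (\<sigma> \<tau>)) v = s" "blinfun_apply (\<omega>\<^sub>1 (\<sigma> \<tau>)) v = t"
    using form_det_solve by metis
  then have "blinfun_apply (s *\<^sub>R \<omega>\<^sub>0 (\<sigma> \<tau>) + t *\<^sub>R \<omega>\<^sub>1 (\<sigma> \<tau>)) v \<noteq> 0"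
    using st(2) by (simp add: blinfun.bilinear_simps sum_squares_eq_zero_iff)
  then have "s *\<^sub>R \<omega>\<^sub>0 (\<sigma> \<tau>) + t *\<^sub>R \<omega>\<^sub>1 (\<sigma> \<tau>) \<noteq> 0" by force
  then show ?thesis
    by (rule form_kernel_parallel)
      (use zero[OF J(2)] acc nz in \<open>simp_all add: blinfun.bilinear_simps h_def k_def\<close>)
qed

section \<open>Geodesics along plaques\<close>

lemma smooth_on_coordinate_curve:
  assumes co: "coordinates_on U \<phi>" and I: "open I" and z: "smooth_on I z" "z ` I \<subseteq> \<phi> ` U"
  shows "smooth_on I (\<lambda>x. inv_into U \<phi> (z x))"
    and "x \<in> I \<Longrightarrow> velocity (\<lambda>x. inv_into U \<phi> (z x)) x =
           frechet_derivative (inv_into U \<phi>) (at (z x)) (velocity z x)"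
proof -
  note c = coordinates_onD[OF co]
  show "smooth_on I (\<lambda>x. inv_into U \<phi> (z x))"
    using smooth_on_compose[OF I c(2) z(2) c(5) z(1)] .
  assume x: "x \<in> I"
  have zx: "z x \<in> \<phi> ` U" using x z(2) by blast
  have "(z has_derivative (\<lambda>h. h *\<^sub>R velocity z x)) (at x)"
    using smooth_on_has_vector_derivative[OF z(1) x] by (simp add: has_vector_derivative_def)
  then have "((\<lambda>x. inv_into U \<phi> (z x)) has_derivative
      (\<lambda>h. frechet_derivative (inv_into U \<phi>) (at (z x)) (h *\<^sub>R velocity z x))) (at x)"
    using smooth_on_has_derivative[OF c(5) zx] by (rule has_derivative_compose)
  then have "((\<lambda>x. inv_into U \<phi> (z x)) has_vector_derivative
      frechet_derivative (inv_into U \<phi>) (at (z x)) (velocity z x)) (at x)"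
    unfolding has_vector_derivative_def
    by (simp add: linear_scale[OF bounded_linear.linear[OF smooth_on_bounded_linear[OF c(5) zx]]])
  then show "velocity (\<lambda>x. inv_into U \<phi> (z x)) x = frechet_derivative (inv_into U \<phi>) (at (z x)) (velocity z x)"
    by (rule vector_derivative_at)
qed

lemma mem_box_plane:
  "(x :: plane) \<in> box a b \<longleftrightarrow> fst a < fst x \<and> fst x < fst b \<and> snd a < snd x \<and> snd x < snd b"
  by (auto simp: mem_box Basis_prod_def inner_prod_def)

text \<open>The horizontal coordinate line through p is tangent to the foliation, hence a
  pregeodesic, and its affine reparametrisation fills the plaque. The function \<alpha> tells the
  time at which a point of the plaque is reached. It is defined on all of U through the first
  coordinate alone, so that composing it with a smooth curve in U is again smooth.\<close>

lemma plaque_geodesic: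
  assumes web: "veronese_web F" and l: "l \<in> RP1" and box: "flow_box (F l) U \<phi> a b"
    and p: "p \<in> U" and v: "v \<noteq> 0" "v \<in> tangent_space (F l) p"
  obtains J \<eta> \<alpha> where "geodesic (web_connection F) J \<eta>" "0 \<in> J" "\<eta> 0 = p" "velocity \<eta> 0 = v"
    "\<eta> ` J = {q\<in>U. snd (\<phi> q) = snd (\<phi> p)}" "smooth_on U \<alpha>" "\<alpha> p = 0"
    "\<And>q. q \<in> U \<Longrightarrow> snd (\<phi> q) = snd (\<phi> p) \<Longrightarrow> \<alpha> q \<in> J \<and> \<eta> (\<alpha> q) = q"
proof -
  have fol: "foliation (F l)" using web l by (rule veronese_web_foliation)
  have co: "coordinates_on U \<phi>" and \<phi>U: "\<phi> ` U = box a b" using box by (auto simp: flow_box_def)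
  note c = coordinates_onD[OF co]
  define I where "I = {fst a<..<fst b}"
  define z :: "real \<Rightarrow> plane" where "z x = (x, snd (\<phi> p))" for x
  have z_in: "z x \<in> \<phi> ` U \<longleftrightarrow> x \<in> I" for x
  proof -
    have "\<phi> p \<in> box a b" using p \<phi>U by blast
    then show ?thesis unfolding \<phi>U I_def z_def by (simp add: mem_box_plane)
  qed
  have fst_I: "fst (\<phi> q) \<in> I" if "q \<in> U" for q
  proof -
    have "\<phi> q \<in> box a b" using that \<phi>U by blast
    then show ?thesis unfolding I_def by (simp add: mem_box_plane)
  qed
  have z_fst: "z (fst (\<phi> q)) = \<phi> q" if "snd (\<phi> q) = snd (\<phi> p)" for q
    using that by (simp add: z_def prod_eq_iff)
  have Io: "open I" by (simp add: I_def)
  have I: "open_interval I" using fst_I[OF p] by (intro open_intervalI) (auto simp: I_def)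
  have smz: "smooth_on I z" unfolding z_def by (intro smooth_intros Io)
  have "(z has_vector_derivative (1, 0)) (at x)" for x
    unfolding z_def has_vector_derivative_def by (auto intro!: derivative_eq_intros)
  then have z': "velocity z x = (1, 0)" for x by (rule vector_derivative_at)
  have zI: "z ` I \<subseteq> \<phi> ` U" using z_in by auto
  define \<sigma> where "\<sigma> x = inv_into U \<phi> (z x)" for x
  have sm: "smooth_on I \<sigma>" unfolding \<sigma>_def using smooth_on_coordinate_curve(1)[OF co Io smz zI] .
  have \<sigma>_U: "\<sigma> x \<in> U" "\<phi> (\<sigma> x) = z x" if "x \<in> I" for x
    using that z_in by (auto simp: \<sigma>_def inv_into_into f_inv_into_f)
  have \<sigma>_fst: "\<sigma> (fst (\<phi> q)) = q" if "q \<in> U" "snd (\<phi> q) = snd (\<phi> p)" for q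
    using that c(3) by (simp add: \<sigma>_def z_fst)
  have \<sigma>': "velocity \<sigma> x = frechet_derivative (inv_into U \<phi>) (at (\<phi> (\<sigma> x))) (1, 0)" if "x \<in> I" for x
    using smooth_on_coordinate_curve(2)[OF co Io smz zI that] \<sigma>_U[OF that] by (simp add: \<sigma>_def[abs_def] z')
  have \<phi>\<sigma>': "frechet_derivative \<phi> (at (\<sigma> x)) (velocity \<sigma> x) = (1, 0)" if "x \<in> I" for x
    using coordinates_on_derivative_inverse(2)[OF co \<sigma>_U(1)[OF that]] \<sigma>'[OF that] by simp
  have nz: "velocity \<sigma> x \<noteq> 0" if "x \<in> I" for x
    using \<phi>\<sigma>'[OF that] linear_0[OF bounded_linear.linear[OF smooth_on_bounded_linear[OF c(4) \<sigma>_U(1)[OF that]]]]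
    by (auto simp: zero_prod_def)
  have tan: "velocity \<sigma> x \<in> tangent_space (F l) (\<sigma> x)" if "x \<in> I" for x
    using tangent_space_flow_box[OF fol box \<sigma>_U(1)[OF that]] \<phi>\<sigma>'[OF that] by simp
  have par: "\<exists>k. acceleration (web_connection F) \<sigma> x = k *\<^sub>R velocity \<sigma> x" if "x \<in> I" for x
    using leafwise_curve_pregeodesic[OF web l Io that sm nz[OF that] tan] .
  obtain \<rho> T where \<rho>: "geodesic (web_connection F) (T ` I) \<rho>" and T: "smooth_on I T"
    and \<rho>T: "\<And>x. x \<in> I \<Longrightarrow> \<rho> (T x) = \<sigma> x"
    by (rule pregeodesic_reparametrisation[OF linear_connection_web_connection[OF web] I sm nz par]) (assumption | rule that)+
  define x\<^sub>0 where "x\<^sub>0 = fst (\<phi> p)"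
  have x\<^sub>0: "x\<^sub>0 \<in> I" "\<sigma> x\<^sub>0 = p" using fst_I[OF p] \<sigma>_fst[OF p] by (auto simp: x\<^sub>0_def)
  have v_eq: "v = fst (frechet_derivative \<phi> (at p) v) *\<^sub>R velocity \<sigma> x\<^sub>0"
  proof -
    have "frechet_derivative \<phi> (at p) v = fst (frechet_derivative \<phi> (at p) v) *\<^sub>R (1, 0)"
      using v(2) tangent_space_flow_box[OF fol box p] by (simp add: prod_eq_iff)
    then have "v = frechet_derivative (inv_into U \<phi>) (at (\<phi> p)) (fst (frechet_derivative \<phi> (at p) v) *\<^sub>R (1, 0))"
      using coordinates_on_derivative_inverse(1)[OF co p, of v] by metis
    also have "\<dots> = fst (frechet_derivative \<phi> (at p) v) *\<^sub>R velocity \<sigma> x\<^sub>0"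
      using \<sigma>'[OF x\<^sub>0(1)] x\<^sub>0(2) p
      by (simp only: linear_scale[OF bounded_linear.linear[OF smooth_on_bounded_linear[OF c(5), of "\<phi> p"]]] image_eqI)
    finally show ?thesis .
  qed
  have "velocity \<sigma> x\<^sub>0 = vector_derivative T (at x\<^sub>0) *\<^sub>R velocity \<rho> (T x\<^sub>0)"
    using \<rho> by (intro velocity_compose[OF Io _ T subset_refl _ x\<^sub>0(1)]) (auto simp: geodesic_iff \<rho>T)
  \<comment> \<open>Both v and the velocity of \<rho> point along the coordinate line, so a change
    of speed by the factor k produces the prescribed initial velocity.\<close>
  with v_eq obtain k where k: "v = k *\<^sub>R velocity \<rho> (T x\<^sub>0)" by (metis scaleR_scaleR)
  have k0: "k \<noteq> 0" using k v(1) by auto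
  define J where "J = {s. T x\<^sub>0 + k * s \<in> T ` I}"
  define \<eta> where "\<eta> s = \<rho> (T x\<^sub>0 + k * s)" for s
  define \<alpha> where "\<alpha> q = (T (fst (\<phi> q)) - T x\<^sub>0) / k" for q
  note aff = geodesic_affine[OF \<rho> k0, of "T x\<^sub>0", folded J_def \<eta>_def]
  have \<rho>I: "\<rho> ` T ` I = \<sigma> ` I" using \<rho>T by (force simp: image_image)
  have \<alpha>: "\<alpha> q \<in> J \<and> \<eta> (\<alpha> q) = q" if "q \<in> U" "snd (\<phi> q) = snd (\<phi> p)" for q
  proof -
    have "T x\<^sub>0 + k * \<alpha> q = T (fst (\<phi> q))" using k0 by (simp add: \<alpha>_def)
    then show ?thesis using fst_I[OF that(1)] \<rho>T \<sigma>_fst[OF that] by (simp add: J_def \<eta>_def)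
  qed
  show thesis
  proof (rule that[of J \<eta> \<alpha>])
    show "geodesic (web_connection F) J \<eta>" by (rule aff(1))
    show "0 \<in> J" using x\<^sub>0 by (simp add: J_def)
    show "\<eta> 0 = p" using x\<^sub>0 \<rho>T by (simp add: \<eta>_def)
    show "velocity \<eta> 0 = v" using aff(2)[of 0] x\<^sub>0 k by simp
    show "\<eta> ` J = {q\<in>U. snd (\<phi> q) = snd (\<phi> p)}"
    proof -
      have "\<sigma> ` I = {q\<in>U. snd (\<phi> q) = snd (\<phi> p)}"
      proof (intro set_eqI iffI)
        fix q assume "q \<in> {q\<in>U. snd (\<phi> q) = snd (\<phi> p)}"
        then show "q \<in> \<sigma> ` I" using \<sigma>_fst[of q] fst_I[of q] by force
      qed (use \<sigma>_U in \<open>auto simp: z_def\<close>)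
      then show ?thesis using aff(3) \<rho>I by simp
    qed
    have "smooth_on U (\<lambda>q. T (fst (\<phi> q)))"
      by (rule smooth_on_compose[OF c(1) Io _ T smooth_on_fst[OF c(1,4)]]) (use fst_I in auto)
    then show "smooth_on U \<alpha>" unfolding \<alpha>_def
      by (intro smooth_on_divide smooth_on_diff smooth_on_const c(1)) (use k0 in auto)
    show "\<alpha> p = 0" by (simp add: \<alpha>_def x\<^sub>0_def)
  qed (use \<alpha> in auto)
qed

text \<open>Uniqueness without differential equations: \<gamma> keeps to the plaque filled by
  \<eta>, so \<gamma> = \<eta> composed with y, where y = \<alpha> composed with \<gamma>. As both
  accelerations vanish and the velocity of \<eta> does not, y'' = 0; the initial data give y = 0 and
  y' = 1 at \<open>\<tau>\<^sub>0\<close>, so y is a shift.\<close>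

lemma geodesic_in_plaque:
  assumes web: "veronese_web F" and l: "l \<in> RP1" and box: "flow_box (F l) U \<phi> a b"
    and \<gamma>: "geodesic (web_connection F) K \<gamma>" "\<gamma> ` K \<subseteq> U" "\<tau>\<^sub>0 \<in> K"
    and tan: "\<And>\<tau>. \<tau> \<in> K \<Longrightarrow> velocity \<gamma> \<tau> \<in> tangent_space (F l) (\<gamma> \<tau>)"
    and \<eta>: "geodesic (web_connection F) J \<eta>" "0 \<in> J" "\<eta> 0 = \<gamma> \<tau>\<^sub>0" "velocity \<eta> 0 = velocity \<gamma> \<tau>\<^sub>0"
    and \<alpha>: "smooth_on U \<alpha>" "\<alpha> (\<gamma> \<tau>\<^sub>0) = 0"
      "\<And>q. q \<in> U \<Longrightarrow> snd (\<phi> q) = snd (\<phi> (\<gamma> \<tau>\<^sub>0)) \<Longrightarrow> \<alpha> q \<in> J \<and> \<eta> (\<alpha> q) = q"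
    and \<tau>: "\<tau> \<in> K"
  shows "\<gamma> \<tau> = \<eta> (\<tau> - \<tau>\<^sub>0)"
proof -
  have fol: "foliation (F l)" using web l by (rule veronese_web_foliation)
  have U: "open U" using box by (simp add: flow_box_def coordinates_on_def)
  have K: "open_interval K" "smooth_on K \<gamma>" using \<gamma>(1) by (auto simp: geodesic_iff)
  have J: "open_interval J" "smooth_on J \<eta>" using \<eta>(1) by (auto simp: geodesic_iff)
  note Ko = open_intervalD[OF K(1)] and Jo = open_intervalD[OF J(1)]
  define y where "y \<tau> = \<alpha> (\<gamma> \<tau>)" for \<tau>
  have y: "y \<tau> \<in> J" "\<gamma> \<tau> = \<eta> (y \<tau>)" if "\<tau> \<in> K" for \<tau>
  proof -
    have "snd (\<phi> (\<gamma> \<tau>)) = snd (\<phi> (\<gamma> \<tau>\<^sub>0))"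
      using tangent_curve_in_plaque[OF fol box Ko(1,2) \<gamma>(2) K(2) tan that \<gamma>(3)] .
    moreover have "\<gamma> \<tau> \<in> U" using that \<gamma>(2) by blast
    ultimately show "y \<tau> \<in> J" "\<gamma> \<tau> = \<eta> (y \<tau>)" using \<alpha>(3) by (simp_all add: y_def)
  qed
  have smy: "smooth_on K y" unfolding y_def using smooth_on_compose[OF Ko(1) U \<gamma>(2) \<alpha>(1) K(2)] .
  have yJ: "y ` K \<subseteq> J" using y by auto
  let ?y' = "\<lambda>\<tau>. vector_derivative y (at \<tau>)"
  have y'': "vector_derivative ?y' (at \<tau>) = 0" if "\<tau> \<in> K" for \<tau>
  proof -
    have "acceleration (web_connection F) \<gamma> \<tau> = 0" using \<gamma>(1) that by (simp add: geodesic_iff)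
    moreover have "acceleration (web_connection F) \<eta> (y \<tau>) = 0" "velocity \<eta> (y \<tau>) \<noteq> 0"
      using \<eta>(1) y(1)[OF that] by (auto simp: geodesic_iff)
    ultimately show ?thesis
      using acceleration_compose[OF Ko(1) Jo(1) J(2) smy yJ y(2) that, of "web_connection F"] by simp
  qed
  have "velocity \<gamma> \<tau>\<^sub>0 = ?y' \<tau>\<^sub>0 *\<^sub>R velocity \<gamma> \<tau>\<^sub>0"
    using velocity_compose[OF Ko(1) J(2) smy yJ y(2) \<gamma>(3)] \<alpha>(2) \<eta>(4) by (simp add: y_def[of \<tau>\<^sub>0])
  moreover have "velocity \<gamma> \<tau>\<^sub>0 \<noteq> 0" using \<gamma>(1,3) by (simp add: geodesic_iff)
  ultimately have y'0: "?y' \<tau>\<^sub>0 = 1" by (metis scaleR_cancel_right scaleR_one)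
  have y': "?y' \<tau> = 1" if "\<tau> \<in> K" for \<tau>
  proof -
    have "?y' \<tau> = ?y' \<tau>\<^sub>0"
    proof (rule has_derivative_zero_unique_connected[OF Ko(1,2) _ that \<gamma>(3)])
      fix x assume x: "x \<in> K"
      show "(?y' has_derivative (\<lambda>x. 0)) (at x)"
        using smooth_on_has_vector_derivative[OF smooth_on_vector_derivative[OF Ko(1) smy] x] y''[OF x]
        by (simp add: has_vector_derivative_def)
    qed
    with y'0 show ?thesis by simp
  qed
  have "y \<tau> - \<tau> = y \<tau>\<^sub>0 - \<tau>\<^sub>0"
  proof (rule has_derivative_zero_unique_connected[OF Ko(1,2) _ \<tau> \<gamma>(3), of "\<lambda>\<tau>. y \<tau> - \<tau>"])
    fix x assume x: "x \<in> K"
    have "(y has_derivative (\<lambda>h. h)) (at x)"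
      using smooth_on_has_vector_derivative[OF smy x] y'[OF x] by (simp add: has_vector_derivative_def)
    from has_derivative_diff[OF this has_derivative_ident]
    show "((\<lambda>\<tau>. y \<tau> - \<tau>) has_derivative (\<lambda>x. 0)) (at x)" by simp
  qed
  then have "y \<tau> = \<tau> - \<tau>\<^sub>0" using \<alpha>(2) by (simp add: y_def)
  with y(2)[OF \<tau>] show ?thesis by simp
qed

section \<open>Uniqueness of geodesics, maximal geodesics and leaves\<close>

lemma geodesic_subinterval:
  "geodesic \<Gamma> I \<gamma> \<Longrightarrow> open_interval J \<Longrightarrow> J \<subseteq> I \<Longrightarrow> geodesic \<Gamma> J \<gamma>"
  unfolding geodesic_iff using smooth_on_subset by blast

text \<open>Equal velocities have the same web direction, so both geodesics follow the same
  foliation. In a flow box of it each of them coincides with the plaque geodesic \<rho> started from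
  the common data.\<close>

lemma geodesic_unique_local:
  assumes web: "veronese_web F"
    and \<gamma>: "geodesic (web_connection F) I \<gamma>" and \<eta>: "geodesic (web_connection F) J \<eta>"
    and \<tau>: "\<tau> \<in> I" "\<tau> \<in> J" and eq: "\<gamma> \<tau> = \<eta> \<tau>" "velocity \<gamma> \<tau> = velocity \<eta> \<tau>"
  obtains K where "open_interval K" "\<tau> \<in> K" "K \<subseteq> I \<inter> J" "\<And>\<sigma>. \<sigma> \<in> K \<Longrightarrow> \<gamma> \<sigma> = \<eta> \<sigma>"
proof -
  obtain l where l: "l \<in> RP1" "\<And>\<tau>. \<tau> \<in> I \<Longrightarrow> velocity \<gamma> \<tau> \<in> tangent_space (F l) (\<gamma> \<tau>)"
    using web \<gamma> by (rule geodesic_direction) blast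
  obtain m where m: "m \<in> RP1" "\<And>\<tau>. \<tau> \<in> J \<Longrightarrow> velocity \<eta> \<tau> \<in> tangent_space (F m) (\<eta> \<tau>)"
    using web \<eta> by (rule geodesic_direction) blast
  have nz: "velocity \<gamma> \<tau> \<noteq> 0" using \<gamma> \<tau> by (simp add: geodesic_iff)
  have "l = m"
    using web_direction_unique[OF web nz, of "\<gamma> \<tau>"] l(1) l(2)[OF \<tau>(1)] m(1) m(2)[OF \<tau>(2)] eq by auto
  have fol: "foliation (F l)" using web l(1) by (rule veronese_web_foliation)
  obtain U \<phi> a b where U: "\<gamma> \<tau> \<in> U" and box: "flow_box (F l) U \<phi> a b" using fol by (rule foliation_flow_box)
  have "open U" using box by (simp add: flow_box_def coordinates_on_def)
  have I: "open I" "smooth_on I \<gamma>" and J: "open J" "smooth_on J \<eta>"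
    using \<gamma> \<eta> by (auto simp: geodesic_iff dest: open_intervalD)
  obtain K1 where K1: "open_interval K1" "\<tau> \<in> K1" "K1 \<subseteq> I" "\<gamma> ` K1 \<subseteq> U"
    using open_interval_neighbourhood[OF I(1) \<tau>(1) smooth_on_imp_continuous_on[OF I(2)] \<open>open U\<close> U] .
  obtain K where K: "open_interval K" "\<tau> \<in> K" "K \<subseteq> J \<inter> K1" "\<eta> ` K \<subseteq> U"
  proof (rule open_interval_neighbourhood[of "J \<inter> K1" \<tau> \<eta> U])
    show "open (J \<inter> K1)" using J(1) open_intervalD[OF K1(1)] by blast
    show "continuous_on (J \<inter> K1) \<eta>" using smooth_on_imp_continuous_on[OF J(2)] by (rule continuous_on_subset) blast
  qed (use \<tau> K1 U eq \<open>open U\<close> in auto)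
  obtain J' \<rho> \<alpha> where \<rho>: "geodesic (web_connection F) J' \<rho>" "0 \<in> J'" "\<rho> 0 = \<gamma> \<tau>" "velocity \<rho> 0 = velocity \<gamma> \<tau>"
    and "\<rho> ` J' = {q\<in>U. snd (\<phi> q) = snd (\<phi> (\<gamma> \<tau>))}"
    and \<alpha>: "smooth_on U \<alpha>" "\<alpha> (\<gamma> \<tau>) = 0"
      "\<And>q. q \<in> U \<Longrightarrow> snd (\<phi> q) = snd (\<phi> (\<gamma> \<tau>)) \<Longrightarrow> \<alpha> q \<in> J' \<and> \<rho> (\<alpha> q) = q"
    by (rule plaque_geodesic[OF web l(1) box U nz l(2)[OF \<tau>(1)]]) (assumption | rule that)+
  have "\<gamma> \<sigma> = \<rho> (\<sigma> - \<tau>)" if "\<sigma> \<in> K" for \<sigma>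
  proof (rule geodesic_in_plaque[OF web l(1) box _ _ K(2) _ \<rho> \<alpha> that])
    show "geodesic (web_connection F) K \<gamma>" using K(3) K1(3) by (intro geodesic_subinterval[OF \<gamma> K(1)]) blast
    show "\<gamma> ` K \<subseteq> U" using K(3) K1(4) by blast
    show "velocity \<gamma> \<tau> \<in> tangent_space (F l) (\<gamma> \<tau>)" if "\<tau> \<in> K" for \<tau> using that l(2) K(3) K1(3) by blast
  qed
  moreover have "\<eta> \<sigma> = \<rho> (\<sigma> - \<tau>)" if "\<sigma> \<in> K" for \<sigma>
  proof (rule geodesic_in_plaque[OF web l(1) box _ K(4) K(2) _ \<rho>(1,2) _ _ \<alpha>(1) _ _ that])
    show "geodesic (web_connection F) K \<eta>" using K(3) by (intro geodesic_subinterval[OF \<eta> K(1)]) blast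
    show "velocity \<eta> \<tau> \<in> tangent_space (F l) (\<eta> \<tau>)" if "\<tau> \<in> K" for \<tau> using that m(2) K(3) \<open>l = m\<close> by blast
  qed (use \<rho> \<alpha> eq in auto)
  ultimately show thesis using that[OF K(1,2)] K(3) K1(3) by auto
qed

text \<open>The times at which position and velocity agree form an open set by local uniqueness, and
  the remaining times do so by continuity. The common domain is an interval, hence
  connected.\<close>

lemma geodesic_unique:
  assumes web: "veronese_web F"
    and \<gamma>: "geodesic (web_connection F) I \<gamma>" and \<eta>: "geodesic (web_connection F) J \<eta>"
    and \<tau>\<^sub>0: "\<tau>\<^sub>0 \<in> I" "\<tau>\<^sub>0 \<in> J" and eq: "\<gamma> \<tau>\<^sub>0 = \<eta> \<tau>\<^sub>0" "velocity \<gamma> \<tau>\<^sub>0 = velocity \<eta> \<tau>\<^sub>0"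
    and \<tau>: "\<tau> \<in> I" "\<tau> \<in> J"
  shows "\<gamma> \<tau> = \<eta> \<tau>"
proof -
  have I: "open I" "is_interval I" "smooth_on I \<gamma>" and J: "open J" "is_interval J" "smooth_on J \<eta>"
    using \<gamma> \<eta> by (auto simp: geodesic_iff open_interval_def)
  have con: "connected (I \<inter> J)" using I J by (simp add: is_interval_Int is_interval_connected)
  have op: "open (I \<inter> J)" using I J by blast
  have sm: "smooth_on (I \<inter> J) \<gamma>" "smooth_on (I \<inter> J) \<eta>"
    using smooth_on_subset[OF I(3)] smooth_on_subset[OF J(3)] by auto
  define P where "P \<sigma> \<longleftrightarrow> \<gamma> \<sigma> = \<eta> \<sigma> \<and> velocity \<gamma> \<sigma> = velocity \<eta> \<sigma>" for \<sigma>
  have mem: "\<tau>\<^sub>0 \<in> I \<inter> J" "\<tau> \<in> I \<inter> J" using \<tau>\<^sub>0 \<tau> by auto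
  have "P \<tau>\<^sub>0 = P \<tau>"
  proof (rule connected_local_const[where f = P, OF con mem], intro ballI)
    fix \<sigma> assume \<sigma>: "\<sigma> \<in> I \<inter> J"
    have "\<exists>K. open K \<and> \<sigma> \<in> K \<and> (\<forall>x\<in>K. P \<sigma> = P x)"
    proof (cases "P \<sigma>")
      case True
      then have eqs: "\<sigma> \<in> I" "\<sigma> \<in> J" "\<gamma> \<sigma> = \<eta> \<sigma>" "velocity \<gamma> \<sigma> = velocity \<eta> \<sigma>"
        using \<sigma> by (auto simp: P_def)
      obtain K where K: "open_interval K" "\<sigma> \<in> K" "\<And>x. x \<in> K \<Longrightarrow> \<gamma> x = \<eta> x"
        by (rule geodesic_unique_local[OF web \<gamma> \<eta> eqs]) (assumption | rule that)+
      have "open K" using K(1) by (rule open_intervalD)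
      moreover from this have "velocity \<gamma> x = velocity \<eta> x" if "x \<in> K" for x
        using that K(3) by (rule vector_derivative_cong_open)
      ultimately show ?thesis using True K(2,3) by (auto simp: P_def)
    next
      case False
      let ?f = "\<lambda>x. (\<gamma> x - \<eta> x, velocity \<gamma> x - velocity \<eta> x)"
      have "continuous_on (I \<inter> J) ?f"
        by (intro continuous_on_Pair continuous_on_diff smooth_on_imp_continuous_on smooth_on_vector_derivative op sm)
      then have "open (I \<inter> J \<inter> ?f -` (- {0}))" by (rule continuous_open_preimage[OF _ op]) (rule open_Compl, simp)
      moreover have "P x \<longleftrightarrow> ?f x = 0" for x by (auto simp: P_def prod_eq_iff)
      ultimately show ?thesis using False \<sigma> by (intro exI[of _ "I \<inter> J \<inter> ?f -` (- {0})"]) auto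
    qed
    then show "\<forall>\<^sub>F x in at \<sigma> within I \<inter> J. P \<sigma> = P x"
      by (auto simp: eventually_at_topological)
  qed
  with eq show ?thesis by (simp add: P_def)
qed

text \<open>The union of all geodesics with the given position and velocity at time 0. By uniqueness
  they agree wherever two of them are defined, so it is immaterial which one the choice in \<gamma>
  selects at a given time.\<close>

lemma maximal_geodesic_exists:
  assumes web: "veronese_web F" and \<eta>\<^sub>0: "geodesic (web_connection F) J\<^sub>0 \<eta>\<^sub>0" "0 \<in> J\<^sub>0"
  obtains I \<gamma> where "maximal_geodesic (web_connection F) I \<gamma>" "0 \<in> I" "\<gamma> 0 = \<eta>\<^sub>0 0" "velocity \<gamma> 0 = velocity \<eta>\<^sub>0 0"
proof -
  let ?\<Gamma> = "web_connection F"
  define G where "G = {(J, \<eta>). geodesic ?\<Gamma> J \<eta> \<and> 0 \<in> J \<and> \<eta> 0 = \<eta>\<^sub>0 0 \<and> velocity \<eta> 0 = velocity \<eta>\<^sub>0 0}"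
  define I where "I = \<Union> (fst ` G)"
  define \<gamma> where "\<gamma> \<tau> = snd (SOME g. g \<in> G \<and> \<tau> \<in> fst g) \<tau>" for \<tau>
  have \<eta>\<^sub>0G: "(J\<^sub>0, \<eta>\<^sub>0) \<in> G" using \<eta>\<^sub>0 by (simp add: G_def)
  have \<gamma>_eq: "\<gamma> \<tau> = \<eta> \<tau>" if "(J, \<eta>) \<in> G" "\<tau> \<in> J" for J \<eta> \<tau>
  proof -
    define g where "g = (SOME g. g \<in> G \<and> \<tau> \<in> fst g)"
    have g: "g \<in> G \<and> \<tau> \<in> fst g"
      unfolding g_def by (rule someI[of _ "(J, \<eta>)"]) (use that in simp)
    obtain J' \<eta>' where "g = (J', \<eta>')" by (cases g)
    with g have "(J', \<eta>') \<in> G" "\<tau> \<in> J'" "\<gamma> \<tau> = \<eta>' \<tau>"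
      by (simp_all add: \<gamma>_def g_def[symmetric])
    with that show ?thesis using geodesic_unique[OF web, of J' \<eta>' J \<eta> 0 \<tau>] by (simp add: G_def)
  qed
  have JI: "open_interval J" "J \<subseteq> I" if "(J, \<eta>) \<in> G" for J \<eta>
    using that by (force simp: G_def I_def geodesic_iff)+
  have JI': "open J" "connected J" if "(J, \<eta>) \<in> G" for J \<eta>
    using open_intervalD[OF JI(1)[OF that]] by auto
  have "open I" unfolding I_def using JI' by (intro open_Union) auto
  moreover have "connected I" unfolding I_def
    by (rule connected_Union) (use JI' in \<open>auto simp: G_def\<close>)
  moreover have "0 \<in> I" using \<eta>\<^sub>0G \<eta>\<^sub>0 JI(2) by blast
  ultimately have I: "open_interval I" by (intro open_intervalI) auto
  have \<gamma>: "geodesic ?\<Gamma> I \<gamma>"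
  proof (rule geodesic_local[OF I])
    fix \<tau> assume "\<tau> \<in> I"
    then obtain J \<eta> where J: "(J, \<eta>) \<in> G" "\<tau> \<in> J" by (auto simp: I_def)
    then have "geodesic ?\<Gamma> J \<eta>" by (simp add: G_def)
    with J \<gamma>_eq[OF J(1)] show "\<exists>J \<eta>. geodesic ?\<Gamma> J \<eta> \<and> \<tau> \<in> J \<and> (\<forall>\<sigma>\<in>J. \<gamma> \<sigma> = \<eta> \<sigma>)"
      by blast
  qed
  have \<gamma>0: "\<gamma> 0 = \<eta>\<^sub>0 0" using \<gamma>_eq[OF \<eta>\<^sub>0G \<eta>\<^sub>0(2)] .
  have "open J\<^sub>0" using JI(1)[OF \<eta>\<^sub>0G] by (rule open_intervalD)
  then have \<gamma>'0: "velocity \<gamma> 0 = velocity \<eta>\<^sub>0 0"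
    using \<eta>\<^sub>0(2) \<gamma>_eq[OF \<eta>\<^sub>0G] by (rule vector_derivative_cong_open)
  have max: "maximal_geodesic ?\<Gamma> I \<gamma>"
    unfolding maximal_geodesic_def
  proof (intro conjI \<gamma> allI impI)
    fix J \<eta> assume *: "geodesic ?\<Gamma> J \<eta> \<and> I \<subseteq> J \<and> (\<forall>\<tau>\<in>I. \<eta> \<tau> = \<gamma> \<tau>)"
    have "velocity \<eta> 0 = velocity \<gamma> 0"
      using open_intervalD(1)[OF I] \<open>0 \<in> I\<close> by (rule vector_derivative_cong_open) (use * in blast)
    then have "(J, \<eta>) \<in> G" using * \<open>0 \<in> I\<close> \<gamma>0 \<gamma>'0 by (auto simp: G_def)
    then show "J = I" using JI(2) * by blast
  qed
  show thesis by (rule that[OF max \<open>0 \<in> I\<close> \<gamma>0 \<gamma>'0])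
qed

text \<open>The plaque geodesic with the position and velocity that \<gamma> has at p agrees with
  \<gamma> on the overlap, so the two glue to a geodesic. Maximality of \<gamma> means that nothing
  was added.\<close>

lemma maximal_geodesic_contains_plaque:
  assumes web: "veronese_web F" and l: "l \<in> RP1" and box: "flow_box (F l) U \<phi> a b"
    and \<gamma>: "maximal_geodesic (web_connection F) I \<gamma>"
    and tan: "\<And>\<tau>. \<tau> \<in> I \<Longrightarrow> velocity \<gamma> \<tau> \<in> tangent_space (F l) (\<gamma> \<tau>)"
    and p: "p \<in> \<gamma> ` I" "p \<in> U"
  shows "{q\<in>U. snd (\<phi> q) = snd (\<phi> p)} \<subseteq> \<gamma> ` I"
proof -
  let ?\<Gamma> = "web_connection F"
  obtain \<tau>\<^sub>0 where \<tau>\<^sub>0: "\<tau>\<^sub>0 \<in> I" "p = \<gamma> \<tau>\<^sub>0" using p(1) by blast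
  have geo: "geodesic ?\<Gamma> I \<gamma>" using \<gamma> by (simp add: maximal_geodesic_def)
  then have I: "open_interval I" and nz: "velocity \<gamma> \<tau>\<^sub>0 \<noteq> 0" using \<tau>\<^sub>0 by (auto simp: geodesic_iff)
  have tan\<^sub>0: "velocity \<gamma> \<tau>\<^sub>0 \<in> tangent_space (F l) p" using tan[OF \<tau>\<^sub>0(1)] \<tau>\<^sub>0(2) by simp
  obtain J \<eta> and \<alpha> :: "plane \<Rightarrow> real"
    where \<eta>: "geodesic ?\<Gamma> J \<eta>" "0 \<in> J" "\<eta> 0 = p" "velocity \<eta> 0 = velocity \<gamma> \<tau>\<^sub>0"
      "\<eta> ` J = {q\<in>U. snd (\<phi> q) = snd (\<phi> p)}"
    by (rule plaque_geodesic[OF web l box p(2) nz tan\<^sub>0]) (assumption | rule that)+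
  \<comment> \<open>Time is shifted so that the plaque geodesic passes p at
    \<open>\<tau>\<^sub>0\<close>; the factor 1 matches the shape of
    \<open>geodesic_affine\<close>.\<close>
  define J' where "J' = {s. - \<tau>\<^sub>0 + 1 * s \<in> J}"
  define \<eta>' where "\<eta>' s = \<eta> (- \<tau>\<^sub>0 + 1 * s)" for s
  note aff = geodesic_affine[OF \<eta>(1) one_neq_zero, of "- \<tau>\<^sub>0", folded J'_def \<eta>'_def]
  have "\<tau>\<^sub>0 \<in> J'" "\<eta>' \<tau>\<^sub>0 = \<gamma> \<tau>\<^sub>0"
    using \<eta>(2,3) \<tau>\<^sub>0(2) by (auto simp: J'_def \<eta>'_def)
  moreover have "velocity \<eta>' \<tau>\<^sub>0 = velocity \<gamma> \<tau>\<^sub>0"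
    using aff(2)[of \<tau>\<^sub>0] \<eta>(2,4) by simp
  ultimately have \<eta>'0: "\<tau>\<^sub>0 \<in> J'" "\<eta>' \<tau>\<^sub>0 = \<gamma> \<tau>\<^sub>0" "velocity \<eta>' \<tau>\<^sub>0 = velocity \<gamma> \<tau>\<^sub>0"
    by auto
  have J': "open_interval J'" using aff(1) by (simp add: geodesic_iff)
  define \<xi> where "\<xi> \<tau> = (if \<tau> \<in> I then \<gamma> \<tau> else \<eta>' \<tau>)" for \<tau>
  have \<xi>: "\<xi> \<tau> = \<eta>' \<tau>" if "\<tau> \<in> J'" for \<tau>
    using geodesic_unique[OF web geo aff(1) \<tau>\<^sub>0(1) \<eta>'0(1)] \<eta>'0 that by (simp add: \<xi>_def)
  have "connected (I \<union> J')"
    using open_intervalD(2)[OF I] open_intervalD(2)[OF J'] \<tau>\<^sub>0(1) \<eta>'0(1) by (intro connected_Un) auto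
  then have un: "open_interval (I \<union> J')"
    using open_intervalD[OF I] open_intervalD[OF J'] by (intro open_intervalI) auto
  have "geodesic ?\<Gamma> (I \<union> J') \<xi>"
  proof (rule geodesic_local[OF un])
    fix \<tau> assume "\<tau> \<in> I \<union> J'"
    then show "\<exists>J \<eta>. geodesic ?\<Gamma> J \<eta> \<and> \<tau> \<in> J \<and> (\<forall>\<sigma>\<in>J. \<xi> \<sigma> = \<eta> \<sigma>)"
      using geo aff(1) \<xi> by (metis Un_iff \<xi>_def zero_neq_one)
  qed
  moreover have "\<forall>\<tau>\<in>I. \<xi> \<tau> = \<gamma> \<tau>" by (simp add: \<xi>_def)
  ultimately have "I \<union> J' = I" using \<gamma> unfolding maximal_geodesic_def by blast
  then have "\<eta>' ` J' \<subseteq> \<gamma> ` I" using \<xi> by (force simp: \<xi>_def)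
  with aff(3) \<eta>(5) show ?thesis by simp
qed

text \<open>That the image lies in one leaf is tangency. To reach an arbitrary point of the leaf,
  follow a path inside the leaf: short pieces of it are connected in a flow box, so they stay in one
  plaque, and a plaque that meets the image is contained in it. Membership in the image is thus
  locally constant along the path.\<close>

lemma maximal_geodesic_image_leaf:
  assumes web: "veronese_web F" and l: "l \<in> RP1"
    and \<gamma>: "maximal_geodesic (web_connection F) I \<gamma>"
    and tan: "\<And>\<tau>. \<tau> \<in> I \<Longrightarrow> velocity \<gamma> \<tau> \<in> tangent_space (F l) (\<gamma> \<tau>)"
  shows "\<gamma> ` I \<in> F l"
proof -
  have fol: "foliation (F l)" using web l by (rule veronese_web_foliation)
  have I: "open_interval I" "smooth_on I \<gamma>" using \<gamma> by (auto simp: maximal_geodesic_def geodesic_iff)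
  obtain L where L: "L \<in> F l" "\<gamma> ` I \<subseteq> L" using fol I tan by (rule tangent_curve_in_leaf)
  have "q \<in> \<gamma> ` I" if q: "q \<in> L" for q
  proof -
    obtain \<tau>\<^sub>0 where \<tau>\<^sub>0: "\<tau>\<^sub>0 \<in> I" using open_intervalD(3)[OF I(1)] by blast
    have "path_connected L" using fol L(1) by (simp add: foliation_def)
    moreover have "\<gamma> \<tau>\<^sub>0 \<in> L" using L(2) \<tau>\<^sub>0 by blast
    ultimately obtain g where g: "path g" "path_image g \<subseteq> L" "pathstart g = \<gamma> \<tau>\<^sub>0" "pathfinish g = q"
      using q unfolding path_connected_def by blast
    have cont: "continuous_on {0..1} g" using g(1) by (simp add: path_def)
    have gL: "g t \<in> L" if "t \<in> {0..1}" for t using g(2) that by (auto simp: path_image_def)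
    have "(g 0 \<in> \<gamma> ` I) = (g 1 \<in> \<gamma> ` I)"
    proof (rule connected_local_const[where f = "\<lambda>t. g t \<in> \<gamma> ` I" and A = "{0..1::real}"])
      show "\<forall>t\<in>{0..1}. \<forall>\<^sub>F s in at t within {0..1}. (g t \<in> \<gamma> ` I) = (g s \<in> \<gamma> ` I)"
      proof
        fix t :: real assume t: "t \<in> {0..1}"
        obtain U \<phi> a b where U: "g t \<in> U" and box: "flow_box (F l) U \<phi> a b" using fol by (rule foliation_flow_box)
        have "open U" using box by (simp add: flow_box_def coordinates_on_def)
        then obtain W where W: "open W" "W \<inter> {0..1} = g -` U \<inter> {0..1}"
          using cont unfolding continuous_on_open_invariant by blast
        have "t \<in> W" using W(2) t U by blast
        then obtain d where d: "d > 0" "ball t d \<subseteq> W" using W(1) open_contains_ball by blast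
        have con: "connected (g ` ({0..1} \<inter> ball t d))"
          using cont by (intro connected_continuous_image convex_connected convex_Int)
            (auto intro: continuous_on_subset)
        have sub: "g ` ({0..1} \<inter> ball t d) \<subseteq> U \<inter> L" using W(2) d(2) gL by blast
        have "(g t \<in> \<gamma> ` I) = (g s \<in> \<gamma> ` I)" if s: "s \<in> {0..1}" "s \<in> ball t d" for s
        proof -
          have eq: "snd (\<phi> (g s)) = snd (\<phi> (g t))"
            using flow_box_connected[OF box L(1) con sub] s t d(1) by simp
          have "g s \<in> U" "g t \<in> U" using sub s t d(1) by auto
          with eq have "g s \<in> {q\<in>U. snd (\<phi> q) = snd (\<phi> (g t))}" "g t \<in> {q\<in>U. snd (\<phi> q) = snd (\<phi> (g s))}"
            by simp_all
          then show ?thesis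
            using maximal_geodesic_contains_plaque[OF web l box \<gamma> tan _ \<open>g s \<in> U\<close>]
              maximal_geodesic_contains_plaque[OF web l box \<gamma> tan _ \<open>g t \<in> U\<close>] by blast
        qed
        moreover have "\<forall>\<^sub>F s in at t within {0..1}. s \<in> {0..1} \<and> s \<in> ball t d"
          using d(1) by (auto simp: eventually_at_topological intro!: exI[of _ "ball t d"])
        ultimately show "\<forall>\<^sub>F s in at t within {0..1}. (g t \<in> \<gamma> ` I) = (g s \<in> \<gamma> ` I)"
          by (auto elim: eventually_mono)
      qed
    qed auto
    moreover have "g 0 \<in> \<gamma> ` I" using g(3) \<tau>\<^sub>0 by (simp add: pathstart_def)
    ultimately show ?thesis using g(4) by (simp add: pathfinish_def)
  qed
  with L have "\<gamma> ` I = L" by blast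
  with L(1) show ?thesis by simp
qed

text \<open>A leaf is reached by starting a maximal geodesic at one of its points in a direction
  tangent to it: that geodesic fills a leaf of its own direction through the point, and both
  direction and leaf are unique. Conversely, a maximal geodesic has one direction and fills a leaf
  of that foliation.\<close>

theorem web_leaves_eq_maximal_geodesics:
  assumes web: "veronese_web F"
  shows "(\<Union>l\<in>RP1. F l) = maximal_unparametrised_geodesics (web_connection F)"
proof (intro set_eqI iffI)
  fix L assume "L \<in> (\<Union>l\<in>RP1. F l)"
  then obtain l where l: "l \<in> RP1" "L \<in> F l" by blast
  have fol: "foliation (F l)" using web l(1) by (rule veronese_web_foliation)
  have "partition_on UNIV (F l)" using fol by (simp only: foliation_def)
  then have "L \<noteq> {}" using l(2) partition_onD3 by metis
  then obtain p where p: "p \<in> L" by blast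
  obtain U \<phi> a b where U: "p \<in> U" and box: "flow_box (F l) U \<phi> a b" using fol by (rule foliation_flow_box)
  have co: "coordinates_on U \<phi>" using box by (simp add: flow_box_def)
  define v where "v = frechet_derivative (inv_into U \<phi>) (at (\<phi> p)) (1, 0)"
  have \<phi>v: "frechet_derivative \<phi> (at p) v = (1, 0)"
    using coordinates_on_derivative_inverse(2)[OF co U] by (simp add: v_def)
  have v: "v \<in> tangent_space (F l) p" using tangent_space_flow_box[OF fol box U] \<phi>v by simp
  have v0: "v \<noteq> 0"
    using \<phi>v linear_0[OF bounded_linear.linear[OF smooth_on_bounded_linear[OF coordinates_onD(4)[OF co] U]]]
    by (auto simp: zero_prod_def)
  obtain J \<eta> and \<alpha> :: "plane \<Rightarrow> real"
    where \<eta>: "geodesic (web_connection F) J \<eta>" "0 \<in> J" "\<eta> 0 = p" "velocity \<eta> 0 = v"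
    by (rule plaque_geodesic[OF web l(1) box U v0 v]) (assumption | rule that)+
  obtain I \<gamma> where \<gamma>: "maximal_geodesic (web_connection F) I \<gamma>" "0 \<in> I" "\<gamma> 0 = p" "velocity \<gamma> 0 = v"
    using maximal_geodesic_exists[OF web \<eta>(1,2)] \<eta>(3,4) by metis
  have "geodesic (web_connection F) I \<gamma>" using \<gamma>(1) by (simp add: maximal_geodesic_def)
  then obtain m where m: "m \<in> RP1" "\<And>\<tau>. \<tau> \<in> I \<Longrightarrow> velocity \<gamma> \<tau> \<in> tangent_space (F m) (\<gamma> \<tau>)"
    by (rule geodesic_direction[OF web]) (assumption | rule that)+
  have "m = l" using web_direction_unique[OF web v0, of p] m(1) m(2)[OF \<gamma>(2)] \<gamma>(3,4) l(1) v by auto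
  then have "\<gamma> ` I \<in> F l" using maximal_geodesic_image_leaf[OF web m(1) \<gamma>(1) m(2)] by simp
  moreover have "p \<in> \<gamma> ` I" using \<gamma>(2,3) by blast
  ultimately have "\<gamma> ` I = L" using foliation_leaf_unique[OF fol _ l(2) _ p] by blast
  then show "L \<in> maximal_unparametrised_geodesics (web_connection F)"
    using \<gamma>(1) unfolding maximal_unparametrised_geodesics_def by blast
next
  fix L assume "L \<in> maximal_unparametrised_geodesics (web_connection F)"
  then obtain I \<gamma> where \<gamma>: "maximal_geodesic (web_connection F) I \<gamma>" "L = \<gamma> ` I"
    unfolding maximal_unparametrised_geodesics_def by blast
  have "geodesic (web_connection F) I \<gamma>" using \<gamma>(1) by (simp add: maximal_geodesic_def)
  then obtain m where m: "m \<in> RP1" "\<And>\<tau>. \<tau> \<in> I \<Longrightarrow> velocity \<gamma> \<tau> \<in> tangent_space (F m) (\<gamma> \<tau>)"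
    by (rule geodesic_direction[OF web]) (assumption | rule that)+
  show "L \<in> (\<Union>l\<in>RP1. F l)" using maximal_geodesic_image_leaf[OF web m(1) \<gamma>(1) m(2)] m(1) \<gamma>(2) by blast
qed


section \<open>Adapted coordinates\<close>

lemma smooth_on_coordinates_compose:
  assumes "coordinates_on U \<phi>" "smooth_on (\<phi> ` U) k"
  shows "smooth_on U (\<lambda>q. k (\<phi> q))"
  using smooth_on_compose[OF coordinates_onD(1,2)[OF assms(1)] order_refl assms(2) coordinates_onD(4)[OF assms(1)]] .

lemma smooth_on_coord_field:
  assumes "coordinates_on U \<phi>"
  shows "smooth_on U (coord_field U \<phi> e)"
  unfolding coord_field_def[abs_def]
  by (intro smooth_on_coordinates_compose[OF assms] smooth_on_frechet_derivative coordinates_onD[OF assms])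

lemma frechet_derivative_coord_field:
  assumes co: "coordinates_on U \<phi>" and q: "q \<in> U" and k: "smooth_on (\<phi> ` U) k"
  shows "frechet_derivative (\<lambda>q. k (\<phi> q)) (at q) (coord_field U \<phi> e q) = frechet_derivative k (at (\<phi> q)) e"
proof -
  have "\<phi> q \<in> \<phi> ` U" using q by blast
  from has_derivative_compose[OF coordinates_on_has_derivative(1)[OF co q] smooth_on_has_derivative[OF k this]]
  have "frechet_derivative (\<lambda>q. k (\<phi> q)) (at q) =
      (\<lambda>v. frechet_derivative k (at (\<phi> q)) (frechet_derivative \<phi> (at q) v))"
    by (rule frechet_derivative_at[symmetric])
  then show ?thesis
    by (simp add: coord_field_def coordinates_on_derivative_inverse(2)[OF co q])
qed

lemma coord_field_coordinates:
  assumes co: "coordinates_on U \<phi>" and q: "q \<in> U"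
  shows "frechet_derivative \<phi> (at q) (coord_field U \<phi> e q) = e"
  using coordinates_on_derivative_inverse(2)[OF assms] by (simp add: coord_field_def)

lemma coord_field_decomposition:
  assumes co: "coordinates_on U \<phi>" and q: "q \<in> U"
  shows "v = fst (frechet_derivative \<phi> (at q) v) *\<^sub>R coord_field U \<phi> (1, 0) q +
             snd (frechet_derivative \<phi> (at q) v) *\<^sub>R coord_field U \<phi> (0, 1) q"
proof -
  have "\<phi> q \<in> \<phi> ` U" using q by blast
  note lin = frechet_derivative_linear[OF coordinates_onD(5)[OF co] this]
  have "frechet_derivative \<phi> (at q) v = fst (frechet_derivative \<phi> (at q) v) *\<^sub>R (1, 0) +
      snd (frechet_derivative \<phi> (at q) v) *\<^sub>R (0, 1)" by simp
  then have "frechet_derivative (inv_into U \<phi>) (at (\<phi> q)) (frechet_derivative \<phi> (at q) v) =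
      fst (frechet_derivative \<phi> (at q) v) *\<^sub>R coord_field U \<phi> (1, 0) q +
      snd (frechet_derivative \<phi> (at q) v) *\<^sub>R coord_field U \<phi> (0, 1) q"
    unfolding coord_field_def by (metis lin(1,2))
  then show ?thesis by (simp only: coordinates_on_derivative_inverse(1)[OF co q])
qed

lemma coord_field_eq_iff:
  assumes co: "coordinates_on U \<phi>" and q: "q \<in> U"
  shows "a *\<^sub>R coord_field U \<phi> (1, 0) q + b *\<^sub>R coord_field U \<phi> (0, 1) q =
         c *\<^sub>R coord_field U \<phi> (1, 0) q + d *\<^sub>R coord_field U \<phi> (0, 1) q \<longleftrightarrow> a = c \<and> b = d" (is "?l = ?r \<longleftrightarrow> _")
proof
  note lin = frechet_derivative_linear[OF coordinates_onD(4)[OF co] q]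
  assume "?l = ?r"
  then have "frechet_derivative \<phi> (at q) ?l = frechet_derivative \<phi> (at q) ?r" by (rule arg_cong)
  then show "a = c \<and> b = d" by (simp add: lin coord_field_coordinates[OF co q])
qed auto

text \<open>Both sides are mixed second derivatives of the inverse chart. This is the vanishing Lie
  bracket that turns symmetry of \<Gamma> into equality of the mixed covariant derivatives.\<close>

lemma commuting_coord_fields:
  assumes co: "coordinates_on U \<phi>" and q: "q \<in> U"
  shows "frechet_derivative (coord_field U \<phi> e) (at q) (coord_field U \<phi> e' q) =
         frechet_derivative (coord_field U \<phi> e') (at q) (coord_field U \<phi> e q)"
proof -
  note c = coordinates_onD[OF co]
  have "frechet_derivative (coord_field U \<phi> e) (at q) (coord_field U \<phi> e' q) =
      frechet_derivative (\<lambda>z. frechet_derivative (inv_into U \<phi>) (at z) e) (at (\<phi> q)) e'" for e e'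
  proof -
    have e: "coord_field U \<phi> e = (\<lambda>q. frechet_derivative (inv_into U \<phi>) (at (\<phi> q)) e)"
      by (simp add: coord_field_def fun_eq_iff)
    show ?thesis
      using frechet_derivative_coord_field[OF co q smooth_on_frechet_derivative[OF c(5)], of e e'] by (simp only: e)
  qed
  then show ?thesis using symmetric_second_derivative[OF c(2,5), of "\<phi> q"] q by simp
qed

section \<open>Partial derivatives in a chart\<close>

lemma partial_eq:
  assumes co: "coordinates_on U \<phi>" and w: "smooth_on U w" and q: "q \<in> U"
  shows "frechet_derivative w (at q) (coord_field U \<phi> e q) =
         frechet_derivative (\<lambda>z. w (inv_into U \<phi> z)) (at (\<phi> q)) e"
proof -
  note c = coordinates_onD[OF co]
  have "w differentiable (at (inv_into U \<phi> (\<phi> q)))"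
    using smooth_on_differentiable[OF w q] by (simp add: c(3) q)
  then have "((\<lambda>z. w (inv_into U \<phi> z)) has_derivative (\<lambda>e. frechet_derivative w (at (inv_into U \<phi> (\<phi> q)))
      (frechet_derivative (inv_into U \<phi>) (at (\<phi> q)) e))) (at (\<phi> q))"
    unfolding frechet_derivative_works
    by (rule has_derivative_compose[OF coordinates_on_has_derivative(2)[OF co q]])
  from frechet_derivative_at[OF this, symmetric] show ?thesis
    by (simp add: coord_field_def c(3) q)
qed

lemma smooth_on_pullback_inverse:
  assumes co: "coordinates_on U \<phi>" and w: "smooth_on U w"
  shows "smooth_on (\<phi> ` U) (\<lambda>z. w (inv_into U \<phi> z))"
proof (rule smooth_on_compose[where T = U and f = w and g = "inv_into U \<phi>"])
  show "inv_into U \<phi> ` (\<phi> ` U) \<subseteq> U" by (rule image_subsetI) (rule inv_into_into)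
qed (use coordinates_onD[OF co] w in auto)

lemma smooth_on_partial:
  assumes co: "coordinates_on U \<phi>" and w: "smooth_on U w"
  shows "smooth_on U (\<lambda>q. frechet_derivative w (at q) (coord_field U \<phi> e q))"
  by (rule smooth_on_cong[OF coordinates_onD(1)[OF co] smooth_on_coordinates_compose[OF co
          smooth_on_frechet_derivative[OF smooth_on_pullback_inverse[OF co w]]]])
    (simp add: partial_eq[OF co w])

text \<open>Transported to the image of the chart, both sides become ordinary second derivatives of
  w composed with the inverse chart.\<close>

lemma mixed_partials:
  fixes w :: "plane \<Rightarrow> real"
  assumes co: "coordinates_on U \<phi>" and w: "smooth_on U w" and q: "q \<in> U"
  shows "frechet_derivative (\<lambda>q. frechet_derivative w (at q) (coord_field U \<phi> e q)) (at q) (coord_field U \<phi> e' q) =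
         frechet_derivative (\<lambda>q. frechet_derivative w (at q) (coord_field U \<phi> e' q)) (at q) (coord_field U \<phi> e q)"
proof -
  note c = coordinates_onD[OF co]
  let ?W = "\<lambda>z. w (inv_into U \<phi> z)"
  have W: "smooth_on (\<phi> ` U) ?W" using co w by (rule smooth_on_pullback_inverse)
  have "frechet_derivative (\<lambda>q. frechet_derivative w (at q) (coord_field U \<phi> e q)) (at q) (coord_field U \<phi> e' q) =
      frechet_derivative (\<lambda>z. frechet_derivative ?W (at z) e) (at (\<phi> q)) e'" for e e'
  proof -
    have "frechet_derivative (\<lambda>q. frechet_derivative w (at q) (coord_field U \<phi> e q)) (at q) =
        frechet_derivative (\<lambda>q. frechet_derivative ?W (at (\<phi> q)) e) (at q)"
      by (rule frechet_derivative_transform_within_open[OF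
            smooth_on_differentiable[OF smooth_on_partial[OF co w] q] c(1) q partial_eq[OF co w]])
    then show ?thesis
      using frechet_derivative_coord_field[OF co q smooth_on_frechet_derivative[OF W]] by simp
  qed
  then show ?thesis using symmetric_second_derivative[OF c(2) W, of "\<phi> q"] q by simp
qed

lemma derivative_in_coordinates:
  fixes w :: "plane \<Rightarrow> real"
  assumes co: "coordinates_on U \<phi>" and w: "smooth_on U w" and q: "q \<in> U"
  shows "frechet_derivative w (at q) v =
    partial_x U \<phi> w q * fst (frechet_derivative \<phi> (at q) v) + partial_y U \<phi> w q * snd (frechet_derivative \<phi> (at q) v)"
  by (subst coord_field_decomposition[OF co q, of v])
    (simp add: frechet_derivative_linear[OF w q] partial_x_def partial_y_def)

text \<open>This is the one-form w_x dx, and \<open>coframe_y\<close> is w_y dy. The differential of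
  the chart passes through \<open>pair_blinfun\<close> so that the result is an element of the
  operator space, as a frame requires.\<close>

definition coframe_x :: "plane set \<Rightarrow> (plane \<Rightarrow> plane) \<Rightarrow> (plane \<Rightarrow> real) \<Rightarrow> plane \<Rightarrow> plane \<Rightarrow>\<^sub>L real" where
  "coframe_x U \<phi> w q = partial_x U \<phi> w q *\<^sub>R
     (fst_blinfun o\<^sub>L pair_blinfun (frechet_derivative \<phi> (at q) (1, 0)) (frechet_derivative \<phi> (at q) (0, 1)))"

definition coframe_y :: "plane set \<Rightarrow> (plane \<Rightarrow> plane) \<Rightarrow> (plane \<Rightarrow> real) \<Rightarrow> plane \<Rightarrow> plane \<Rightarrow>\<^sub>L real" where
  "coframe_y U \<phi> w q = partial_y U \<phi> w q *\<^sub>R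
     (snd_blinfun o\<^sub>L pair_blinfun (frechet_derivative \<phi> (at q) (1, 0)) (frechet_derivative \<phi> (at q) (0, 1)))"

lemma coframe_apply:
  assumes "coordinates_on U \<phi>" "q \<in> U"
  shows "blinfun_apply (coframe_x U \<phi> w q) v = partial_x U \<phi> w q * fst (frechet_derivative \<phi> (at q) v)"
    and "blinfun_apply (coframe_y U \<phi> w q) v = partial_y U \<phi> w q * snd (frechet_derivative \<phi> (at q) v)"
  using pair_blinfun_frechet_derivative[OF coordinates_onD(4)[OF assms(1)] assms(2)]
  by (simp_all add: coframe_x_def coframe_y_def blinfun.scaleR_left del: pair_blinfun_apply)

lemma coframe_smooth:
  assumes co: "coordinates_on U \<phi>" and w: "smooth_on U w"
  shows "smooth_on U (coframe_x U \<phi> w)" "smooth_on U (coframe_y U \<phi> w)"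
proof -
  note c = coordinates_onD[OF co]
  have bl: "bounded_linear (\<lambda>A. (B :: plane \<Rightarrow>\<^sub>L real) o\<^sub>L (A :: plane \<Rightarrow>\<^sub>L plane))" for B
    by (rule bounded_bilinear.bounded_linear_right[OF bounded_bilinear_blinfun_compose])
  have P: "smooth_on U (\<lambda>q. pair_blinfun (frechet_derivative \<phi> (at q) (1, 0)) (frechet_derivative \<phi> (at q) (0, 1)))"
    by (intro smooth_on_pair_blinfun smooth_on_frechet_derivative c)
  show "smooth_on U (coframe_x U \<phi> w)" "smooth_on U (coframe_y U \<phi> w)"
    unfolding coframe_x_def[abs_def] coframe_y_def[abs_def] partial_x_def partial_y_def
    by (rule smooth_on_scaleR[OF c(1) smooth_on_partial[OF co w] smooth_on_linear[OF c(1) bl P]])+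
qed

lemma coframe_det:
  assumes co: "coordinates_on U \<phi>" and q: "q \<in> U"
    and nz: "t\<^sub>0 \<noteq> 0" "partial_x U \<phi> w q \<noteq> 0" "partial_y U \<phi> w q \<noteq> 0"
  shows "form_det (t\<^sub>0 *\<^sub>R coframe_x U \<phi> w q) (coframe_y U \<phi> w q) \<noteq> 0"
proof (rule form_det_nonzero, intro allI impI)
  fix a b assume *: "a *\<^sub>R t\<^sub>0 *\<^sub>R coframe_x U \<phi> w q + b *\<^sub>R coframe_y U \<phi> w q = 0"
  show "a = 0 \<and> b = 0"
    using arg_cong[OF *, of "\<lambda>\<alpha>. blinfun_apply \<alpha> (coord_field U \<phi> (1, 0) q)"]
      arg_cong[OF *, of "\<lambda>\<alpha>. blinfun_apply \<alpha> (coord_field U \<phi> (0, 1) q)"] nz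
    by (simp add: blinfun.add_left blinfun.scaleR_left coframe_apply[OF co q] coord_field_coordinates[OF co q])
qed

text \<open>Adapted coordinates prescribe only three kernels, but these determine the pair of forms
  up to a common factor and thereby every tangent space of the web. The constant
  \<open>t\<^sub>0\<close> enters because the combination at parameter \<open>t\<^sub>0\<close> must
  be a multiple of dw = w_x dx + w_y dy.\<close>

lemma adapted_coordinates_frame:
  assumes web: "veronese_web F" and t\<^sub>0: "t\<^sub>0 \<noteq> 0" and ad: "adapted_coordinates F t\<^sub>0 U \<phi> w"
  shows "web_frame F U (\<lambda>q. t\<^sub>0 *\<^sub>R coframe_x U \<phi> w q) (coframe_y U \<phi> w)"
proof -
  have co: "coordinates_on U \<phi>" and w: "smooth_on U w" using ad by (auto simp: adapted_coordinates_def)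
  note c = coordinates_onD[OF co] and sm = coframe_smooth[OF co w]
  have nz: "partial_x U \<phi> w q \<noteq> 0" "partial_y U \<phi> w q \<noteq> 0" if "q \<in> U" for q
    using ad that by (auto simp: adapted_coordinates_def)
  have det: "form_det (t\<^sub>0 *\<^sub>R coframe_x U \<phi> w q) (coframe_y U \<phi> w q) \<noteq> 0" if "q \<in> U" for q
    using coframe_det[OF co that t\<^sub>0 nz[OF that]] .
  have ker: "tangent_space (F (proj_point s t)) q =
      {v. s * blinfun_apply (t\<^sub>0 *\<^sub>R coframe_x U \<phi> w q) v + t * blinfun_apply (coframe_y U \<phi> w q) v = 0}"
    if q: "q \<in> U" and st: "(s, t) \<noteq> (0, 0)" for q s t
  proof -
    obtain V \<omega>\<^sub>0 \<omega>\<^sub>1 where V: "q \<in> V" "web_frame F V \<omega>\<^sub>0 \<omega>\<^sub>1" using web by (rule veronese_web_frame)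
    have det\<omega>: "form_det (\<omega>\<^sub>0 q) (\<omega>\<^sub>1 q) \<noteq> 0" using V by (simp add: web_frame_def)
    have ker\<omega>: "v \<in> tangent_space (F (proj_point s t)) q \<longleftrightarrow>
        s * blinfun_apply (\<omega>\<^sub>0 q) v + t * blinfun_apply (\<omega>\<^sub>1 q) v = 0" if "(s, t) \<noteq> (0, 0)" for s t v
      using V that unfolding web_frame_def by blast
    have T: "v \<in> tangent_space (F (proj_point 1 0)) q \<longleftrightarrow> fst (frechet_derivative \<phi> (at q) v) = 0"
      "v \<in> tangent_space (F (proj_point 0 1)) q \<longleftrightarrow> snd (frechet_derivative \<phi> (at q) v) = 0"
      "v \<in> tangent_space (F (proj_point 1 t\<^sub>0)) q \<longleftrightarrow> frechet_derivative w (at q) v = 0" for v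
      using ad q by (simp_all add: adapted_coordinates_def frechet_derivative_fst_snd[OF c(4) q])
    have "\<exists>f. t\<^sub>0 *\<^sub>R coframe_x U \<phi> w q = f *\<^sub>R \<omega>\<^sub>0 q \<and> coframe_y U \<phi> w q = f *\<^sub>R \<omega>\<^sub>1 q"
    proof (rule forms_proportional[OF det\<omega> t\<^sub>0])
      show "blinfun_apply (t\<^sub>0 *\<^sub>R coframe_x U \<phi> w q) v = 0" if "blinfun_apply (\<omega>\<^sub>0 q) v = 0" for v
        using ker\<omega>[of 1 0 v] T(1)[of v] that by (simp add: blinfun.scaleR_left coframe_apply[OF co q])
      show "blinfun_apply (coframe_y U \<phi> w q) v = 0" if "blinfun_apply (\<omega>\<^sub>1 q) v = 0" for v
        using ker\<omega>[of 0 1 v] T(2)[of v] that by (simp add: coframe_apply[OF co q])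
      show "blinfun_apply (t\<^sub>0 *\<^sub>R coframe_x U \<phi> w q + t\<^sub>0 *\<^sub>R coframe_y U \<phi> w q) v = 0"
        if "blinfun_apply (\<omega>\<^sub>0 q + t\<^sub>0 *\<^sub>R \<omega>\<^sub>1 q) v = 0" for v
      proof -
        have "frechet_derivative w (at q) v = 0"
          using ker\<omega>[of 1 t\<^sub>0 v] T(3)[of v] that by (simp add: blinfun.add_left blinfun.scaleR_left)
        then show ?thesis
          unfolding derivative_in_coordinates[OF co w q]
          by (simp add: blinfun.add_left blinfun.scaleR_left coframe_apply[OF co q] distrib_left[symmetric])
      qed
    qed
    then obtain f where f: "t\<^sub>0 *\<^sub>R coframe_x U \<phi> w q = f *\<^sub>R \<omega>\<^sub>0 q" "coframe_y U \<phi> w q = f *\<^sub>R \<omega>\<^sub>1 q" by blast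
    have "f \<noteq> 0" using det[OF q] by (auto simp: f form_det_def)
    have "s * blinfun_apply (t\<^sub>0 *\<^sub>R coframe_x U \<phi> w q) v + t * blinfun_apply (coframe_y U \<phi> w q) v =
        f * (s * blinfun_apply (\<omega>\<^sub>0 q) v + t * blinfun_apply (\<omega>\<^sub>1 q) v)" for v
      unfolding f by (simp add: blinfun.scaleR_left algebra_simps)
    then show ?thesis using ker\<omega>[OF st] \<open>f \<noteq> 0\<close> by auto
  qed
  show ?thesis
    unfolding web_frame_def using c(1) sm det ker
    by (auto intro!: smooth_on_linear[OF _ bounded_linear_scaleR_right])
qed

text \<open>The product rule for the pairing of a form with a field: A applied to \<eta>_i(B) is the
  covariant derivative of \<eta>_i, here \<theta>(A) \<eta>_i(B), plus \<eta>_i of the covariant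
  derivative of B. It allows computing with the functions \<eta>_i(B) alone.\<close>

lemma cov_deriv_in_frame:
  assumes G: "connection_at \<eta>\<^sub>0 \<eta>\<^sub>1 q (\<Gamma> q)" and \<eta>: "\<eta>\<^sub>0 differentiable (at q)" "\<eta>\<^sub>1 differentiable (at q)"
  obtains \<theta> :: "plane \<Rightarrow> real" where
    "\<And>A B. B differentiable (at q) \<Longrightarrow> blinfun_apply (\<eta>\<^sub>0 q) (cov_deriv \<Gamma> A B q) =
       frechet_derivative (\<lambda>p. blinfun_apply (\<eta>\<^sub>0 p) (B p)) (at q) (A q) - \<theta> (A q) * blinfun_apply (\<eta>\<^sub>0 q) (B q)"
    "\<And>A B. B differentiable (at q) \<Longrightarrow> blinfun_apply (\<eta>\<^sub>1 q) (cov_deriv \<Gamma> A B q) =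
       frechet_derivative (\<lambda>p. blinfun_apply (\<eta>\<^sub>1 p) (B p)) (at q) (A q) - \<theta> (A q) * blinfun_apply (\<eta>\<^sub>1 q) (B q)"
proof -
  obtain \<theta> :: "plane \<Rightarrow> real" where \<theta>:
    "\<And>u v. blinfun_apply (\<eta>\<^sub>0 q) (blinfun_apply (blinfun_apply (\<Gamma> q) u) v) =
          blinfun_apply (frechet_derivative \<eta>\<^sub>0 (at q) u) v - \<theta> u * blinfun_apply (\<eta>\<^sub>0 q) v"
    "\<And>u v. blinfun_apply (\<eta>\<^sub>1 q) (blinfun_apply (blinfun_apply (\<Gamma> q) u) v) =
          blinfun_apply (frechet_derivative \<eta>\<^sub>1 (at q) u) v - \<theta> u * blinfun_apply (\<eta>\<^sub>1 q) v"
    using G unfolding connection_at_def by blast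
  have D: "frechet_derivative (\<lambda>p. blinfun_apply (\<eta> p) (B p)) (at q) u =
      blinfun_apply (\<eta> q) (frechet_derivative B (at q) u) + blinfun_apply (frechet_derivative \<eta> (at q) u) (B q)"
    if "\<eta> differentiable (at q)" "B differentiable (at q)" for \<eta> :: "plane \<Rightarrow> plane \<Rightarrow>\<^sub>L real" and B u
    using frechet_derivative_at[OF bounded_bilinear.FDERIV[OF bounded_bilinear_blinfun_apply
          that[unfolded frechet_derivative_works]], symmetric] by simp
  show thesis
  proof (rule that[of \<theta>])
    fix A B :: "plane \<Rightarrow> plane" assume B: "B differentiable (at q)"
    show "blinfun_apply (\<eta>\<^sub>0 q) (cov_deriv \<Gamma> A B q) =
       frechet_derivative (\<lambda>p. blinfun_apply (\<eta>\<^sub>0 p) (B p)) (at q) (A q) - \<theta> (A q) * blinfun_apply (\<eta>\<^sub>0 q) (B q)"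
      by (simp add: D[OF \<eta>(1) B] cov_deriv_def blinfun.add_right \<theta>)
    show "blinfun_apply (\<eta>\<^sub>1 q) (cov_deriv \<Gamma> A B q) =
       frechet_derivative (\<lambda>p. blinfun_apply (\<eta>\<^sub>1 p) (B p)) (at q) (A q) - \<theta> (A q) * blinfun_apply (\<eta>\<^sub>1 q) (B q)"
      by (simp add: D[OF \<eta>(2) B] cov_deriv_def blinfun.add_right \<theta>)
  qed
qed

text \<open>On the coordinate fields the coframe takes only the values \<open>t\<^sub>0 w_x\<close>,
  w_y and 0, so every covariant derivative is known up to \<theta>. Vanishing torsion gives
  \<theta>(X) = w_xy / w_y and \<theta>(Y) = w_xy / w_x.\<close>

lemma web_connection_adapted:
  fixes F \<phi> w U
  defines "X \<equiv> coord_field U \<phi> (1, 0)" and "Y \<equiv> coord_field U \<phi> (0, 1)"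
    and "w_x \<equiv> partial_x U \<phi> w" and "w_y \<equiv> partial_y U \<phi> w"
  assumes web: "veronese_web F" and t\<^sub>0: "t\<^sub>0 \<noteq> 0" and ad: "adapted_coordinates F t\<^sub>0 U \<phi> w" and q: "q \<in> U"
  shows "cov_deriv (web_connection F) X X q =
      ((w_y q * partial_x U \<phi> w_x q - w_x q * partial_y U \<phi> w_x q) / (w_x q * w_y q)) *\<^sub>R X q"
    and "cov_deriv (web_connection F) Y Y q =
      ((w_x q * partial_y U \<phi> w_y q - w_y q * partial_y U \<phi> w_x q) / (w_x q * w_y q)) *\<^sub>R Y q"
    and "cov_deriv (web_connection F) X Y q = 0"
    and "cov_deriv (web_connection F) Y X q = 0"
proof -
  let ?\<Gamma> = "web_connection F" and ?\<eta>\<^sub>0 = "\<lambda>q. t\<^sub>0 *\<^sub>R coframe_x U \<phi> w q" and ?\<eta>\<^sub>1 = "coframe_y U \<phi> w"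
  have co: "coordinates_on U \<phi>" and w: "smooth_on U w" and nz: "w_x q \<noteq> 0" "w_y q \<noteq> 0"
    using ad q by (auto simp: adapted_coordinates_def w_x_def w_y_def)
  note c = coordinates_onD[OF co]
  have fr: "web_frame F U ?\<eta>\<^sub>0 ?\<eta>\<^sub>1" using web t\<^sub>0 ad by (rule adapted_coordinates_frame)
  have det: "form_det (?\<eta>\<^sub>0 q) (?\<eta>\<^sub>1 q) \<noteq> 0" using fr q by (simp add: web_frame_def)
  have \<eta>_diff: "?\<eta>\<^sub>0 differentiable (at q)" "?\<eta>\<^sub>1 differentiable (at q)"
    using fr q unfolding web_frame_def by (auto intro: smooth_on_differentiable)
  have G: "connection_at ?\<eta>\<^sub>0 ?\<eta>\<^sub>1 q (?\<Gamma> q)" using fr q by (rule connection_at_web_connection)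
  have XY_diff: "X differentiable (at q)" "Y differentiable (at q)"
    unfolding X_def Y_def using smooth_on_coord_field[OF co] q by (auto intro: smooth_on_differentiable)
  have \<eta>: "blinfun_apply (?\<eta>\<^sub>0 p) (X p) = t\<^sub>0 * w_x p" "blinfun_apply (?\<eta>\<^sub>0 p) (Y p) = 0"
    "blinfun_apply (?\<eta>\<^sub>1 p) (X p) = 0" "blinfun_apply (?\<eta>\<^sub>1 p) (Y p) = w_y p" if "p \<in> U" for p
    by (simp_all add: blinfun.scaleR_left coframe_apply[OF co that] X_def Y_def w_x_def w_y_def
        coord_field_coordinates[OF co that])
  have sm: "smooth_on U w_x" "smooth_on U w_y"
    unfolding w_x_def w_y_def partial_x_def[abs_def] partial_y_def[abs_def] by (rule smooth_on_partial[OF co w])+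
  have D\<eta>: "frechet_derivative (\<lambda>p. blinfun_apply (?\<eta>\<^sub>0 p) (X p)) (at q) u = t\<^sub>0 * frechet_derivative w_x (at q) u"
    "frechet_derivative (\<lambda>p. blinfun_apply (?\<eta>\<^sub>0 p) (Y p)) (at q) u = 0"
    "frechet_derivative (\<lambda>p. blinfun_apply (?\<eta>\<^sub>1 p) (X p)) (at q) u = 0"
    "frechet_derivative (\<lambda>p. blinfun_apply (?\<eta>\<^sub>1 p) (Y p)) (at q) u = frechet_derivative w_y (at q) u" for u
  proof -
    have tr: "frechet_derivative f (at q) u = g' u"
      if "(g has_derivative g') (at q)" "\<And>p. p \<in> U \<Longrightarrow> f p = g p" for f g :: "plane \<Rightarrow> real" and g'
    proof -
      have "(f has_derivative g') (at q)"
        using that(1) c(1) q by (rule has_derivative_transform_within_open) (simp add: that(2))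
      from frechet_derivative_at[OF this] show ?thesis by simp
    qed
    note w_x' = smooth_on_has_derivative[OF sm(1) q] and w_y' = smooth_on_has_derivative[OF sm(2) q]
    show "frechet_derivative (\<lambda>p. blinfun_apply (?\<eta>\<^sub>0 p) (X p)) (at q) u = t\<^sub>0 * frechet_derivative w_x (at q) u"
      using has_derivative_mult_right[OF w_x'] \<eta>(1) by (rule tr)
    show "frechet_derivative (\<lambda>p. blinfun_apply (?\<eta>\<^sub>0 p) (Y p)) (at q) u = 0"
      using has_derivative_const \<eta>(2) by (rule tr)
    show "frechet_derivative (\<lambda>p. blinfun_apply (?\<eta>\<^sub>1 p) (X p)) (at q) u = 0"
      using has_derivative_const \<eta>(3) by (rule tr)
    show "frechet_derivative (\<lambda>p. blinfun_apply (?\<eta>\<^sub>1 p) (Y p)) (at q) u = frechet_derivative w_y (at q) u"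
      using w_y' \<eta>(4) by (rule tr)
  qed
  have mixed: "frechet_derivative w_y (at q) (X q) = partial_y U \<phi> w_x q"
    unfolding w_x_def w_y_def partial_y_def partial_x_def[abs_def] X_def by (rule mixed_partials[OF co w q])
  have D_w: "frechet_derivative w_x (at q) (X q) = partial_x U \<phi> w_x q"
    "frechet_derivative w_x (at q) (Y q) = partial_y U \<phi> w_x q"
    "frechet_derivative w_y (at q) (Y q) = partial_y U \<phi> w_y q"
    by (simp_all add: partial_x_def partial_y_def X_def Y_def)
  obtain \<theta> :: "plane \<Rightarrow> real" where \<theta>:
    "\<And>A B. B differentiable (at q) \<Longrightarrow> blinfun_apply (?\<eta>\<^sub>0 q) (cov_deriv ?\<Gamma> A B q) =
       frechet_derivative (\<lambda>p. blinfun_apply (?\<eta>\<^sub>0 p) (B p)) (at q) (A q) - \<theta> (A q) * blinfun_apply (?\<eta>\<^sub>0 q) (B q)"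
    "\<And>A B. B differentiable (at q) \<Longrightarrow> blinfun_apply (?\<eta>\<^sub>1 q) (cov_deriv ?\<Gamma> A B q) =
       frechet_derivative (\<lambda>p. blinfun_apply (?\<eta>\<^sub>1 p) (B p)) (at q) (A q) - \<theta> (A q) * blinfun_apply (?\<eta>\<^sub>1 q) (B q)"
    by (rule cov_deriv_in_frame[where \<eta>\<^sub>0 = ?\<eta>\<^sub>0 and \<eta>\<^sub>1 = ?\<eta>\<^sub>1 and \<Gamma> = ?\<Gamma> and q = q, OF G \<eta>_diff]) (rule that)
  have cov: "blinfun_apply (?\<eta>\<^sub>0 q) (cov_deriv ?\<Gamma> X X q) = t\<^sub>0 * partial_x U \<phi> w_x q - \<theta> (X q) * (t\<^sub>0 * w_x q)"
    "blinfun_apply (?\<eta>\<^sub>1 q) (cov_deriv ?\<Gamma> X X q) = 0"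
    "blinfun_apply (?\<eta>\<^sub>0 q) (cov_deriv ?\<Gamma> Y X q) = t\<^sub>0 * partial_y U \<phi> w_x q - \<theta> (Y q) * (t\<^sub>0 * w_x q)"
    "blinfun_apply (?\<eta>\<^sub>1 q) (cov_deriv ?\<Gamma> Y X q) = 0"
    "blinfun_apply (?\<eta>\<^sub>0 q) (cov_deriv ?\<Gamma> X Y q) = 0"
    "blinfun_apply (?\<eta>\<^sub>1 q) (cov_deriv ?\<Gamma> X Y q) = partial_y U \<phi> w_x q - \<theta> (X q) * w_y q"
    "blinfun_apply (?\<eta>\<^sub>0 q) (cov_deriv ?\<Gamma> Y Y q) = 0"
    "blinfun_apply (?\<eta>\<^sub>1 q) (cov_deriv ?\<Gamma> Y Y q) = partial_y U \<phi> w_y q - \<theta> (Y q) * w_y q"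
    unfolding \<theta>(1)[OF XY_diff(1)] \<theta>(1)[OF XY_diff(2)] \<theta>(2)[OF XY_diff(1)] \<theta>(2)[OF XY_diff(2)]
      D\<eta> \<eta>[OF q] mixed D_w by simp_all
  have "blinfun_apply (blinfun_apply (?\<Gamma> q) (X q)) (Y q) = blinfun_apply (blinfun_apply (?\<Gamma> q) (Y q)) (X q)"
    using G unfolding connection_at_def by blast
  then have torsion: "cov_deriv ?\<Gamma> X Y q = cov_deriv ?\<Gamma> Y X q"
    using commuting_coord_fields[OF co q, of "(1, 0)" "(0, 1)"]
    by (simp add: cov_deriv_def X_def Y_def)
  \<comment> \<open>The first form annihilates \<nabla>_X Y and the second annihilates \<nabla>_Y X.
    Since these vectors coincide, the remaining components vanish as well, which determines \<theta>
    on both fields.\<close>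
  have \<theta>Y: "partial_y U \<phi> w_x q = \<theta> (Y q) * w_x q" using cov(3,5) torsion t\<^sub>0 by simp
  have \<theta>X: "partial_y U \<phi> w_x q = \<theta> (X q) * w_y q" using cov(4,6) torsion by simp
  show XY: "cov_deriv ?\<Gamma> X Y q = 0"
    by (rule form_det_eqI[OF det]) (use cov(5,6) \<theta>X in \<open>simp_all add: blinfun.zero_right\<close>)
  then show "cov_deriv ?\<Gamma> Y X q = 0" using torsion by simp
  show "cov_deriv ?\<Gamma> X X q = ((w_y q * partial_x U \<phi> w_x q - w_x q * partial_y U \<phi> w_x q) / (w_x q * w_y q)) *\<^sub>R X q"
    by (rule form_det_eqI[OF det])
      (use nz in \<open>simp_all add: cov(1,2) blinfun.scaleR_right \<eta>[OF q] \<theta>X field_simps\<close>)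
  show "cov_deriv ?\<Gamma> Y Y q = ((w_x q * partial_y U \<phi> w_y q - w_y q * partial_y U \<phi> w_x q) / (w_x q * w_y q)) *\<^sub>R Y q"
    by (rule form_det_eqI[OF det])
      (use nz in \<open>simp_all add: cov(7,8) blinfun.scaleR_right \<eta>[OF q] \<theta>Y field_simps\<close>)
qed

section \<open>The associated connection is the connection of the web\<close>

lemma is_associated_web_connection:
  assumes "veronese_web F"
  shows "is_associated_connection F (web_connection F)"
  unfolding is_associated_connection_def Let_def
  using web_connection_adapted[OF assms] linear_connection_web_connection[OF assms] by blast

text \<open>The second coordinate of a flow box is constant along plaques. Those for the parameters
  (1:0) and (0:1) serve as x and y, and the one for (1:1) as w, whence the value 1 for the constant
  \<open>t\<^sub>0\<close>.\<close>

lemma adapted_coordinates_exist: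
  assumes web: "veronese_web F"
  obtains U \<phi> w where "p \<in> U" "adapted_coordinates F 1 U \<phi> w"
proof -
  have RP1: "proj_point 1 0 \<in> RP1" "proj_point 0 1 \<in> RP1" "proj_point 1 1 \<in> RP1"
    unfolding RP1_eq by force+
  note fol = veronese_web_foliation[OF web RP1(1)] veronese_web_foliation[OF web RP1(2)]
    veronese_web_foliation[OF web RP1(3)]
  obtain U0 \<phi>0 a0 b0 where U0: "p \<in> U0" and box0: "flow_box (F (proj_point 1 0)) U0 \<phi>0 a0 b0"
    using fol(1) by (rule foliation_flow_box)
  obtain U1 \<phi>1 a1 b1 where U1: "p \<in> U1" and box1: "flow_box (F (proj_point 0 1)) U1 \<phi>1 a1 b1"
    using fol(2) by (rule foliation_flow_box)
  obtain U2 \<phi>2 a2 b2 where U2: "p \<in> U2" and box2: "flow_box (F (proj_point 1 1)) U2 \<phi>2 a2 b2"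
    using fol(3) by (rule foliation_flow_box)
  have co: "coordinates_on U0 \<phi>0" "coordinates_on U1 \<phi>1" "coordinates_on U2 \<phi>2"
    using box0 box1 box2 by (auto simp: flow_box_def)
  define S where "S = U0 \<inter> U1 \<inter> U2"
  have S: "open S" "p \<in> S" using co U0 U1 U2 by (auto simp: S_def coordinates_on_def)
  have "S \<subseteq> U0" "S \<subseteq> U1" "S \<subseteq> U2" by (auto simp: S_def)
  then have sm: "smooth_on S \<phi>0" "smooth_on S \<phi>1" "smooth_on S \<phi>2"
    using co coordinates_onD(4) smooth_on_subset by blast+
  define f where "f q = (snd (\<phi>0 q), snd (\<phi>1 q))" for q
  define w where "w q = snd (\<phi>2 q)" for q
  have smf: "smooth_on S f" and smw: "smooth_on S w"
    unfolding f_def w_def by (intro smooth_on_Pair smooth_on_snd S sm)+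
  have T: "tangent_space (F (proj_point 1 0)) q = {v. fst (frechet_derivative f (at q) v) = 0}"
    "tangent_space (F (proj_point 0 1)) q = {v. snd (frechet_derivative f (at q) v) = 0}"
    "tangent_space (F (proj_point 1 1)) q = {v. frechet_derivative w (at q) v = 0}" if q: "q \<in> S" for q
    using tangent_space_flow_box[OF fol(1) box0, of q] tangent_space_flow_box[OF fol(2) box1, of q]
      tangent_space_flow_box[OF fol(3) box2, of q] q frechet_derivative_fst_snd[OF smf q]
      frechet_derivative_fst_snd(2)[OF sm(1) q] frechet_derivative_fst_snd(2)[OF sm(2) q]
      frechet_derivative_fst_snd(2)[OF sm(3) q]
    by (simp_all add: S_def f_def w_def[abs_def])
  \<comment> \<open>Distinct foliations of the web are transverse. This gives both the nonsingular
    differential of the chart and the nonvanishing of w_x and w_y.\<close>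
  have two: "v = 0" if q: "q \<in> S" and v: "v \<in> tangent_space (F l) q" "v \<in> tangent_space (F m) q"
    and lm: "l \<in> RP1" "m \<in> RP1" "l \<noteq> m" for q v l m
    using web_direction_unique[OF web, of v q] v lm by blast
  have "(1, 0) \<in> proj_point 1 0" "(1, 1) \<in> proj_point 1 1" by (simp_all add: proj_point_def span_base)
  moreover have "(1, 0) \<notin> proj_point 0 1" "(1, 0) \<notin> proj_point 1 1" "(1, 1) \<notin> proj_point 0 1"
    by (auto simp: proj_point_def span_singleton)
  ultimately have ne: "proj_point 1 0 \<noteq> proj_point 0 1" "proj_point 1 0 \<noteq> proj_point 1 1" "proj_point 0 1 \<noteq> proj_point 1 1"
    by auto
  have "v = 0" if "frechet_derivative f (at p) v = 0" for v
    using that by (intro two[OF S(2) _ _ RP1(1,2) ne(1)]) (simp_all add: T[OF S(2)])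
  then obtain U where U: "p \<in> U" "U \<subseteq> S" "coordinates_on U f"
    using coordinates_on_of_nonsingular[OF S(1) smf S(2)] by blast
  have smwU: "smooth_on U w" using smw U(2) by (rule smooth_on_subset)
  have "adapted_coordinates F 1 U f w"
    unfolding adapted_coordinates_def
  proof (intro conjI ballI U(3) smwU)
    fix q assume q: "q \<in> U"
    then have qS: "q \<in> S" using U(2) by blast
    note cf = coord_field_coordinates[OF U(3) q] and lin0 = frechet_derivative_linear(3)[OF smf qS]
    show "partial_x U f w q \<noteq> 0"
    proof
      assume "partial_x U f w q = 0"
      then have "coord_field U f (1, 0) q = 0"
        by (intro two[OF qS _ _ RP1(2,3) ne(3)]) (simp_all add: T[OF qS] cf partial_x_def)
      then show False using cf[of "(1, 0)"] lin0 by (simp add: zero_prod_def)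
    qed
    show "partial_y U f w q \<noteq> 0"
    proof
      assume "partial_y U f w q = 0"
      then have "coord_field U f (0, 1) q = 0"
        by (intro two[OF qS _ _ RP1(1,3) ne(2)]) (simp_all add: T[OF qS] cf partial_y_def)
      then show False using cf[of "(0, 1)"] lin0 by (simp add: zero_prod_def)
    qed
  qed (use T U(2) smf in \<open>auto simp: frechet_derivative_fst_snd[OF smf]\<close>)
  with U(1) show thesis by (rule that)
qed

text \<open>The defining property speaks only about domains of adapted coordinates. As these cover
  the plane and the coordinate fields span every tangent space, it determines \<Gamma> at each point
  by bilinearity.\<close>

lemma associated_connection_eq:
  assumes web: "veronese_web F"
  shows "associated_connection F = web_connection F"
  unfolding associated_connection_def
proof (rule the_equality[where P = "is_associated_connection F"])
  show "is_associated_connection F (web_connection F)" using web by (rule is_associated_web_connection)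
  fix \<Gamma> assume \<Gamma>: "is_associated_connection F \<Gamma>"
  show "\<Gamma> = web_connection F"
  proof
    fix q
    obtain U \<phi> w where q: "q \<in> U" and ad: "adapted_coordinates F 1 U \<phi> w"
      using web by (rule adapted_coordinates_exist)
    have co: "coordinates_on U \<phi>" using ad by (simp add: adapted_coordinates_def)
    let ?X = "coord_field U \<phi> (1, 0)" and ?Y = "coord_field U \<phi> (0, 1)"
    have "cov_deriv \<Gamma> ?X ?X q = cov_deriv (web_connection F) ?X ?X q"
      "cov_deriv \<Gamma> ?X ?Y q = cov_deriv (web_connection F) ?X ?Y q"
      "cov_deriv \<Gamma> ?Y ?X q = cov_deriv (web_connection F) ?Y ?X q"
      "cov_deriv \<Gamma> ?Y ?Y q = cov_deriv (web_connection F) ?Y ?Y q"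
      using \<Gamma> is_associated_web_connection[OF web] ad q
      unfolding is_associated_connection_def Let_def by (metis zero_neq_one)+
    then have eq: "blinfun_apply (blinfun_apply (\<Gamma> q) u) v = blinfun_apply (blinfun_apply (web_connection F q) u) v"
      if "u = ?X q \<or> u = ?Y q" "v = ?X q \<or> v = ?Y q" for u v
      using that by (auto simp: cov_deriv_def)
    show "\<Gamma> q = web_connection F q"
    proof (intro blinfun_eqI)
      fix u v
      show "blinfun_apply (blinfun_apply (\<Gamma> q) u) v = blinfun_apply (blinfun_apply (web_connection F q) u) v"
        by (subst (1 2) coord_field_decomposition[OF co q, of u], subst (1 2) coord_field_decomposition[OF co q, of v])
          (simp add: blinfun.add_left blinfun.add_right blinfun.scaleR_left blinfun.scaleR_right eq)
    qed
  qed
qed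

text \<open>Brings the description by all finite parameters under the results on adapted
  coordinates. At t = \<open>t\<^sub>0\<close> the given form is \<open>t\<^sub>0\<close> times dw,
  which explains the kernel of dw.\<close>

lemma web_given_by_adapted:
  assumes web: "veronese_web F" and t\<^sub>0: "t\<^sub>0 \<noteq> 0" and gb: "web_given_by F t\<^sub>0 U \<phi> w"
  shows "adapted_coordinates F t\<^sub>0 U \<phi> w"
proof -
  have co: "coordinates_on U \<phi>" and w: "smooth_on U w" using gb by (auto simp: web_given_by_def)
  note c = coordinates_onD[OF co]
  show ?thesis unfolding adapted_coordinates_def
  proof (intro conjI ballI co w)
    fix q assume q: "q \<in> U"
    note fs = frechet_derivative_fst_snd[OF c(4) q]
    show nz: "partial_x U \<phi> w q \<noteq> 0" "partial_y U \<phi> w q \<noteq> 0" using gb q by (auto simp: web_given_by_def)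
    let ?\<eta>\<^sub>0 = "t\<^sub>0 *\<^sub>R coframe_x U \<phi> w q" and ?\<eta>\<^sub>1 = "coframe_y U \<phi> w q"
    have \<eta>: "blinfun_apply ?\<eta>\<^sub>0 v = t\<^sub>0 * partial_x U \<phi> w q * fst (frechet_derivative \<phi> (at q) v)"
      "blinfun_apply ?\<eta>\<^sub>1 v = partial_y U \<phi> w q * snd (frechet_derivative \<phi> (at q) v)" for v
      by (simp_all add: blinfun.scaleR_left coframe_apply[OF co q])
    have T: "v \<in> tangent_space (F (proj_point 1 t)) q \<longleftrightarrow> blinfun_apply ?\<eta>\<^sub>0 v + t * blinfun_apply ?\<eta>\<^sub>1 v = 0" for t v
    proof -
      have "tangent_space (F (proj_point 1 t)) q = {v. t\<^sub>0 * partial_x U \<phi> w q * fst (frechet_derivative \<phi> (at q) v) +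
          t * partial_y U \<phi> w q * snd (frechet_derivative \<phi> (at q) v) = 0}"
        using gb q unfolding web_given_by_def fs[symmetric] by blast
      then show ?thesis unfolding \<eta> by (simp add: mult.assoc)
    qed
    show "tangent_space (F (proj_point 1 0)) q = {v. frechet_derivative (\<lambda>p. fst (\<phi> p)) (at q) v = 0}"
      using T[of _ 0] t\<^sub>0 nz by (auto simp: \<eta> fs)
    show "tangent_space (F (proj_point 1 t\<^sub>0)) q = {v. frechet_derivative w (at q) v = 0}"
      using T[of _ t\<^sub>0] t\<^sub>0 derivative_in_coordinates[OF co w q]
      by (auto simp: \<eta> mult.assoc distrib_left[symmetric])
    obtain V \<omega>\<^sub>0 \<omega>\<^sub>1 where V: "q \<in> V" "web_frame F V \<omega>\<^sub>0 \<omega>\<^sub>1" using web by (rule veronese_web_frame)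
    have det\<omega>: "form_det (\<omega>\<^sub>0 q) (\<omega>\<^sub>1 q) \<noteq> 0" using V by (simp add: web_frame_def)
    have ker\<omega>: "v \<in> tangent_space (F (proj_point s t)) q \<longleftrightarrow>
        s * blinfun_apply (\<omega>\<^sub>0 q) v + t * blinfun_apply (\<omega>\<^sub>1 q) v = 0" if "(s, t) \<noteq> (0, 0)" for s t v
      using V that unfolding web_frame_def by blast
    have imp: "blinfun_apply ?\<eta>\<^sub>0 v + t * blinfun_apply ?\<eta>\<^sub>1 v = 0"
      if "blinfun_apply (\<omega>\<^sub>0 q) v + t * blinfun_apply (\<omega>\<^sub>1 q) v = 0" for t v
      using that T[of v t] ker\<omega>[of 1 t v] by simp
    \<comment> \<open>\<open>TF\<^sub>\<infinity>\<close> is not among the given kernels; it is recovered from those of \<open>\<F>\<^sub>1\<close>, \<open>\<F>\<^sub>-\<^sub>1\<close> and \<open>\<F>\<^sub>0\<close>\<close>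
    have "\<exists>f. ?\<eta>\<^sub>0 + ?\<eta>\<^sub>1 = f *\<^sub>R (\<omega>\<^sub>0 q + \<omega>\<^sub>1 q) \<and> ?\<eta>\<^sub>0 - ?\<eta>\<^sub>1 = f *\<^sub>R (\<omega>\<^sub>0 q - \<omega>\<^sub>1 q)"
    proof (rule forms_proportional[where c = 1])
      have "form_det (\<omega>\<^sub>0 q + \<omega>\<^sub>1 q) (\<omega>\<^sub>0 q - \<omega>\<^sub>1 q) = - 2 * form_det (\<omega>\<^sub>0 q) (\<omega>\<^sub>1 q)"
        by (simp add: form_det_def blinfun.add_left blinfun.diff_left algebra_simps)
      then show "form_det (\<omega>\<^sub>0 q + \<omega>\<^sub>1 q) (\<omega>\<^sub>0 q - \<omega>\<^sub>1 q) \<noteq> 0" using det\<omega> by simp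
      show "blinfun_apply (?\<eta>\<^sub>0 + ?\<eta>\<^sub>1) v = 0" if "blinfun_apply (\<omega>\<^sub>0 q + \<omega>\<^sub>1 q) v = 0" for v
        using imp[of v 1] that by (simp add: blinfun.add_left)
      show "blinfun_apply (?\<eta>\<^sub>0 - ?\<eta>\<^sub>1) v = 0" if "blinfun_apply (\<omega>\<^sub>0 q - \<omega>\<^sub>1 q) v = 0" for v
        using imp[of v "-1"] that by (simp add: blinfun.diff_left)
      show "blinfun_apply (?\<eta>\<^sub>0 + ?\<eta>\<^sub>1 + 1 *\<^sub>R (?\<eta>\<^sub>0 - ?\<eta>\<^sub>1)) v = 0"
        if "blinfun_apply (\<omega>\<^sub>0 q + \<omega>\<^sub>1 q + 1 *\<^sub>R (\<omega>\<^sub>0 q - \<omega>\<^sub>1 q)) v = 0" for v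
        using imp[of v 0] that by (simp add: blinfun.add_left blinfun.diff_left)
    qed simp
    then obtain f where f: "?\<eta>\<^sub>0 + ?\<eta>\<^sub>1 = f *\<^sub>R (\<omega>\<^sub>0 q + \<omega>\<^sub>1 q)" "?\<eta>\<^sub>0 - ?\<eta>\<^sub>1 = f *\<^sub>R (\<omega>\<^sub>0 q - \<omega>\<^sub>1 q)" by blast
    have f\<eta>\<^sub>1: "blinfun_apply ?\<eta>\<^sub>1 v = f * blinfun_apply (\<omega>\<^sub>1 q) v" for v
      using arg_cong[OF f(1), of "\<lambda>\<alpha>. blinfun_apply \<alpha> v"] arg_cong[OF f(2), of "\<lambda>\<alpha>. blinfun_apply \<alpha> v"]
      by (simp add: blinfun.add_left blinfun.diff_left blinfun.scaleR_left algebra_simps)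
    have "blinfun_apply ?\<eta>\<^sub>1 (coord_field U \<phi> (0, 1) q) \<noteq> 0"
      using nz(2) by (simp add: \<eta> coord_field_coordinates[OF co q])
    then have "f \<noteq> 0" using f\<eta>\<^sub>1 by auto
    have "v \<in> tangent_space (F (proj_point 0 1)) q \<longleftrightarrow> blinfun_apply ?\<eta>\<^sub>1 v = 0" for v
      using ker\<omega>[of 0 1 v] f\<eta>\<^sub>1[of v] \<open>f \<noteq> 0\<close> by simp
    then show "tangent_space (F (proj_point 0 1)) q = {v. frechet_derivative (\<lambda>p. snd (\<phi> p)) (at q) v = 0}"
      using nz by (auto simp: \<eta> fs)
  qed
qed


section \<open>The second order equation of the web\<close>

text \<open>The velocity of a graph in the chart is X + f' Y along the curve. Differentiating this
  and sorting by powers of f' collects the covariant derivatives of the coordinate fields, for an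
  arbitrary connection.\<close>

lemma graph_acceleration:
  fixes f :: "real \<Rightarrow> real"
  defines "f' \<equiv> \<lambda>x. vector_derivative f (at x)"
  assumes co: "coordinates_on U \<phi>" and I: "open I" and f: "smooth_on I f" and graph: "\<And>x. x \<in> I \<Longrightarrow> (x, f x) \<in> \<phi> ` U"
    and x: "x \<in> I"
    and \<sigma>: "\<sigma> = (\<lambda>x. inv_into U \<phi> (x, f x))" and X: "X = coord_field U \<phi> (1, 0)" and Y: "Y = coord_field U \<phi> (0, 1)"
  shows "smooth_on I \<sigma>" "velocity \<sigma> x = X (\<sigma> x) + f' x *\<^sub>R Y (\<sigma> x)"
    "acceleration \<Gamma> \<sigma> x = cov_deriv \<Gamma> X X (\<sigma> x) + f' x *\<^sub>R (cov_deriv \<Gamma> X Y (\<sigma> x) + cov_deriv \<Gamma> Y X (\<sigma> x)) +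
       (f' x)\<^sup>2 *\<^sub>R cov_deriv \<Gamma> Y Y (\<sigma> x) + vector_derivative f' (at x) *\<^sub>R Y (\<sigma> x)"
proof -
  note c = coordinates_onD[OF co]
  have smz: "smooth_on I (\<lambda>x. (x, f x))" by (intro smooth_on_Pair smooth_on_ident I f)
  have sub: "(\<lambda>x. (x, f x)) ` I \<subseteq> \<phi> ` U" using graph by auto
  have z': "velocity (\<lambda>x. (x, f x)) x = (1, f' x)" if "x \<in> I" for x
  proof (rule vector_derivative_at)
    have "(f has_derivative (\<lambda>h. h *\<^sub>R f' x)) (at x)"
      using smooth_on_has_vector_derivative[OF f that] by (simp add: has_vector_derivative_def f'_def)
    from has_derivative_Pair[OF has_derivative_ident this]
    show "((\<lambda>x. (x, f x)) has_vector_derivative (1, f' x)) (at x)"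
      by (simp add: has_vector_derivative_def)
  qed
  show sm: "smooth_on I \<sigma>" unfolding \<sigma> using smooth_on_coordinate_curve(1)[OF co I smz sub] .
  have \<sigma>U: "\<sigma> x \<in> U" "\<phi> (\<sigma> x) = (x, f x)" if "x \<in> I" for x
    using graph[OF that] by (auto simp: \<sigma> inv_into_into f_inv_into_f)
  have v: "velocity \<sigma> x = X (\<sigma> x) + f' x *\<^sub>R Y (\<sigma> x)" if x: "x \<in> I" for x
  proof -
    have "velocity \<sigma> x = frechet_derivative (inv_into U \<phi>) (at (x, f x)) (1, f' x)"
      unfolding \<sigma> using smooth_on_coordinate_curve(2)[OF co I smz sub x] z'[OF x] by simp
    also have "(1, f' x) = (1, 0) + f' x *\<^sub>R (0, 1)" by simp
    finally show ?thesis
      using graph[OF x] by (simp only: frechet_derivative_linear[OF c(5)] X Y coord_field_def \<sigma>U[OF x])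
  qed
  then show "velocity \<sigma> x = X (\<sigma> x) + f' x *\<^sub>R Y (\<sigma> x)" using x by blast
  have smXY: "smooth_on U X" "smooth_on U Y" unfolding X Y by (rule smooth_on_coord_field[OF co])+
  note linX = frechet_derivative_linear[OF smXY(1) \<sigma>U(1)[OF x]] and linY = frechet_derivative_linear[OF smXY(2) \<sigma>U(1)[OF x]]
  have D: "((\<lambda>x. A (\<sigma> x)) has_vector_derivative frechet_derivative A (at (\<sigma> x)) (velocity \<sigma> x)) (at x)"
    if "smooth_on U A" for A :: "plane \<Rightarrow> plane"
  proof -
    have "(\<sigma> has_derivative (\<lambda>h. h *\<^sub>R velocity \<sigma> x)) (at x)"
      using smooth_on_has_vector_derivative[OF sm x] by (simp add: has_vector_derivative_def)
    from has_derivative_compose[OF this smooth_on_has_derivative[OF that \<sigma>U(1)[OF x]]]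
    show ?thesis by (simp add: has_vector_derivative_def frechet_derivative_linear[OF that \<sigma>U(1)[OF x]])
  qed
  have f'': "(f' has_real_derivative vector_derivative f' (at x)) (at x)"
    using smooth_on_has_vector_derivative[OF smooth_on_vector_derivative[OF I f] x]
    by (simp add: f'_def has_real_derivative_iff_has_vector_derivative)
  have "((\<lambda>x. X (\<sigma> x) + f' x *\<^sub>R Y (\<sigma> x)) has_vector_derivative
      frechet_derivative X (at (\<sigma> x)) (velocity \<sigma> x) +
      (f' x *\<^sub>R frechet_derivative Y (at (\<sigma> x)) (velocity \<sigma> x) + vector_derivative f' (at x) *\<^sub>R Y (\<sigma> x))) (at x)"
    by (intro has_vector_derivative_add has_vector_derivative_scaleR f'' D smXY)
  then have "(velocity \<sigma> has_vector_derivative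
      frechet_derivative X (at (\<sigma> x)) (velocity \<sigma> x) +
      (f' x *\<^sub>R frechet_derivative Y (at (\<sigma> x)) (velocity \<sigma> x) + vector_derivative f' (at x) *\<^sub>R Y (\<sigma> x))) (at x)"
    using I x by (rule has_vector_derivative_transform_within_open) (simp add: v)
  from vector_derivative_at[OF this]
  show "acceleration \<Gamma> \<sigma> x = cov_deriv \<Gamma> X X (\<sigma> x) + f' x *\<^sub>R (cov_deriv \<Gamma> X Y (\<sigma> x) + cov_deriv \<Gamma> Y X (\<sigma> x)) +
       (f' x)\<^sup>2 *\<^sub>R cov_deriv \<Gamma> Y Y (\<sigma> x) + vector_derivative f' (at x) *\<^sub>R Y (\<sigma> x)"
    by (simp add: acceleration_def v[OF x] cov_deriv_def linX linY blinfun.add_left blinfun.add_right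
        blinfun.scaleR_left blinfun.scaleR_right scaleR_add_right power2_eq_square)
qed

text \<open>An unparametrised geodesic is only a set, so any geodesic with the graph as image must
  be compared with \<sigma>. It is \<sigma> composed with a smooth y having y' nonzero, and
  \<open>acceleration_compose\<close> then makes the acceleration of \<sigma> tangential. Conversely
  a pregeodesic has an affine reparametrisation with the same image.\<close>

lemma graph_geodesic_iff_pregeodesic:
  fixes f :: "real \<Rightarrow> real"
  assumes \<Gamma>: "linear_connection \<Gamma>" and co: "coordinates_on U \<phi>" and I: "open_interval I"
    and graph: "\<And>x. x \<in> I \<Longrightarrow> (x, f x) \<in> \<phi> ` U" and \<sigma>: "\<sigma> = (\<lambda>x. inv_into U \<phi> (x, f x))"
    and sm: "smooth_on I \<sigma>" and nz: "\<And>x. x \<in> I \<Longrightarrow> velocity \<sigma> x \<noteq> 0"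
  shows "\<sigma> ` I \<in> unparametrised_geodesics \<Gamma> \<longleftrightarrow> (\<forall>x\<in>I. \<exists>k. acceleration \<Gamma> \<sigma> x = k *\<^sub>R velocity \<sigma> x)"
proof
  note c = coordinates_onD[OF co]
  have Io: "open I" using I by (rule open_intervalD)
  have \<sigma>U: "\<sigma> x \<in> U" "\<phi> (\<sigma> x) = (x, f x)" if "x \<in> I" for x
    using graph[OF that] by (auto simp: \<sigma> inv_into_into f_inv_into_f)
  {
    assume "\<sigma> ` I \<in> unparametrised_geodesics \<Gamma>"
    then obtain J \<gamma> where \<gamma>: "geodesic \<Gamma> J \<gamma>" "\<gamma> ` J = \<sigma> ` I" unfolding unparametrised_geodesics_def by blast
    have J: "open J" "smooth_on J \<gamma>" using \<gamma>(1) by (auto simp: geodesic_iff dest: open_intervalD)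
    \<comment> \<open>On a graph the parameter is the first coordinate of the point, so the change
      of parameter is read off smoothly although only the images are known to agree.\<close>
    define y where "y \<tau> = fst (\<phi> (\<gamma> \<tau>))" for \<tau>
    have y: "y \<tau> \<in> I" "\<gamma> \<tau> = \<sigma> (y \<tau>)" "\<gamma> \<tau> \<in> U" if "\<tau> \<in> J" for \<tau>
    proof -
      have "\<gamma> \<tau> \<in> \<gamma> ` J" using that by (rule imageI)
      with \<gamma>(2) have "\<gamma> \<tau> \<in> \<sigma> ` I" by simp
      then obtain s where s: "\<gamma> \<tau> = \<sigma> s" "s \<in> I" by (rule imageE)
      have "\<phi> (\<gamma> \<tau>) = (s, f s)" "\<sigma> s \<in> U" using \<sigma>U[OF s(2)] s(1) by simp_all
      then show "y \<tau> \<in> I" "\<gamma> \<tau> = \<sigma> (y \<tau>)" "\<gamma> \<tau> \<in> U" using s by (simp_all add: y_def)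
    qed
    have "smooth_on J (\<lambda>\<tau>. \<phi> (\<gamma> \<tau>))"
      by (rule smooth_on_compose[OF J(1) c(1) _ c(4) J(2)]) (use y in auto)
    then have smy: "smooth_on J y" unfolding y_def by (intro smooth_on_fst J(1))
    have yI: "y ` J \<subseteq> I" using y by auto
    show "\<forall>x\<in>I. \<exists>k. acceleration \<Gamma> \<sigma> x = k *\<^sub>R velocity \<sigma> x"
    proof
      fix x assume x: "x \<in> I"
      then have "\<sigma> x \<in> \<gamma> ` J" using \<gamma>(2) by simp
      then obtain \<tau> where \<tau>: "\<tau> \<in> J" "\<gamma> \<tau> = \<sigma> x" by force
      have y\<tau>: "y \<tau> = x" using \<tau>(2) \<sigma>U[OF x] by (simp add: y_def)
      have geo: "velocity \<gamma> \<tau> \<noteq> 0" "acceleration \<Gamma> \<gamma> \<tau> = 0" using \<gamma>(1) \<tau>(1) by (auto simp: geodesic_iff)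
      define a where "a = vector_derivative y (at \<tau>)"
      define b where "b = vector_derivative (\<lambda>\<tau>. vector_derivative y (at \<tau>)) (at \<tau>)"
      have "a \<noteq> 0"
        using velocity_compose[OF J(1) sm smy yI y(2) \<tau>(1)] geo(1) by (auto simp: a_def)
      have "b *\<^sub>R velocity \<sigma> x + a\<^sup>2 *\<^sub>R acceleration \<Gamma> \<sigma> x = 0"
        using acceleration_compose[OF J(1) Io sm smy yI y(2) \<tau>(1), of \<Gamma>] geo(2) y\<tau> by (simp add: a_def b_def)
      then have "a\<^sup>2 *\<^sub>R acceleration \<Gamma> \<sigma> x = (- b) *\<^sub>R velocity \<sigma> x" by (simp add: eq_neg_iff_add_eq_0 add.commute)
      then have "inverse (a\<^sup>2) *\<^sub>R a\<^sup>2 *\<^sub>R acceleration \<Gamma> \<sigma> x = inverse (a\<^sup>2) *\<^sub>R (- b) *\<^sub>R velocity \<sigma> x" by simp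
      then have "acceleration \<Gamma> \<sigma> x = (inverse (a\<^sup>2) * - b) *\<^sub>R velocity \<sigma> x" using \<open>a \<noteq> 0\<close> by simp
      then show "\<exists>k. acceleration \<Gamma> \<sigma> x = k *\<^sub>R velocity \<sigma> x" by blast
    qed
  next
    assume par: "\<forall>x\<in>I. \<exists>k. acceleration \<Gamma> \<sigma> x = k *\<^sub>R velocity \<sigma> x"
    obtain \<rho> T where \<rho>: "geodesic \<Gamma> (T ` I) \<rho>" "smooth_on I T" "\<And>x. x \<in> I \<Longrightarrow> \<rho> (T x) = \<sigma> x"
      by (rule pregeodesic_reparametrisation[OF \<Gamma> I sm nz bspec[OF par]]) (assumption | rule that)+
    have "\<sigma> ` I = \<rho> ` (T ` I)" using \<rho>(3) by (force simp: image_image)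
    then show "\<sigma> ` I \<in> unparametrised_geodesics \<Gamma>" using \<rho>(1) unfolding unparametrised_geodesics_def by blast
  }
qed

text \<open>In adapted coordinates the mixed covariant derivatives vanish and those of X along X and
  Y along Y are multiples of X and Y. This is why the equation has only a linear and a quadratic
  term in y'.\<close>

lemma web_geodesic_ode:
  assumes web: "veronese_web F" and t\<^sub>0: "t\<^sub>0 \<noteq> 0" and ad: "adapted_coordinates F t\<^sub>0 U \<phi> w"
  shows "geodesic_ode (web_connection F) U \<phi> (web_ode_rhs U \<phi> w)"
  unfolding geodesic_ode_def
proof (intro allI impI)
  fix I and f :: "real \<Rightarrow> real"
  assume *: "open_interval I \<and> smooth_on I f \<and> (\<forall>x\<in>I. (x, f x) \<in> \<phi> ` U)"
  then have I: "open_interval I" and f: "smooth_on I f" and graph: "\<And>x. x \<in> I \<Longrightarrow> (x, f x) \<in> \<phi> ` U" by auto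
  have Io: "open I" using I by (rule open_intervalD)
  have co: "coordinates_on U \<phi>" using ad by (simp add: adapted_coordinates_def)
  let ?\<Gamma> = "web_connection F"
  define \<sigma> where "\<sigma> = (\<lambda>x. inv_into U \<phi> (x, f x))"
  define X where "X = coord_field U \<phi> (1, 0)"
  define Y where "Y = coord_field U \<phi> (0, 1)"
  define f' where "f' x = vector_derivative f (at x)" for x
  note ga = graph_acceleration[OF co Io f graph _ \<sigma>_def X_def Y_def, folded f'_def]
  have \<sigma>U: "\<sigma> x \<in> U" if "x \<in> I" for x
    using graph[OF that] by (simp add: \<sigma>_def inv_into_into)
  have deriv: "deriv f x = f' x" "deriv (deriv f) x = vector_derivative f' (at x)" if "x \<in> I" for x
  proof -
    have d: "deriv f x = f' x" if "x \<in> I" for x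
      using smooth_on_has_vector_derivative[OF f that]
      by (intro DERIV_imp_deriv) (simp add: f'_def has_real_derivative_iff_has_vector_derivative)
    have "(f' has_vector_derivative vector_derivative f' (at x)) (at x)"
      using smooth_on_has_vector_derivative[OF smooth_on_vector_derivative[OF Io f] that] by (simp add: f'_def[abs_def])
    then have "(deriv f has_vector_derivative vector_derivative f' (at x)) (at x)"
      using Io that by (rule has_vector_derivative_transform_within_open) (simp add: d)
    then show "deriv (deriv f) x = vector_derivative f' (at x)"
      by (intro DERIV_imp_deriv) (simp add: has_real_derivative_iff_has_vector_derivative)
    show "deriv f x = f' x" using that by (rule d)
  qed
  have iff: "(\<exists>k. acceleration ?\<Gamma> \<sigma> x = k *\<^sub>R velocity \<sigma> x) \<longleftrightarrow>
      deriv (deriv f) x = web_ode_rhs U \<phi> w (x, f x) (deriv f x)" and nz: "velocity \<sigma> x \<noteq> 0" if x: "x \<in> I" for x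
  proof -
    note q = \<sigma>U[OF x]
    define w_x w_y where "w_x = partial_x U \<phi> w (\<sigma> x)" and "w_y = partial_y U \<phi> w (\<sigma> x)"
    define w_xx w_xy w_yy where "w_xx = partial_x U \<phi> (partial_x U \<phi> w) (\<sigma> x)"
      and "w_xy = partial_y U \<phi> (partial_x U \<phi> w) (\<sigma> x)" and "w_yy = partial_y U \<phi> (partial_y U \<phi> w) (\<sigma> x)"
    have w0: "w_x \<noteq> 0" "w_y \<noteq> 0" using ad q by (auto simp: adapted_coordinates_def w_x_def w_y_def)
    define A where "A = (w_y * w_xx - w_x * w_xy) / (w_x * w_y)"
    define B where "B = (w_x * w_yy - w_y * w_xy) / (w_x * w_y)"
    note wc = web_connection_adapted[OF web t\<^sub>0 ad q, folded X_def Y_def w_x_def w_y_def w_xx_def w_xy_def w_yy_def,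
        folded A_def B_def]
    have acc: "acceleration ?\<Gamma> \<sigma> x = A *\<^sub>R X (\<sigma> x) + ((f' x)\<^sup>2 * B + vector_derivative f' (at x)) *\<^sub>R Y (\<sigma> x)"
      using ga(3)[OF _ x, of ?\<Gamma>] by (simp add: wc scaleR_add_left)
    have vel: "k *\<^sub>R velocity \<sigma> x = k *\<^sub>R X (\<sigma> x) + (k * f' x) *\<^sub>R Y (\<sigma> x)" for k
      using ga(2)[OF _ x] by (simp add: scaleR_add_right)
    note eq_iff = coord_field_eq_iff[OF co q, folded X_def Y_def]
    \<comment> \<open>Comparing the coefficients of X forces k = A; the coefficients of Y then give
      the equation.\<close>
    have "(\<exists>k. acceleration ?\<Gamma> \<sigma> x = k *\<^sub>R velocity \<sigma> x) \<longleftrightarrow> (f' x)\<^sup>2 * B + vector_derivative f' (at x) = A * f' x"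
      unfolding acc vel eq_iff by auto
    also have "\<dots> \<longleftrightarrow> vector_derivative f' (at x) = A * f' x - (f' x)\<^sup>2 * B" by auto
    also have "A * f' x - (f' x)\<^sup>2 * B = web_ode_rhs U \<phi> w (x, f x) (f' x)"
      using w0 unfolding web_ode_rhs_def Let_def
      by (simp add: \<sigma>_def[THEN fun_cong, symmetric] w_x_def[symmetric] w_y_def[symmetric] w_xx_def[symmetric]
          w_xy_def[symmetric] w_yy_def[symmetric] A_def B_def field_simps)
    finally show "(\<exists>k. acceleration ?\<Gamma> \<sigma> x = k *\<^sub>R velocity \<sigma> x) \<longleftrightarrow>
      deriv (deriv f) x = web_ode_rhs U \<phi> w (x, f x) (deriv f x)" by (simp add: deriv[OF x])
    have "1 *\<^sub>R X (\<sigma> x) + f' x *\<^sub>R Y (\<sigma> x) \<noteq> 0 *\<^sub>R X (\<sigma> x) + 0 *\<^sub>R Y (\<sigma> x)" unfolding eq_iff by simp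
    then show "velocity \<sigma> x \<noteq> 0" using vel[of 1] by simp
  qed
  obtain x where "x \<in> I" using open_intervalD(3)[OF I] by blast
  then have sm: "smooth_on I \<sigma>" using ga(1) by blast
  have "\<sigma> ` I \<in> unparametrised_geodesics ?\<Gamma> \<longleftrightarrow> (\<forall>x\<in>I. \<exists>k. acceleration ?\<Gamma> \<sigma> x = k *\<^sub>R velocity \<sigma> x)"
    by (rule graph_geodesic_iff_pregeodesic[OF linear_connection_web_connection[OF web] co I graph \<sigma>_def sm nz])
  then show "(\<lambda>x. inv_into U \<phi> (x, f x)) ` I \<in> unparametrised_geodesics ?\<Gamma> \<longleftrightarrow>
      (\<forall>x\<in>I. deriv (deriv f) x = web_ode_rhs U \<phi> w (x, f x) (deriv f x))"
    using iff unfolding \<sigma>_def by simp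
qed

theorem proposition3p1:
  fixes F :: "plane set \<Rightarrow> plane set set"
  assumes "veronese_web F"
  shows "projective_structure (\<Union>l\<in>RP1. F l) \<and>
         linear_connection (associated_connection F) \<and>
         (\<Union>l\<in>RP1. F l) = maximal_unparametrised_geodesics (associated_connection F) \<and>
         (\<forall>t\<^sub>0 U \<phi> w. t\<^sub>0 \<noteq> 0 \<and> web_given_by F t\<^sub>0 U \<phi> w \<longrightarrow>
            geodesic_ode (associated_connection F) U \<phi> (web_ode_rhs U \<phi> w))"
proof -
  note eq = associated_connection_eq[OF assms]
  have lc: "linear_connection (web_connection F)" using assms by (rule linear_connection_web_connection)
  have leaves: "(\<Union>l\<in>RP1. F l) = maximal_unparametrised_geodesics (web_connection F)"
    using assms by (rule web_leaves_eq_maximal_geodesics)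
  have "projective_structure (\<Union>l\<in>RP1. F l)"
    unfolding projective_structure_def using lc leaves by blast
  then show ?thesis
    unfolding eq using lc leaves web_geodesic_ode[OF assms _ web_given_by_adapted[OF assms]] by blast
qed

end
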